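(* Let $\{S_j\}_{j=1}^N$ be an iterated function system of contractive similitudes on $\mathbb{R}^d$ with self-similar set $K$, and assume that $K$ has positive Lebesgue measure or that the IFS satisfies the weak separation condition. Then $K$ is homeomorphic to the hyperbolic boundary $\partial X$ of $(X,\mathcal{E})$ and to the hyperbolic boundary $\partial X^\diamond$ of $(X,\mathcal{E}^\diamond)$. Furthermore, if the IFS satisfies in addition condition (H) (stated in the context), then the Hölder equivalence holds: with $\alpha=-\log r/a$, there are homeomorphisms $\Phi:\partial X\to K$ and $\Phi^\diamond:\partial X^\diamond\to K$ and a constant $C>0$ such that $$C^{-1}|\Phi(\xi)-\Phi(\eta)|\le\rho_a(\xi,\eta)^\alpha\le C|\Phi(\xi)-\Phi(\eta)|\quad\forall \xi,\eta\in\partial X,$$ and likewise with $(\partial X^\diamond,\rho_a^\diamond,\Phi^\diamond)$ in place of $(\partial X,\rho_a,\Phi)$.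
   Context: **IFS and symbolic space.** $\{S_j\}_{j=1}^N$ are similitudes of $\mathbb{R}^d$ with contraction ratios $0<r_j<1$, i.e. $|S_j(p)-S_j(q)|=r_j|p-q|$. $K$ is the self-similar set: the unique nonempty compact set with $K=\bigcup_{j=1}^N S_j(K)$. $\Sigma^*=\bigcup_{n\ge 0}\{1,\dots,N\}^n$ is the set of finite words, $o$ is the empty word. For $\mathbf{i}=i_1\cdots i_k$ put $S_{\mathbf{i}}=S_{i_1}\circ\cdots\circ S_{i_k}$ ($S_o=\mathrm{id}$) and $r_{\mathbf{i}}=r_{i_1}\cdots r_{i_k}$. Let $r=\min_j r_j$, $\mathcal{J}_0=\{o\}$, and for $n\ge1$ let $\mathcal{J}_n$ be the set of words $j_1\cdots j_k\in\Sigma^*$ (any length $k\ge 1$) with $r_{j_1}\cdots r_{j_k}\le r^n<r_{j_1}\cdots r_{j_{k-1}}$; $\mathcal{J}=\bigcup_{n\ge0}\mathcal{J}_n$ (a disjoint union). For $\mathbf{i}\in\mathcal{J}_n$ write $|\mathbf{i}|=n$ (the level of $\mathbf i$). Words $\mathbf{i},\mathbf{j}\in\mathcal{J}$ are equivalent, $\mathbf{i}\sim\mathbf{j}$, iff $S_{\mathbf{i}}=S_{\mathbf{j}}$ (then $|\mathbf{i}|=|\mathbf{j}|$). $X=\mathcal{J}/\!\sim$; for $x=[\mathbf{i}]\in X$ put $S_x=S_{\mathbf{i}}$, $|x|=|\mathbf{i}|$. **Graphs (edges unordered).** $\mathcal{E}_v$: pairs $(x,y)$ with $|y|=|x|+1$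 such that there are $\mathbf{i}\in x$, $\mathbf{j}\in y$, $\mathbf{k}\in\Sigma^*$ with $\mathbf{j}=\mathbf{i}\mathbf{k}$ (then $x$ is called an ancestor of $y$). $\mathcal{E}_v^+$: pairs $(x,y)$ with $|y|=|x|+1$, $S_x(K)\cap S_y(K)\ne\emptyset$, $x$ not an ancestor of $y$. $\mathcal{E}_h$: pairs $(x,y)$ with $x\neq y$, $|x|=|y|$, $S_x(K)\cap S_y(K)\neq\emptyset$. Set $\mathcal{E}=\mathcal{E}_v\cup\mathcal{E}_h$ and $\mathcal{E}^\diamond=\mathcal{E}_v\cup\mathcal{E}_v^+$. The root of both graphs is $o$; in both graphs the graph distance from $o$ to $x$ equals $|x|$. **Weak separation condition (WSC).** There exist $\gamma>0$ and a compact $D\subset\mathbb{R}^d$ with nonempty interior and $\bigcup_{j=1}^N S_j(D)\subset D$ such that for all $n\ge1$ and $p\in\mathbb{R}^d$, $\#\{S\in\mathcal{A}_n: p\in S(D)\}\le\gamma$, where $\mathcal{A}_n=\{S_{\mathbf{i}}:\mathbf{i}\in\mathcal{J}_n\}$ (a set of maps). **Hyperbolic boundary.** For a connected rooted graph $G$ with graph metric $d$ and $|x|=d(o,x)$, put $|x\wedge y|=\frac12(|x|+|y|-d(x,y))$; $G$ is $\delta$-hyperbolic if $|x\wedge y|\ge\min\{|x\wedge z|,|z\wedge y|\}-\delta$ for all $x,y,z$. Under the hypotheses here, both $(X,\mathcal{E})$ and $(X,\mathcal{E}^\diamond)$ are hyperbolic; fix $\delta>0$ valid for both and $a>0$ with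 $a'=e^{\delta a}-1<\sqrt2-1$. Put $\rho_a(x,y)=e^{-a|x\wedge y|}$ for $x\neq y$ and $\rho_a(x,x)=0$. $\rho_a$ is equivalent to the metric $\theta_a(x,y)=\inf\{\sum_{i=1}^n\rho_a(x_{i-1},x_i): n\ge 1,\ x_0=x,\ x_n=y,\ x_i\in G\}$ (namely $(1-2a')\rho_a\le\theta_a\le\rho_a$). $\widehat G$ is the completion of $G$ under $\rho_a$ (equivalently $\theta_a$), and $\partial G=\widehat G\setminus G$ is the hyperbolic boundary. A geodesic ray is an infinite path $[x_0,x_1,\dots]$ with $x_0=o$ all of whose finite segments are geodesic. For $\xi\ne\eta$ in $\partial G$, $|\xi\wedge\eta|=\inf\lim_{n\to\infty}|x_n\wedge y_n|$ over all geodesic rays $[x_0,x_1,\dots]$, $[y_0,y_1,\dots]$ converging to $\xi$, $\eta$ (the limits exist), $\rho_a(\xi,\eta)=e^{-a|\xi\wedge\eta|}$, and $\rho_a(\xi,\xi)=0$. The boundary and $\rho_a$ for $(X,\mathcal{E})$ are denoted $\partial X,\rho_a$; for $(X,\mathcal{E}^\diamond)$ they are denoted $\partial X^\diamond,\rho_a^\diamond$. **Condition (H).** There is a constant $C'>0$ such that for any integer $n>0$ and $\mathbf{u},\mathbf{v}\in\mathcal{J}_n$, either $S_{\mathbf{u}}(K)\cap S_{\mathbf{v}}(K)\ne\emptyset$ or $|S_{\mathbf{u}}(p)-S_{\mathbf{v}}(q)|\ge C'r^n$ for all $p,q\in K$. *)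

theory Defs
  imports "HOL-Analysis.Analysis"
begin

section \<open>Rooted graphs and their hyperbolic boundary\<close>

text \<open>A graph is given by its vertex set V and its edge set E, a symmetric relation on V
  (an unordered edge is the two ordered pairs it consists of); o is written rt.\<close>

definition connected_graph :: "'v set \<Rightarrow> 'v rel \<Rightarrow> bool" where
  "connected_graph V E \<longleftrightarrow> E \<subseteq> V \<times> V \<and> sym E \<and> (\<forall>x\<in>V. \<forall>y\<in>V. (x, y) \<in> E\<^sup>*)"

text \<open>Only meaningful between vertices joined by a path.\<close>

definition graph_dist :: "'v rel \<Rightarrow> 'v \<Rightarrow> 'v \<Rightarrow> nat" where
  "graph_dist E x y = (LEAST n. (x, y) \<in> E ^^ n)"

definition gromov_product :: "'v rel \<Rightarrow> 'v \<Rightarrow> 'v \<Rightarrow> 'v \<Rightarrow> real" where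
  "gromov_product E rt x y =
     (real (graph_dist E rt x) + real (graph_dist E rt y) - real (graph_dist E x y)) / 2"

definition hyperbolic_graph :: "'v set \<Rightarrow> 'v rel \<Rightarrow> 'v \<Rightarrow> real \<Rightarrow> bool" where
  "hyperbolic_graph V E rt \<delta> \<longleftrightarrow> rt \<in> V \<and> connected_graph V E \<and>
     (\<forall>x\<in>V. \<forall>y\<in>V. \<forall>z\<in>V. gromov_product E rt x y \<ge>
        min (gromov_product E rt x z) (gromov_product E rt z y) - \<delta>)"

definition vis_rho :: "'v rel \<Rightarrow> 'v \<Rightarrow> real \<Rightarrow> 'v \<Rightarrow> 'v \<Rightarrow> real" where
  "vis_rho E rt a x y = (if x = y then 0 else exp (- a * gromov_product E rt x y))"

text \<open>The value 0 outside V is a dummy: the library's locale \<open>Metric_space\<close> asks for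
  symmetry and nonnegativity on the whole type.\<close>

definition vis_theta :: "'v set \<Rightarrow> 'v rel \<Rightarrow> 'v \<Rightarrow> real \<Rightarrow> 'v \<Rightarrow> 'v \<Rightarrow> real" where
  "vis_theta V E rt a x y =
     (if x \<in> V \<and> y \<in> V
      then Inf {(\<Sum>i=1..n::nat. vis_rho E rt a (c (i - 1)) (c i)) | n c.
             n \<ge> 1 \<and> c 0 = x \<and> c n = y \<and> (\<forall>i\<le>n. c i \<in> V)}
      else 0)"

subsection \<open>Completion of a metric space by classes of Cauchy sequences\<close>

definition cauchy_equiv :: "'v set \<Rightarrow> ('v \<Rightarrow> 'v \<Rightarrow> real) \<Rightarrow> (nat \<Rightarrow> 'v) rel" where
  "cauchy_equiv M d = {(s, t). Metric_space.MCauchy M d s \<and> Metric_space.MCauchy M d t \<and>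
     (\<lambda>n. d (s n) (t n)) \<longlonglongrightarrow> 0}"

definition cauchy_completion :: "'v set \<Rightarrow> ('v \<Rightarrow> 'v \<Rightarrow> real) \<Rightarrow> (nat \<Rightarrow> 'v) set set" where
  "cauchy_completion M d = {s. Metric_space.MCauchy M d s} // cauchy_equiv M d"

definition completion_point :: "'v set \<Rightarrow> ('v \<Rightarrow> 'v \<Rightarrow> real) \<Rightarrow> 'v \<Rightarrow> (nat \<Rightarrow> 'v) set" where
  "completion_point M d x = cauchy_equiv M d `` {\<lambda>_. x}"

definition completion_dist ::
  "'v set \<Rightarrow> ('v \<Rightarrow> 'v \<Rightarrow> real) \<Rightarrow> (nat \<Rightarrow> 'v) set \<Rightarrow> (nat \<Rightarrow> 'v) set \<Rightarrow> real" where
  "completion_dist M d \<xi> \<eta> =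
     (if \<xi> \<in> cauchy_completion M d \<and> \<eta> \<in> cauchy_completion M d
      then lim (\<lambda>n. d ((SOME s. s \<in> \<xi>) n) ((SOME t. t \<in> \<eta>) n)) else 0)"

definition completion_topology ::
  "'v set \<Rightarrow> ('v \<Rightarrow> 'v \<Rightarrow> real) \<Rightarrow> (nat \<Rightarrow> 'v) set topology" where
  "completion_topology M d = Metric_space.mtopology (cauchy_completion M d) (completion_dist M d)"

subsection \<open>Hyperbolic boundary\<close>

definition hyp_boundary ::
  "'v set \<Rightarrow> 'v rel \<Rightarrow> 'v \<Rightarrow> real \<Rightarrow> (nat \<Rightarrow> 'v) set set" where
  "hyp_boundary V E rt a =
     cauchy_completion V (vis_theta V E rt a) - completion_point V (vis_theta V E rt a) ` V"

definition hyp_boundary_topology ::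
  "'v set \<Rightarrow> 'v rel \<Rightarrow> 'v \<Rightarrow> real \<Rightarrow> (nat \<Rightarrow> 'v) set topology" where
  "hyp_boundary_topology V E rt a =
     subtopology (completion_topology V (vis_theta V E rt a)) (hyp_boundary V E rt a)"

definition geodesic_ray :: "'v set \<Rightarrow> 'v rel \<Rightarrow> 'v \<Rightarrow> (nat \<Rightarrow> 'v) \<Rightarrow> bool" where
  "geodesic_ray V E rt x \<longleftrightarrow> x 0 = rt \<and> (\<forall>n. x n \<in> V) \<and> (\<forall>n. (x n, x (Suc n)) \<in> E) \<and>
     (\<forall>m n. m \<le> n \<longrightarrow> graph_dist E (x m) (x n) = n - m)"

definition ray_to ::
  "'v set \<Rightarrow> 'v rel \<Rightarrow> 'v \<Rightarrow> real \<Rightarrow> (nat \<Rightarrow> 'v) \<Rightarrow> (nat \<Rightarrow> 'v) set \<Rightarrow> bool" where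
  "ray_to V E rt a x \<xi> \<longleftrightarrow> geodesic_ray V E rt x \<and>
     limitin (completion_topology V (vis_theta V E rt a))
       (\<lambda>n. completion_point V (vis_theta V E rt a) (x n)) \<xi> sequentially"

definition boundary_product ::
  "'v set \<Rightarrow> 'v rel \<Rightarrow> 'v \<Rightarrow> real \<Rightarrow> (nat \<Rightarrow> 'v) set \<Rightarrow> (nat \<Rightarrow> 'v) set \<Rightarrow> real" where
  "boundary_product V E rt a \<xi> \<eta> =
     Inf {lim (\<lambda>n. gromov_product E rt (x n) (y n)) | x y.
            ray_to V E rt a x \<xi> \<and> ray_to V E rt a y \<eta>}"

definition boundary_rho ::
  "'v set \<Rightarrow> 'v rel \<Rightarrow> 'v \<Rightarrow> real \<Rightarrow> (nat \<Rightarrow> 'v) set \<Rightarrow> (nat \<Rightarrow> 'v) set \<Rightarrow> real" where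
  "boundary_rho V E rt a \<xi> \<eta> =
     (if \<xi> = \<eta> then 0 else exp (- a * boundary_product V E rt a \<xi> \<eta>))"

section \<open>Iterated function systems of similitudes\<close>

text \<open>The maps are \<open>S 1, \<dots>, S N\<close> with ratios \<open>\<rho> 1, \<dots>, \<rho> N\<close>; values at other indices are
  irrelevant. Finite words are lists over \<open>{1..N}\<close>.\<close>

definition similitude_ifs ::
  "nat \<Rightarrow> (nat \<Rightarrow> 'a::euclidean_space \<Rightarrow> 'a) \<Rightarrow> (nat \<Rightarrow> real) \<Rightarrow> bool" where
  "similitude_ifs N S \<rho> \<longleftrightarrow> N \<ge> 1 \<and>
     (\<forall>j\<in>{1..N}. 0 < \<rho> j \<and> \<rho> j < 1 \<and> (\<forall>p q. norm (S j p - S j q) = \<rho> j * norm (p - q)))"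

definition self_similar_set ::
  "nat \<Rightarrow> (nat \<Rightarrow> 'a::euclidean_space \<Rightarrow> 'a) \<Rightarrow> 'a set \<Rightarrow> bool" where
  "self_similar_set N S K \<longleftrightarrow> compact K \<and> K \<noteq> {} \<and> K = (\<Union>j\<in>{1..N}. S j ` K)"

definition word_map :: "(nat \<Rightarrow> 'a \<Rightarrow> 'a) \<Rightarrow> nat list \<Rightarrow> 'a \<Rightarrow> 'a" where
  "word_map S w = foldr (\<lambda>j f. S j \<circ> f) w id"

definition word_ratio :: "(nat \<Rightarrow> real) \<Rightarrow> nat list \<Rightarrow> real" where
  "word_ratio \<rho> w = prod_list (map \<rho> w)"

definition min_ratio :: "nat \<Rightarrow> (nat \<Rightarrow> real) \<Rightarrow> real" where
  "min_ratio N \<rho> = Min (\<rho> ` {1..N})"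

definition words_level :: "nat \<Rightarrow> (nat \<Rightarrow> real) \<Rightarrow> nat \<Rightarrow> nat list set" where
  "words_level N \<rho> n =
     (if n = 0 then {[]}
      else {w \<in> lists {1..N}. w \<noteq> [] \<and> word_ratio \<rho> w \<le> min_ratio N \<rho> ^ n \<and>
              min_ratio N \<rho> ^ n < word_ratio \<rho> (butlast w)})"

definition words_J :: "nat \<Rightarrow> (nat \<Rightarrow> real) \<Rightarrow> nat list set" where
  "words_J N \<rho> = (\<Union>n. words_level N \<rho> n)"

definition word_equiv ::
  "nat \<Rightarrow> (nat \<Rightarrow> 'a \<Rightarrow> 'a) \<Rightarrow> (nat \<Rightarrow> real) \<Rightarrow> nat list rel" where
  "word_equiv N S \<rho> =
     {(u, v). u \<in> words_J N \<rho> \<and> v \<in> words_J N \<rho> \<and> word_map S u = word_map S v}"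

definition ifs_vertices ::
  "nat \<Rightarrow> (nat \<Rightarrow> 'a \<Rightarrow> 'a) \<Rightarrow> (nat \<Rightarrow> real) \<Rightarrow> nat list set set" where
  "ifs_vertices N S \<rho> = words_J N \<rho> // word_equiv N S \<rho>"

definition ifs_root :: "nat \<Rightarrow> (nat \<Rightarrow> 'a \<Rightarrow> 'a) \<Rightarrow> (nat \<Rightarrow> real) \<Rightarrow> nat list set" where
  "ifs_root N S \<rho> = word_equiv N S \<rho> `` {[]}"

text \<open>On vertices, neither of the next two depends on the chosen representative.\<close>

definition vertex_map :: "(nat \<Rightarrow> 'a \<Rightarrow> 'a) \<Rightarrow> nat list set \<Rightarrow> 'a \<Rightarrow> 'a" where
  "vertex_map S x = word_map S (SOME w. w \<in> x)"

definition vertex_level :: "nat \<Rightarrow> (nat \<Rightarrow> real) \<Rightarrow> nat list set \<Rightarrow> nat" where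
  "vertex_level N \<rho> x = (THE n. (SOME w. w \<in> x) \<in> words_level N \<rho> n)"

text \<open>In the two vertical relations the pairs are oriented from the upper to the lower level;
  they are symmetrized when the graphs are formed.\<close>

definition vertical_edges ::
  "nat \<Rightarrow> (nat \<Rightarrow> 'a \<Rightarrow> 'a) \<Rightarrow> (nat \<Rightarrow> real) \<Rightarrow> nat list set rel" where
  "vertical_edges N S \<rho> = {(x, y). x \<in> ifs_vertices N S \<rho> \<and> y \<in> ifs_vertices N S \<rho> \<and>
     vertex_level N \<rho> y = vertex_level N \<rho> x + 1 \<and>
     (\<exists>u\<in>x. \<exists>v\<in>y. \<exists>k\<in>lists {1..N}. v = u @ k)}"

definition vertical_plus_edges ::
  "nat \<Rightarrow> (nat \<Rightarrow> 'a \<Rightarrow> 'a) \<Rightarrow> (nat \<Rightarrow> real) \<Rightarrow> 'a set \<Rightarrow> nat list set rel" where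
  "vertical_plus_edges N S \<rho> K = {(x, y). x \<in> ifs_vertices N S \<rho> \<and> y \<in> ifs_vertices N S \<rho> \<and>
     vertex_level N \<rho> y = vertex_level N \<rho> x + 1 \<and>
     vertex_map S x ` K \<inter> vertex_map S y ` K \<noteq> {} \<and> (x, y) \<notin> vertical_edges N S \<rho>}"

definition horizontal_edges ::
  "nat \<Rightarrow> (nat \<Rightarrow> 'a \<Rightarrow> 'a) \<Rightarrow> (nat \<Rightarrow> real) \<Rightarrow> 'a set \<Rightarrow> nat list set rel" where
  "horizontal_edges N S \<rho> K = {(x, y). x \<in> ifs_vertices N S \<rho> \<and> y \<in> ifs_vertices N S \<rho> \<and>
     x \<noteq> y \<and> vertex_level N \<rho> x = vertex_level N \<rho> y \<and>
     vertex_map S x ` K \<inter> vertex_map S y ` K \<noteq> {}}"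

definition sym_closure :: "'v rel \<Rightarrow> 'v rel" where
  "sym_closure R = R \<union> R\<inverse>"

definition ifs_edges ::
  "nat \<Rightarrow> (nat \<Rightarrow> 'a \<Rightarrow> 'a) \<Rightarrow> (nat \<Rightarrow> real) \<Rightarrow> 'a set \<Rightarrow> nat list set rel" where
  "ifs_edges N S \<rho> K = sym_closure (vertical_edges N S \<rho> \<union> horizontal_edges N S \<rho> K)"

definition ifs_diamond_edges ::
  "nat \<Rightarrow> (nat \<Rightarrow> 'a \<Rightarrow> 'a) \<Rightarrow> (nat \<Rightarrow> real) \<Rightarrow> 'a set \<Rightarrow> nat list set rel" where
  "ifs_diamond_edges N S \<rho> K = sym_closure (vertical_edges N S \<rho> \<union> vertical_plus_edges N S \<rho> K)"

text \<open>\<open>card\<close> is harmless here: each level has only finitely many words, so the set is finite.\<close>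

definition weak_separation ::
  "nat \<Rightarrow> (nat \<Rightarrow> 'a::euclidean_space \<Rightarrow> 'a) \<Rightarrow> (nat \<Rightarrow> real) \<Rightarrow> bool" where
  "weak_separation N S \<rho> \<longleftrightarrow>
     (\<exists>\<gamma>::real. \<exists>D. \<gamma> > 0 \<and> compact D \<and> interior D \<noteq> {} \<and> (\<Union>j\<in>{1..N}. S j ` D) \<subseteq> D \<and>
        (\<forall>n\<ge>1. \<forall>p. real (card {f \<in> word_map S ` words_level N \<rho> n. p \<in> f ` D}) \<le> \<gamma>))"

definition condition_H ::
  "nat \<Rightarrow> (nat \<Rightarrow> 'a::euclidean_space \<Rightarrow> 'a) \<Rightarrow> (nat \<Rightarrow> real) \<Rightarrow> 'a set \<Rightarrow> bool" where
  "condition_H N S \<rho> K \<longleftrightarrow>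
     (\<exists>C'>0. \<forall>n>0. \<forall>u\<in>words_level N \<rho> n. \<forall>v\<in>words_level N \<rho> n.
        word_map S u ` K \<inter> word_map S v ` K \<noteq> {} \<or>
        (\<forall>p\<in>K. \<forall>q\<in>K. norm (word_map S u p - word_map S v q) \<ge> C' * min_ratio N \<rho> ^ n))"

end

theory Submission
  imports Defs
begin

text \<open>For vertices x and y let p(x, y) be the deepest level on which they have ancestors that are
  joined by a horizontal chain of at most M cells, with M a fixed constant. A shortest chain of cells
  of level n inside a ball of radius comparable to \<open>r ^ n\<close> consists, up to every second cell, of
  disjoint cells, so a volume count (of copies of K, or of the set D of the weak separation condition)
  bounds its length by such an M. Hence long chains contract to chains of length at most M after
  boundedly many steps upwards, and p is an ultrametric Gromov product up to an additive constant.

  In both graphs the Gromov product differs from p by a bounded amount: going up to level p(x, y),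
  across, and down again bounds the distance from above, and Frink's chain lemma for
  \<open>s ^ (2 * p x y)\<close> bounds it from below. This gives hyperbolicity.

  A point z of K is sent to the class of a ray of vertices whose cells contain z. Since there are only
  finitely many closed cells on each level, points close to z lie only in cells of level l that contain
  z; this makes the map bijective and continuous. As \<open>norm (z - z')\<close> is at most a constant times
  \<open>r ^ p\<close>, its inverse is Hoelder continuous, and condition (H) is the reverse estimate.\<close>

text \<open>Equivalent words form one vertex, so a vertex can have several parents, and its
  ancestors on a given level are not unique. The cells of any two of them contain the cell of the
  vertex and hence meet; statements about ancestors therefore hold only up to one contact of cells.
  This is why the depth at which two vertices separate is measured by chains with a fixed number of
  contacts and not by a last common ancestor.

  The two separation hypotheses enter only through a bound on the number of disjoint cells of one
  level in a ball, and the two graphs only through the number of edges (1 or 2) that can replace a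
  contact. All statements on boundaries are thus proved once for both graphs.

  The chain lemma needs a quasi-metric constant b with b * b at most 2. For \<open>vis_rho\<close>
  the constant is \<open>exp (\<delta> * a)\<close>, and the condition is the hypothesis on a; for
  the powers of s it is met by taking s close to 1. The \<delta> of the theorem is arbitrary and
  serves only to make \<open>vis_theta\<close> a metric comparable to \<open>vis_rho\<close>; all
  further estimates rest on the bounded difference between the Gromov product and p.\<close>

section \<open>Chains for quasi-metrics\<close>

text \<open>Frink's argument: cut the chain at the step where half of its length is reached.\<close>

lemma quasimetric_chain_bound:
  fixes q :: "'v \<Rightarrow> 'v \<Rightarrow> real"
  assumes q0: "\<And>x y. x \<in> V \<Longrightarrow> y \<in> V \<Longrightarrow> 0 \<le> q x y"
    and b: "0 \<le> b" "b\<^sup>2 \<le> 2"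
    and q: "\<And>x y z. x \<in> V \<Longrightarrow> y \<in> V \<Longrightarrow> z \<in> V \<Longrightarrow> q x y \<le> b * max (q x z) (q z y)"
    and c: "\<And>i. i \<le> n \<Longrightarrow> c i \<in> V" and n: "n \<ge> 1"
  shows "q (c 0) (c n) \<le> 2 * (\<Sum>i<n. q (c i) (c (Suc i)))"
  using c n
proof (induction n arbitrary: c rule: less_induct)
  case (less n)
  let ?s = "\<lambda>m. \<Sum>i<m. q (c i) (c (Suc i))"
  define R where "R = ?s n"
  have nn: "0 \<le> q (c i) (c (Suc i))" if "i < n" for i
    using that less.prems(1) q0 by simp
  have R0: "0 \<le> R"
    unfolding R_def using nn by (auto intro: sum_nonneg)
  have step: "q (c i) (c (Suc i)) \<le> R" if "i < n" for i
    unfolding R_def using nn that by (intro member_le_sum) auto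
  have b2: "b * (b * R) \<le> 2 * R"
    using mult_right_mono[OF b(2) R0] by (simp add: power2_eq_square mult.assoc)
  have b1: "b * R \<le> 2 * R"
  proof -
    have "b \<le> 2"
      using b(2) by (smt (verit) power_mono one_power2 power2_nonneg_ge_1_iff real_le_rsqrt real_sqrt_four sqrt_le_D)
    then show ?thesis using R0 by (simp add: mult_right_mono)
  qed
  define p where "p = Max {m. m < n \<and> ?s m \<le> R / 2}"
  have "finite {m. m < n \<and> ?s m \<le> R / 2}" "{m. m < n \<and> ?s m \<le> R / 2} \<noteq> {}"
    using less.prems(2) R0 by (auto intro!: exI[of _ 0])
  then have p: "p < n" "?s p \<le> R / 2" and pmax: "\<And>m. m < n \<Longrightarrow> ?s m \<le> R / 2 \<Longrightarrow> m \<le> p"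
    unfolding p_def using Max_in[of "{m. m < n \<and> ?s m \<le> R / 2}"] by auto
  \<comment> \<open>The pieces before index \<open>p\<close> and after index \<open>Suc p\<close>
    have length at most R / 2, so the induction hypothesis bounds \<open>q\<close> by R on each.
    Empty pieces are set apart because \<open>q\<close> need not vanish on the diagonal; powers of a
    positive number do not.\<close>
  have left: "p = 0 \<or> q (c 0) (c p) \<le> R"
  proof (cases "p = 0")
    case False
    then have "q (c 0) (c p) \<le> 2 * ?s p"
      using less.IH[of p c] less.prems p by auto
    then show ?thesis using p by simp
  qed simp
  have right: "Suc p = n \<or> q (c (Suc p)) (c n) \<le> R"
  proof (cases "Suc p = n")
    case False
    with p have pn: "Suc p < n" by simp
    have "?s (Suc p) > R / 2" using pmax[OF pn] by fastforce
    moreover have "R = ?s (Suc p) + (\<Sum>i<n - Suc p. q (c (Suc p + i)) (c (Suc (Suc p + i))))"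
    proof -
      have "?s n = ?s (Suc p) + (\<Sum>i=Suc p..<n. q (c i) (c (Suc i)))"
        using pn by (metis lessThan_atLeast0 less_or_eq_imp_le sum.atLeastLessThan_concat zero_le)
      moreover have "(\<Sum>i=Suc p..<n. q (c i) (c (Suc i))) = (\<Sum>i=0..<n - Suc p. q (c (i + Suc p)) (c (Suc (i + Suc p))))"
        using sum.shift_bounds_nat_ivl[of "\<lambda>i. q (c i) (c (Suc i))" 0 "Suc p" "n - Suc p"] pn by simp
      ultimately show ?thesis
        unfolding R_def by (simp add: lessThan_atLeast0 add.commute)
    qed
    moreover have "q (c (Suc p + 0)) (c (Suc p + (n - Suc p)))
        \<le> 2 * (\<Sum>i<n - Suc p. q (c (Suc p + i)) (c (Suc p + Suc i)))"
      by (rule less.IH) (use less.prems pn in auto)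
    ultimately show ?thesis using pn by simp
  qed simp
  have V: "c 0 \<in> V" "c p \<in> V" "c (Suc p) \<in> V" "c n \<in> V"
    using less.prems(1) p by auto
  have mid: "q (c p) (c (Suc p)) \<le> R" using step p by simp
  \<comment> \<open>The three pieces are merged by two uses of the quasi-triangle inequality, which
    cost a factor of at most b * b; hence the condition on b.\<close>
  have right': "q (c p) (c n) \<le> max R (b * R)"
  proof (cases "Suc p = n")
    case True with mid show ?thesis by simp
  next
    case False
    have "q (c p) (c n) \<le> b * max (q (c p) (c (Suc p))) (q (c (Suc p)) (c n))"
      using q V by blast
    also have "\<dots> \<le> b * R"
      using False right mid b by (intro mult_left_mono) auto
    finally show ?thesis by simp
  qed
  show ?case
  proof (cases "p = 0")
    case True
    then show ?thesis using right' b1 R0 unfolding R_def by auto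
  next
    case False
    have "q (c 0) (c n) \<le> b * max (q (c 0) (c p)) (q (c p) (c n))"
      using q V by blast
    also have "\<dots> \<le> b * max R (b * R)"
      using False left right' b by (intro mult_left_mono) auto
    also have "\<dots> \<le> 2 * R"
      using b1 b2 by (simp add: max_def)
    finally show ?thesis unfolding R_def .
  qed
qed

section \<open>Graph distance\<close>

lemma graph_dist_le: "(x, y) \<in> E ^^ n \<Longrightarrow> graph_dist E x y \<le> n"
  unfolding graph_dist_def by (rule Least_le)

lemma graph_dist_relpow:
  assumes "(x, y) \<in> E\<^sup>*"
  shows "(x, y) \<in> E ^^ graph_dist E x y"
  unfolding graph_dist_def using rtrancl_imp_relpow[OF assms] by (rule LeastI_ex)

lemma graph_dist_self [simp]: "graph_dist E x x = 0"
  using graph_dist_le[of x x 0 E] by simp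

lemma graph_dist_triangle:
  assumes "(x, y) \<in> E\<^sup>*" "(y, z) \<in> E\<^sup>*"
  shows "graph_dist E x z \<le> graph_dist E x y + graph_dist E y z"
  using relcompI[OF assms[THEN graph_dist_relpow]] by (intro graph_dist_le) (simp add: relpow_add)

lemma relpow_sym:
  assumes "sym E" "(x, y) \<in> E ^^ n"
  shows "(y, x) \<in> E ^^ n"
  using assms(2)
proof (induction n arbitrary: y)
  case (Suc n)
  then obtain z where "(x, z) \<in> E ^^ n" "(z, y) \<in> E" by auto
  then show ?case using Suc.IH assms(1) relpow_Suc_I2 by (metis symD)
qed auto

lemma graph_dist_commute: "sym E \<Longrightarrow> graph_dist E x y = graph_dist E y x"
  unfolding graph_dist_def
  by (rule arg_cong[where f = Least], rule ext, rule iffI) (erule (1) relpow_sym)+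

lemma gromov_product_commute: "sym E \<Longrightarrow> gromov_product E rt x y = gromov_product E rt y x"
  unfolding gromov_product_def using graph_dist_commute by fastforce

lemma sym_sym_closure: "sym (sym_closure R)"
  unfolding sym_closure_def by (rule sym_Un_converse)

section \<open>Completion by classes of Cauchy sequences\<close>

context Metric_space
begin

abbreviation ceq where "ceq \<equiv> cauchy_equiv M d"
abbreviation cdist where "cdist \<equiv> completion_dist M d"
abbreviation cpl where "cpl \<equiv> cauchy_completion M d"

lemma MCauchy_in: "MCauchy s \<Longrightarrow> s n \<in> M"
  unfolding MCauchy_def by auto

lemma MCauchy_dist_convergent:
  assumes "MCauchy s" "MCauchy t"
  shows "convergent (\<lambda>n. d (s n) (t n))"
proof (rule Cauchy_convergent, rule metric_CauchyI)
  fix e :: real assume "e > 0"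
  then obtain N1 N2 where N: "\<And>n n'. N1 \<le> n \<Longrightarrow> N1 \<le> n' \<Longrightarrow> d (s n) (s n') < e / 2"
    "\<And>n n'. N2 \<le> n \<Longrightarrow> N2 \<le> n' \<Longrightarrow> d (t n) (t n') < e / 2"
    using assms unfolding MCauchy_def by (meson half_gt_zero)
  have "dist (d (s m) (t m)) (d (s n) (t n)) < e" if "m \<ge> max N1 N2" "n \<ge> max N1 N2" for m n
  proof -
    have "d (s m) (s n) < e / 2" "d (t m) (t n) < e / 2" using N that by auto
    moreover have "s m \<in> M" "s n \<in> M" "t m \<in> M" "t n \<in> M" using assms MCauchy_in by auto
    moreover have "d (s m) (t m) \<le> d (s m) (s n) + d (s n) (t n) + d (t n) (t m)"
      "d (s n) (t n) \<le> d (s n) (s m) + d (s m) (t m) + d (t m) (t n)"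
      by (smt (verit, best) calculation triangle)+
    ultimately show ?thesis by (simp add: dist_real_def commute)
  qed
  then show "\<exists>N. \<forall>m\<ge>N. \<forall>n\<ge>N. dist (d (s m) (t m)) (d (s n) (t n)) < e" by blast
qed

lemma equiv_cauchy_equiv: "equiv {s. MCauchy s} ceq"
proof (rule equivI)
  show "refl_on {s. MCauchy s} ceq"
    by (auto simp: refl_on_def cauchy_equiv_def MCauchy_in)
  show "ceq \<subseteq> {s. MCauchy s} \<times> {s. MCauchy s}"
    by (auto simp: cauchy_equiv_def)
  show "sym ceq"
    by (auto simp: sym_def cauchy_equiv_def commute)
  show "trans ceq"
  proof (rule transI)
    fix s t u assume *: "(s, t) \<in> ceq" "(t, u) \<in> ceq"
    have "(\<lambda>n. d (s n) (t n) + d (t n) (u n)) \<longlonglongrightarrow> 0 + 0"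
      using * by (intro tendsto_add) (auto simp: cauchy_equiv_def)
    then have "(\<lambda>n. d (s n) (u n)) \<longlonglongrightarrow> 0"
      by (rule tendsto_0_le[where K = 1, OF tendsto_eq_rhs])
        (use * in \<open>auto simp: cauchy_equiv_def MCauchy_in intro!: always_eventually triangle\<close>)
    then show "(s, u) \<in> ceq" using * by (auto simp: cauchy_equiv_def)
  qed
qed

definition cls where "cls s = ceq `` {s}"

lemma cls_in: "MCauchy s \<Longrightarrow> cls s \<in> cpl"
  unfolding cls_def cauchy_completion_def by (simp add: quotientI)

lemma cls_cases:
  assumes "\<xi> \<in> cpl"
  obtains s where "MCauchy s" "\<xi> = cls s"
  using assms unfolding cls_def cauchy_completion_def by (auto elim: quotientE)

lemma cls_eq_iff:
  assumes "MCauchy s" "MCauchy t"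
  shows "cls s = cls t \<longleftrightarrow> (\<lambda>n. d (s n) (t n)) \<longlonglongrightarrow> 0"
  using eq_equiv_class_iff[OF equiv_cauchy_equiv, of s t] assms
  unfolding cls_def by (simp add: cauchy_equiv_def)

lemma dist_tendsto_cong:
  assumes "(s, s') \<in> ceq" "(t, t') \<in> ceq" "(\<lambda>n. d (s n) (t n)) \<longlonglongrightarrow> l"
  shows "(\<lambda>n. d (s' n) (t' n)) \<longlonglongrightarrow> l"
proof -
  have "(\<lambda>n. d (s n) (s' n) + d (t n) (t' n)) \<longlonglongrightarrow> 0 + 0"
    using assms(1,2) by (intro tendsto_add) (auto simp: cauchy_equiv_def)
  then have lim: "(\<lambda>n. d (s n) (s' n) + d (t n) (t' n)) \<longlonglongrightarrow> 0" by simp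
  have "\<bar>d (s' n) (t' n) - d (s n) (t n)\<bar> \<le> d (s n) (s' n) + d (t n) (t' n)" for n
  proof -
    have M: "s n \<in> M" "s' n \<in> M" "t n \<in> M" "t' n \<in> M"
      using assms by (auto simp: cauchy_equiv_def MCauchy_in)
    have "d (s n) (t n) \<le> d (s n) (s' n) + (d (s' n) (t' n) + d (t' n) (t n))"
      "d (s' n) (t' n) \<le> d (s' n) (s n) + (d (s n) (t n) + d (t n) (t' n))"
      using triangle[OF M(1,2,3)] triangle[OF M(2,4,3)] triangle[OF M(2,1,4)] triangle[OF M(1,3,4)]
      by linarith+
    then show ?thesis using commute[of "s' n" "s n"] commute[of "t' n" "t n"] by linarith
  qed
  then have "(\<lambda>n. d (s' n) (t' n) - d (s n) (t n)) \<longlonglongrightarrow> 0"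
    by (intro tendsto_0_le[where K = 1, OF lim] always_eventually) simp
  from tendsto_add[OF this assms(3)] show ?thesis by simp
qed

text \<open>\<open>completion_dist\<close> is defined through chosen representatives; by
  \<open>dist_tendsto_cong\<close> the choice does not affect the limit, so any representatives may
  be used from here on.\<close>

lemma cdist_cls:
  assumes "MCauchy s" "MCauchy t"
  shows "(\<lambda>n. d (s n) (t n)) \<longlonglongrightarrow> cdist (cls s) (cls t)"
proof -
  define s' t' where "s' = (SOME u. u \<in> cls s)" and "t' = (SOME u. u \<in> cls t)"
  have "s \<in> cls s" "t \<in> cls t"
    using assms equiv_class_self[OF equiv_cauchy_equiv] unfolding cls_def by auto
  then have "s' \<in> cls s" "t' \<in> cls t"
    unfolding s'_def t'_def by (metis someI)+
  then have "(s, s') \<in> ceq" "(t, t') \<in> ceq"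
    unfolding cls_def by auto
  moreover obtain l where l: "(\<lambda>n. d (s n) (t n)) \<longlonglongrightarrow> l"
    using MCauchy_dist_convergent[OF assms] convergent_def by blast
  ultimately have "(\<lambda>n. d (s' n) (t' n)) \<longlonglongrightarrow> l"
    by (rule dist_tendsto_cong)
  then have "cdist (cls s) (cls t) = l"
    using cls_in[OF assms(1)] cls_in[OF assms(2)]
    unfolding completion_dist_def s'_def t'_def by (simp add: limI)
  with l show ?thesis by simp
qed

lemma Metric_space_completion: "Metric_space cpl cdist"
proof
  fix \<xi> \<eta>
  show "0 \<le> cdist \<xi> \<eta>"
  proof (cases "\<xi> \<in> cpl \<and> \<eta> \<in> cpl")
    case True
    then obtain s t where "MCauchy s" "\<xi> = cls s" "MCauchy t" "\<eta> = cls t" by (metis cls_cases)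
    then show ?thesis using cdist_cls[of s t] by (auto intro: LIMSEQ_le_const)
  qed (auto simp: completion_dist_def)
  show "cdist \<xi> \<eta> = cdist \<eta> \<xi>"
    by (simp add: completion_dist_def commute)
next
  fix \<xi> \<eta> assume "\<xi> \<in> cpl" "\<eta> \<in> cpl"
  then obtain s t where st: "MCauchy s" "\<xi> = cls s" "MCauchy t" "\<eta> = cls t" by (metis cls_cases)
  then show "cdist \<xi> \<eta> = 0 \<longleftrightarrow> \<xi> = \<eta>"
    using cdist_cls[of s t] cls_eq_iff[of s t] LIMSEQ_unique by metis
next
  fix \<xi> \<eta> \<zeta> assume "\<xi> \<in> cpl" "\<eta> \<in> cpl" "\<zeta> \<in> cpl"
  then obtain s t u where st: "MCauchy s" "\<xi> = cls s" "MCauchy t" "\<eta> = cls t" "MCauchy u" "\<zeta> = cls u"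
    by (metis cls_cases)
  have "(\<lambda>n. d (s n) (t n) + d (t n) (u n)) \<longlonglongrightarrow> cdist \<xi> \<eta> + cdist \<eta> \<zeta>"
    using st cdist_cls by (intro tendsto_add) auto
  then show "cdist \<xi> \<zeta> \<le> cdist \<xi> \<eta> + cdist \<eta> \<zeta>"
    using cdist_cls[of s u] st by (auto intro!: LIMSEQ_le triangle simp: MCauchy_in)
qed

lemma MCauchy_const: "x \<in> M \<Longrightarrow> MCauchy (\<lambda>_. x)"
  unfolding MCauchy_def by auto

lemma completion_point_eq: "completion_point M d x = cls (\<lambda>_. x)"
  unfolding completion_point_def cls_def ..

lemma cdist_point_cls:
  assumes "MCauchy s"
  shows "(\<lambda>n. cdist (cls (\<lambda>_. s n)) (cls s)) \<longlonglongrightarrow> 0"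
proof (rule metric_LIMSEQ_I)
  fix e :: real assume "e > 0"
  then obtain N where N: "\<And>n n'. N \<le> n \<Longrightarrow> N \<le> n' \<Longrightarrow> d (s n) (s n') < e / 2"
    using assms unfolding MCauchy_def by (meson half_gt_zero)
  have "dist (cdist (cls (\<lambda>_. s n)) (cls s)) 0 < e" if "n \<ge> N" for n
  proof -
    have "(\<lambda>m. d (s n) (s m)) \<longlonglongrightarrow> cdist (cls (\<lambda>_. s n)) (cls s)"
      using cdist_cls[OF MCauchy_const assms] assms MCauchy_in by blast
    then have "cdist (cls (\<lambda>_. s n)) (cls s) \<le> e / 2"
      using N that by (intro LIMSEQ_le_const2) (auto intro!: exI[of _ N] less_imp_le)
    then show ?thesis using \<open>e > 0\<close> Metric_space.nonneg[OF Metric_space_completion] by (simp add: dist_real_def)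
  qed
  then show "\<exists>N. \<forall>n\<ge>N. dist (cdist (cls (\<lambda>_. s n)) (cls s)) 0 < e" by blast
qed

lemma limitin_completion_point_cls:
  assumes "MCauchy s"
  shows "limitin (completion_topology M d) (\<lambda>n. completion_point M d (s n)) (cls s) sequentially"
proof -
  interpret C: Metric_space cpl cdist by (rule Metric_space_completion)
  have "cls (\<lambda>_. s n) \<in> cpl" for n
    using assms MCauchy_const MCauchy_in cls_in by blast
  moreover have "\<exists>N. \<forall>n\<ge>N. cdist (cls (\<lambda>_. s n)) (cls s) < e" if "e > 0" for e
    using metric_LIMSEQ_D[OF cdist_point_cls[OF assms] that] by (simp add: dist_real_def)
  ultimately show ?thesis
    unfolding completion_topology_def C.limit_metric_sequentially completion_point_eq
    using assms cls_in by simp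
qed

lemma limitin_completion_pointD:
  assumes "limitin (completion_topology M d) (\<lambda>n. completion_point M d (s n)) \<xi> sequentially"
    and s: "\<And>n. s n \<in> M"
  shows "\<xi> \<in> cpl" "(\<lambda>n. cdist (cls (\<lambda>_. s n)) \<xi>) \<longlonglongrightarrow> 0"
proof -
  interpret C: Metric_space cpl cdist by (rule Metric_space_completion)
  have *: "\<xi> \<in> cpl" "\<forall>\<epsilon>>0. \<exists>N. \<forall>n\<ge>N. cls (\<lambda>_. s n) \<in> cpl \<and> cdist (cls (\<lambda>_. s n)) \<xi> < \<epsilon>"
    using assms unfolding completion_topology_def C.limit_metric_sequentially completion_point_eq
    by auto
  then show "\<xi> \<in> cpl" by simp
  show "(\<lambda>n. cdist (cls (\<lambda>_. s n)) \<xi>) \<longlonglongrightarrow> 0"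
  proof (rule metric_LIMSEQ_I)
    fix e :: real assume "e > 0"
    then obtain N where "\<And>n. n \<ge> N \<Longrightarrow> cdist (cls (\<lambda>_. s n)) \<xi> < e" using *(2) by meson
    then show "\<exists>N. \<forall>n\<ge>N. dist (cdist (cls (\<lambda>_. s n)) \<xi>) 0 < e"
      by (intro exI[of _ N]) (simp add: dist_real_def)
  qed
qed

text \<open>A ray is only known to converge in the completion, not to be a member of the class that
  is its limit. The embedding of M is isometric, and the distance of the completion is
  continuous.\<close>

lemma limitin_completion_point_dist:
  assumes s: "\<And>n. s n \<in> M" and t: "\<And>n. t n \<in> M"
    and "limitin (completion_topology M d) (\<lambda>n. completion_point M d (s n)) \<xi> sequentially"
    and "limitin (completion_topology M d) (\<lambda>n. completion_point M d (t n)) \<eta> sequentially"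
  shows "(\<lambda>n. d (s n) (t n)) \<longlonglongrightarrow> cdist \<xi> \<eta>"
proof -
  interpret C: Metric_space cpl cdist by (rule Metric_space_completion)
  note a = limitin_completion_pointD[OF assms(3) s] and b = limitin_completion_pointD[OF assms(4) t]
  have eq: "d (s n) (t n) = cdist (cls (\<lambda>_. s n)) (cls (\<lambda>_. t n))" for n
    using cdist_cls[OF MCauchy_const MCauchy_const, of "s n" "t n"] s t
    by (simp add: LIMSEQ_const_iff)
  have lim: "(\<lambda>n. cdist (cls (\<lambda>_. s n)) \<xi> + cdist (cls (\<lambda>_. t n)) \<eta>) \<longlonglongrightarrow> 0"
    using tendsto_add[OF a(2) b(2)] by simp
  have "\<bar>d (s n) (t n) - cdist \<xi> \<eta>\<bar> \<le> cdist (cls (\<lambda>_. s n)) \<xi> + cdist (cls (\<lambda>_. t n)) \<eta>" for n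
  proof -
    have M: "cls (\<lambda>_. s n) \<in> cpl" "cls (\<lambda>_. t n) \<in> cpl"
      using s t MCauchy_const cls_in by auto
    show ?thesis unfolding eq
      using C.triangle[OF M(1) a(1) M(2)] C.triangle[OF a(1) b(1) M(2)]
        C.triangle[OF a(1) M(1) b(1)] C.triangle[OF M(1) M(2) b(1)]
        C.commute[of \<xi> "cls (\<lambda>_. s n)"] C.commute[of \<eta> "cls (\<lambda>_. t n)"] by linarith
  qed
  then have "(\<lambda>n. d (s n) (t n) - cdist \<xi> \<eta>) \<longlonglongrightarrow> 0"
    by (intro tendsto_0_le[where K = 1, OF lim] always_eventually) simp
  then show ?thesis by (simp add: LIM_zero_iff)
qed

end

section \<open>The visual metric of a hyperbolic graph\<close>

text \<open>The hypothesis \<open>small\<close> says that the quasi-metric constant of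
  \<open>vis_rho\<close> has square below 2, as the chain lemma demands.\<close>

locale visual_graph =
  fixes V :: "'v set" and E :: "'v rel" and rt :: 'v and \<delta> a :: real
  assumes hyp: "hyperbolic_graph V E rt \<delta>" and \<delta>: "\<delta> > 0" and a: "a > 0"
    and small: "exp (\<delta> * a) < sqrt 2"
begin

abbreviation g where "g \<equiv> gromov_product E rt"
abbreviation qr where "qr \<equiv> vis_rho E rt a"
abbreviation th where "th \<equiv> vis_theta V E rt a"
abbreviation D where "D \<equiv> completion_dist V th"

lemma symE: "sym E"
  and connected: "x \<in> V \<Longrightarrow> y \<in> V \<Longrightarrow> (x, y) \<in> E\<^sup>*"
  using hyp unfolding hyperbolic_graph_def connected_graph_def by auto

lemma g_hyp: "x \<in> V \<Longrightarrow> y \<in> V \<Longrightarrow> z \<in> V \<Longrightarrow> min (g x z) (g z y) - \<delta> \<le> g x y"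
  using hyp unfolding hyperbolic_graph_def by auto

lemma qr_nonneg [simp]: "0 \<le> qr x y" and qr_self [simp]: "qr x x = 0"
  unfolding vis_rho_def by auto

lemma qr_commute: "qr x y = qr y x"
  unfolding vis_rho_def using gromov_product_commute[OF symE, of rt x y] by simp

lemma qr_quasi:
  assumes "x \<in> V" "y \<in> V" "z \<in> V"
  shows "qr x y \<le> exp (\<delta> * a) * max (qr x z) (qr z y)"
proof (cases "x = y \<or> x = z \<or> z = y")
  case True
  have "1 \<le> exp (\<delta> * a)" using \<delta> a by simp
  then show ?thesis
    using True mult_right_mono[of 1 "exp (\<delta> * a)" "qr x y"] by (auto simp: max_def)
next
  case False
  have "- a * g x y \<le> \<delta> * a + max (- a * g x z) (- a * g z y)"
  proof -
    have "a * (min (g x z) (g z y) - \<delta>) \<le> a * g x y"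
      using g_hyp[OF assms] a by (intro mult_left_mono) auto
    then have "a * min (g x z) (g z y) - a * \<delta> \<le> a * g x y"
      by (simp add: right_diff_distrib)
    moreover have "a * min (g x z) (g z y) = min (a * g x z) (a * g z y)"
      using a by (simp add: min_def)
    ultimately show ?thesis by (simp add: max_def min_def mult.commute split: if_splits)
  qed
  then have "exp (- a * g x y) \<le> exp (\<delta> * a) * exp (max (- a * g x z) (- a * g z y))"
    by (metis exp_add exp_le_cancel_iff)
  also have "exp (max (- a * g x z) (- a * g z y)) = max (exp (- a * g x z)) (exp (- a * g z y))"
    by (simp add: max_def)
  finally show ?thesis using False by (simp add: vis_rho_def)
qed

text \<open>The sums in the definition of \<open>vis_theta\<close>, with indices shifted to start at
  0 as in the chain lemma.\<close>

definition chains where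
  "chains x y = {(\<Sum>i<n. qr (c i) (c (Suc i))) | n c.
     n \<ge> 1 \<and> c 0 = x \<and> c n = y \<and> (\<forall>i\<le>n. c i \<in> V)}"

lemma th_eq: "x \<in> V \<Longrightarrow> y \<in> V \<Longrightarrow> th x y = Inf (chains x y)"
  unfolding vis_theta_def chains_def One_nat_def by (simp add: sum.atLeast1_atMost_eq del: One_nat_def)

lemma chain_nonneg: "s \<in> chains x y \<Longrightarrow> 0 \<le> s"
  unfolding chains_def by (auto intro: sum_nonneg)

lemma bdd_chains: "bdd_below (chains x y)"
  using chain_nonneg by (meson bdd_belowI)

lemma edge_chain: "x \<in> V \<Longrightarrow> y \<in> V \<Longrightarrow> qr x y \<in> chains x y"
  unfolding chains_def
  by (auto intro!: exI[of _ 1] exI[of _ "\<lambda>i::nat. if i = 0 then x else y"])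

lemma th_le_qr: "x \<in> V \<Longrightarrow> y \<in> V \<Longrightarrow> th x y \<le> qr x y"
  using th_eq edge_chain bdd_chains cInf_lower by metis

lemma th_le_chain: "x \<in> V \<Longrightarrow> y \<in> V \<Longrightarrow> s \<in> chains x y \<Longrightarrow> th x y \<le> s"
  using th_eq bdd_chains cInf_lower by metis

text \<open>Frink's bound with b = exp (\<delta> * a). It yields the lower constant 1 / 2 for
  \<open>vis_theta\<close> against \<open>vis_rho\<close>, whatever a is; only the comparability of
  the two is used later.\<close>

lemma qr_le_chain:
  assumes "s \<in> chains x y"
  shows "qr x y \<le> 2 * s"
proof -
  obtain n c where c: "n \<ge> 1" "c 0 = x" "c n = y" "\<And>i. i \<le> n \<Longrightarrow> c i \<in> V"
    "s = (\<Sum>i<n. qr (c i) (c (Suc i)))"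
    using assms unfolding chains_def by auto
  have "(exp (\<delta> * a))\<^sup>2 \<le> (sqrt 2)\<^sup>2"
    using small by (intro power_mono) auto
  then have "qr (c 0) (c n) \<le> 2 * (\<Sum>i<n. qr (c i) (c (Suc i)))"
    by (intro quasimetric_chain_bound[where V = V and b = "exp (\<delta> * a)"])
      (use c qr_quasi in auto)
  then show ?thesis using c by simp
qed

lemma qr_le_th: "x \<in> V \<Longrightarrow> y \<in> V \<Longrightarrow> qr x y \<le> 2 * th x y"
proof -
  assume V: "x \<in> V" "y \<in> V"
  have "qr x y / 2 \<le> Inf (chains x y)"
    using edge_chain[OF V] qr_le_chain by (intro cInf_greatest) force+
  then show ?thesis using th_eq[OF V] by simp
qed

lemma chains_rev:
  assumes "s \<in> chains x y"
  shows "s \<in> chains y x"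
proof -
  obtain n c where c: "n \<ge> 1" "c 0 = x" "c n = y" "\<And>i. i \<le> n \<Longrightarrow> c i \<in> V"
    "s = (\<Sum>i<n. qr (c i) (c (Suc i)))"
    using assms unfolding chains_def by auto
  have "s = (\<Sum>i<n. qr (c (n - Suc i)) (c (Suc (n - Suc i))))"
    unfolding c(5) by (rule sum.nat_diff_reindex[symmetric])
  also have "\<dots> = (\<Sum>i<n. qr (c (n - i)) (c (n - Suc i)))"
    by (intro sum.cong refl) (simp add: Suc_diff_Suc qr_commute)
  finally show ?thesis unfolding chains_def using c
    by (auto intro!: exI[of _ n] exI[of _ "\<lambda>i. c (n - i)"])
qed

lemma chains_append:
  assumes "s \<in> chains x y" "t \<in> chains y z"
  shows "s + t \<in> chains x z"
proof -
  obtain n c where c: "n \<ge> 1" "c 0 = x" "c n = y" "\<And>i. i \<le> n \<Longrightarrow> c i \<in> V"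
    "s = (\<Sum>i<n. qr (c i) (c (Suc i)))"
    using assms(1) unfolding chains_def by auto
  obtain m b where b: "m \<ge> 1" "b 0 = y" "b m = z" "\<And>i. i \<le> m \<Longrightarrow> b i \<in> V"
    "t = (\<Sum>i<m. qr (b i) (b (Suc i)))"
    using assms(2) unfolding chains_def by auto
  define e where "e = (\<lambda>i. if i \<le> n then c i else b (i - n))"
  have "(\<Sum>i<n + m. qr (e i) (e (Suc i))) = s + (\<Sum>i=n..<n+m. qr (e i) (e (Suc i)))"
  proof -
    have "s = (\<Sum>i<n. qr (e i) (e (Suc i)))"
      unfolding c(5) e_def by (intro sum.cong) auto
    then show ?thesis
      using sum.atLeastLessThan_concat[of 0 n "n + m" "\<lambda>i. qr (e i) (e (Suc i))"]
      by (simp add: lessThan_atLeast0)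
  qed
  also have "(\<Sum>i=n..<n+m. qr (e i) (e (Suc i))) = (\<Sum>i<m. qr (e (i + n)) (e (Suc (i + n))))"
    using sum.shift_bounds_nat_ivl[of "\<lambda>i. qr (e i) (e (Suc i))" 0 n m]
    by (simp add: lessThan_atLeast0 add.commute)
  also have "\<dots> = t"
    unfolding b(5) e_def using c b(2) by (intro sum.cong) auto
  finally show ?thesis unfolding chains_def using c b
    by (auto intro!: exI[of _ "n + m"] exI[of _ e] simp: e_def)
qed

sublocale Metric_space V th
proof
  fix x y
  show "0 \<le> th x y"
  proof (cases "x \<in> V \<and> y \<in> V")
    case True
    then show ?thesis using qr_le_th[of x y] qr_nonneg[of x y] by linarith
  next
    case False
    then show ?thesis by (auto simp: vis_theta_def)
  qed
  show "th x y = th y x"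
  proof (cases "x \<in> V \<and> y \<in> V")
    case True
    have "chains x y = chains y x" using chains_rev by blast
    then show ?thesis using th_eq True by simp
  next
    case False
    then show ?thesis by (auto simp: vis_theta_def)
  qed
next
  fix x y assume V: "x \<in> V" "y \<in> V"
  show "th x y = 0 \<longleftrightarrow> x = y"
  proof
    assume "th x y = 0"
    then have "qr x y \<le> 0" using qr_le_th[OF V] by simp
    then show "x = y" by (simp add: vis_rho_def split: if_splits)
  next
    assume "x = y"
    then show "th x y = 0" using th_le_qr[OF V] qr_le_th[OF V] by simp
  qed
next
  fix x y z assume V: "x \<in> V" "y \<in> V" "z \<in> V"
  \<comment> \<open>Two infima one after the other: over the chains from x to y with t fixed, then
    over t.\<close>
  have "th x z - t \<le> th x y" if "t \<in> chains y z" for t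
  proof -
    have "th x z - t \<le> Inf (chains x y)"
      using th_le_chain[OF V(1,3) chains_append[OF _ that]] edge_chain V
      by (intro cInf_greatest) (force simp: algebra_simps)+
    then show ?thesis using th_eq V by simp
  qed
  then have "th x z - th x y \<le> Inf (chains y z)"
    using edge_chain V by (intro cInf_greatest) (force simp: algebra_simps)+
  then show "th x z \<le> th x y + th y z" using th_eq V by simp
qed

lemma th_le_exp: "x \<in> V \<Longrightarrow> y \<in> V \<Longrightarrow> th x y \<le> exp (- a * g x y)"
  using th_le_qr[of x y] by (auto simp: vis_rho_def split: if_splits)

lemma exp_le_th: "x \<in> V \<Longrightarrow> y \<in> V \<Longrightarrow> x \<noteq> y \<Longrightarrow> exp (- a * g x y) \<le> 2 * th x y"
  using qr_le_th[of x y] by (auto simp: vis_rho_def)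

lemma boundary_subset: "hyp_boundary V E rt a \<subseteq> cpl"
  unfolding hyp_boundary_def by auto

text \<open>\<open>boundary_product\<close> is written with \<open>lim\<close>, so convergence has
  to be proved. The Gromov products along two rays increase, and they are bounded because the
  distance of the ray vertices tends to \<open>D \<xi> \<eta> > 0\<close>. The two estimates between
  \<open>vis_theta\<close> and the exponential then pass to the limit.\<close>

lemma ray_product_limit:
  assumes x: "ray_to V E rt a x \<xi>" and y: "ray_to V E rt a y \<eta>"
    and ne: "\<xi> \<noteq> \<eta>"
  shows "D \<xi> \<eta> > 0"
    and "D \<xi> \<eta> \<le> exp (- a * lim (\<lambda>n. g (x n) (y n)))"
    and "exp (- a * lim (\<lambda>n. g (x n) (y n))) \<le> 2 * D \<xi> \<eta>"
proof -
  interpret C: Metric_space cpl D by (rule Metric_space_completion)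
  have V: "x n \<in> V" "y n \<in> V" for n
    using x y unfolding ray_to_def geodesic_ray_def by auto
  have e: "(x n, x (Suc n)) \<in> E" "(y n, y (Suc n)) \<in> E" for n
    using x y unfolding ray_to_def geodesic_ray_def by auto
  have lev: "graph_dist E rt (x n) = n" "graph_dist E rt (y n) = n" for n
  proof -
    have "graph_dist E (x 0) (x n) = n - 0" "graph_dist E (y 0) (y n) = n - 0" "x 0 = rt" "y 0 = rt"
      using x y unfolding ray_to_def geodesic_ray_def by blast+
    then show "graph_dist E rt (x n) = n" "graph_dist E rt (y n) = n" by simp_all
  qed
  have limx: "limitin (completion_topology V th) (\<lambda>n. completion_point V th (x n)) \<xi> sequentially"
    and limy: "limitin (completion_topology V th) (\<lambda>n. completion_point V th (y n)) \<eta> sequentially"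
    using x y unfolding ray_to_def by auto
  have lim: "(\<lambda>n. th (x n) (y n)) \<longlonglongrightarrow> D \<xi> \<eta>"
    by (rule limitin_completion_point_dist[OF V limx limy])
  have "\<xi> \<in> cpl" "\<eta> \<in> cpl"
    by (rule limitin_completion_pointD(1)[OF limx V(1)], rule limitin_completion_pointD(1)[OF limy V(2)])
  then show pos: "D \<xi> \<eta> > 0" using ne by simp
  \<comment> \<open>One step on both rays raises the sum of the levels by exactly 2 and the distance
    by at most 2.\<close>
  have g_mono: "g (x n) (y n) \<le> g (x (Suc n)) (y (Suc n))" for n
  proof -
    have 1: "graph_dist E (x (Suc n)) (x n) \<le> 1" "graph_dist E (y n) (y (Suc n)) \<le> 1"
      by (rule graph_dist_le, use e(2)[of n] symD[OF symE e(1)[of n]] in simp)+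
    have "graph_dist E (x (Suc n)) (y (Suc n)) \<le> graph_dist E (x (Suc n)) (x n) + graph_dist E (x n) (y (Suc n))"
      "graph_dist E (x n) (y (Suc n)) \<le> graph_dist E (x n) (y n) + graph_dist E (y n) (y (Suc n))"
      by (rule graph_dist_triangle; rule connected; rule V)+
    then have "graph_dist E (x (Suc n)) (y (Suc n)) \<le> graph_dist E (x n) (y n) + 2" using 1 by linarith
    then show ?thesis unfolding gromov_product_def lev by simp
  qed
  obtain m where m: "\<And>n. n \<ge> m \<Longrightarrow> D \<xi> \<eta> / 2 < th (x n) (y n)"
    using order_tendstoD(1)[OF lim, of "D \<xi> \<eta> / 2"] pos by (auto simp: eventually_sequentially)
  have up: "g (x n) (y n) \<le> - ln (D \<xi> \<eta> / 2) / a" if "n \<ge> m" for n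
  proof -
    have "D \<xi> \<eta> / 2 \<le> exp (- a * g (x n) (y n))"
      using m[OF that] th_le_exp[OF V, of n n] by linarith
    then have "ln (D \<xi> \<eta> / 2) \<le> ln (exp (- a * g (x n) (y n)))"
      by (intro ln_mono) (use pos in simp_all)
    then show ?thesis using a by (simp add: field_simps)
  qed
  have inc: "incseq (\<lambda>n. g (x n) (y n))" using g_mono by (rule incseq_SucI)
  have "g (x n) (y n) \<le> - ln (D \<xi> \<eta> / 2) / a" for n
    using incseqD[OF inc max.cobounded1[of n m]] up[OF max.cobounded2[of m n]] by linarith
  then obtain l where l: "(\<lambda>n. g (x n) (y n)) \<longlonglongrightarrow> l"
    using incseq_convergent[OF inc, of "- ln (D \<xi> \<eta> / 2) / a"] by blast
  then have leq: "lim (\<lambda>n. g (x n) (y n)) = l" by (rule limI)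
  have le: "(\<lambda>n. exp (- a * g (x n) (y n))) \<longlonglongrightarrow> exp (- a * l)"
    by (intro tendsto_intros l)
  show "D \<xi> \<eta> \<le> exp (- a * lim (\<lambda>n. g (x n) (y n)))"
    unfolding leq using lim le th_le_exp[OF V] by (intro LIMSEQ_le) auto
  have "x n \<noteq> y n" if "n \<ge> m" for n using m[OF that] pos V by auto
  then show "exp (- a * lim (\<lambda>n. g (x n) (y n))) \<le> 2 * D \<xi> \<eta>"
    unfolding leq using exp_le_th[OF V]
    by (intro LIMSEQ_le[OF le tendsto_mult_left[OF lim]]) (auto intro!: exI[of _ m])
qed

text \<open>The bounds of \<open>ray_product_limit\<close> are the same for all pairs of rays, so
  the infimum over pairs inherits them. The two given rays make the set under the infimum
  nonempty.\<close>

lemma boundary_rho_bounds: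
  assumes x: "ray_to V E rt a x \<xi>" and y: "ray_to V E rt a y \<eta>" and \<xi>: "\<xi> \<in> cpl"
  shows "D \<xi> \<eta> \<le> boundary_rho V E rt a \<xi> \<eta>" "boundary_rho V E rt a \<xi> \<eta> \<le> 2 * D \<xi> \<eta>"
proof -
  interpret C: Metric_space cpl D by (rule Metric_space_completion)
  have "D \<xi> \<eta> \<le> boundary_rho V E rt a \<xi> \<eta> \<and> boundary_rho V E rt a \<xi> \<eta> \<le> 2 * D \<xi> \<eta>"
  proof (cases "\<xi> = \<eta>")
    case True
    then show ?thesis using \<xi> by (simp add: boundary_rho_def)
  next
    case False
    define L where "L = {lim (\<lambda>n. g (x n) (y n)) | x y. ray_to V E rt a x \<xi> \<and> ray_to V E rt a y \<eta>}"
    have pos: "D \<xi> \<eta> > 0" by (rule ray_product_limit(1)[OF x y False])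
    have ne: "L \<noteq> {}" unfolding L_def using x y by blast
    have b: "- ln (2 * D \<xi> \<eta>) / a \<le> l" "l \<le> - ln (D \<xi> \<eta>) / a" if "l \<in> L" for l
    proof -
      obtain x' y' where "ray_to V E rt a x' \<xi>" "ray_to V E rt a y' \<eta>"
        and l: "l = lim (\<lambda>n. g (x' n) (y' n))"
        using \<open>l \<in> L\<close> unfolding L_def by blast
      from ray_product_limit(2,3)[OF this(1,2) False]
      have "D \<xi> \<eta> \<le> exp (- a * l)" "exp (- a * l) \<le> 2 * D \<xi> \<eta>" unfolding l .
      then have "ln (D \<xi> \<eta>) \<le> ln (exp (- a * l))" "ln (exp (- a * l)) \<le> ln (2 * D \<xi> \<eta>)"
        by (intro ln_mono; use pos in simp)+
      then show "- ln (2 * D \<xi> \<eta>) / a \<le> l" "l \<le> - ln (D \<xi> \<eta>) / a"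
        using a by (simp_all add: field_simps)
    qed
    have lo: "- ln (2 * D \<xi> \<eta>) / a \<le> Inf L" using ne b(1) by (rule cInf_greatest)
    obtain l where "l \<in> L" using ne by blast
    have "bdd_below L" using b(1) by (rule bdd_belowI)
    then have "Inf L \<le> - ln (D \<xi> \<eta>) / a"
      using cInf_lower2[OF \<open>l \<in> L\<close> b(2)[OF \<open>l \<in> L\<close>]] by simp
    with lo have "ln (D \<xi> \<eta>) \<le> - a * Inf L" "- a * Inf L \<le> ln (2 * D \<xi> \<eta>)"
      using a by (simp_all add: field_simps)
    then have "exp (ln (D \<xi> \<eta>)) \<le> exp (- a * Inf L)" "exp (- a * Inf L) \<le> exp (ln (2 * D \<xi> \<eta>))"
      by (simp_all only: exp_le_cancel_iff)
    then have "D \<xi> \<eta> \<le> exp (- a * Inf L)" "exp (- a * Inf L) \<le> 2 * D \<xi> \<eta>"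
      using pos by simp_all
    then show ?thesis using False unfolding boundary_rho_def boundary_product_def L_def by simp
  qed
  then show "D \<xi> \<eta> \<le> boundary_rho V E rt a \<xi> \<eta>" "boundary_rho V E rt a \<xi> \<eta> \<le> 2 * D \<xi> \<eta>"
    by auto
qed

end

section \<open>Systems of cells\<close>

lemma path_segment:
  assumes "\<And>i. i < m \<Longrightarrow> (f i, f (Suc i)) \<in> R" "i \<le> j" "j \<le> m"
  shows "(f i, f j) \<in> R ^^ (j - i)"
  unfolding relpow_fun_conv using assms by (intro exI[of _ "\<lambda>k. f (i + k)"]) auto

text \<open>A relation between members that are not consecutive would be a shortcut. The absence of
  such chords is what makes every second cell of the path disjoint from the others.\<close>

lemma shortest_path:
  assumes "(x, y) \<in> R\<^sup>*"
  obtains f m where "f 0 = x" "f m = y" "\<And>i. i < m \<Longrightarrow> (f i, f (Suc i)) \<in> R"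
    "\<And>i j. Suc i < j \<Longrightarrow> j \<le> m \<Longrightarrow> (f i, f j) \<notin> R"
proof -
  obtain f where f: "f 0 = x" "f (graph_dist R x y) = y"
    "\<And>i. i < graph_dist R x y \<Longrightarrow> (f i, f (Suc i)) \<in> R"
    using graph_dist_relpow[OF assms] unfolding relpow_fun_conv by auto
  have "(f i, f j) \<notin> R" if ij: "Suc i < j" "j \<le> graph_dist R x y" for i j
  proof
    assume "(f i, f j) \<in> R"
    moreover have "(x, f i) \<in> R ^^ i"
      using path_segment[of "graph_dist R x y" f R 0 i] f ij by simp
    ultimately have "(x, f j) \<in> R ^^ Suc i" by auto
    moreover have "(f j, y) \<in> R ^^ (graph_dist R x y - j)"
      using path_segment[of "graph_dist R x y" f R j "graph_dist R x y"] f ij by simp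
    ultimately have "(x, y) \<in> R ^^ (Suc i + (graph_dist R x y - j))"
      unfolding relpow_add by blast
    then have "graph_dist R x y \<le> Suc i + (graph_dist R x y - j)" by (rule graph_dist_le)
    with ij show False by simp
  qed
  with f show ?thesis using that by blast
qed

text \<open>The properties of the vertices of an iterated function system that the geometry needs,
  without words or maps. Parents exist but are not assumed unique. \<open>packing\<close> is the
  only trace of the separation hypotheses; its radius is the one that \<open>chain_contracts\<close>
  produces.\<close>

locale cell_system =
  fixes V :: "'v set" and rt :: 'v and lev :: "'v \<Rightarrow> nat" and Vt :: "'v rel"
    and cell :: "'v \<Rightarrow> 'a::euclidean_space set" and r B :: real and K :: "'a set" and M0 :: nat
  assumes r: "0 < r" "r < 1" and B: "0 < B"
    and rt: "rt \<in> V" and lev_0: "\<And>x. x \<in> V \<Longrightarrow> lev x = 0 \<longleftrightarrow> x = rt"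
    and Vt: "\<And>x y. (x, y) \<in> Vt \<Longrightarrow> x \<in> V \<and> y \<in> V \<and> lev y = Suc (lev x) \<and> cell y \<subseteq> cell x"
    and parent: "\<And>y n. y \<in> V \<Longrightarrow> lev y = Suc n \<Longrightarrow> \<exists>x. (x, y) \<in> Vt"
    and child: "\<And>x z. x \<in> V \<Longrightarrow> z \<in> cell x \<Longrightarrow> \<exists>y. (x, y) \<in> Vt \<and> z \<in> cell y"
    and finite_level: "\<And>n. finite {x \<in> V. lev x = n}"
    and compact_cell: "\<And>x. x \<in> V \<Longrightarrow> compact (cell x)"
    and cell_ne: "\<And>x. x \<in> V \<Longrightarrow> cell x \<noteq> {}"
    and cell_diam: "\<And>x p q. x \<in> V \<Longrightarrow> p \<in> cell x \<Longrightarrow> q \<in> cell x \<Longrightarrow> norm (p - q) \<le> B * r ^ lev x"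
    and cell_rt: "cell rt = K"
    and packing: "\<And>F n z. F \<subseteq> {x \<in> V. lev x = n} \<Longrightarrow>
      (\<And>x y. x \<in> F \<Longrightarrow> y \<in> F \<Longrightarrow> x \<noteq> y \<Longrightarrow> cell x \<inter> cell y = {}) \<Longrightarrow>
      (\<And>x. x \<in> F \<Longrightarrow> cell x \<subseteq> cball z (2 * B * r ^ n)) \<Longrightarrow> card F \<le> M0"
begin

section \<open>Chains of touching cells and their ancestors\<close>

definition touch :: "'v rel" where
  "touch = {(x, y). x \<in> V \<and> y \<in> V \<and> lev x = lev y \<and> cell x \<inter> cell y \<noteq> {}}"

text \<open>Twice the packing number, because only every second cell is counted. It is at least 1,
  because two ancestors of one vertex on the same level touch but may differ.\<close>

definition M where "M = Suc (2 * M0)"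

text \<open>\<open>touch\<close> is reflexive on V, so exactly M steps mean the same as at most M
  steps.\<close>

definition near where
  "near l x y \<longleftrightarrow> (\<exists>x' y'. (x', x) \<in> Vt\<^sup>* \<and> (y', y) \<in> Vt\<^sup>* \<and> lev x' = l \<and> lev y' = l \<and>
     (x', y') \<in> touch ^^ M)"

definition p where "p x y = Max {l. near l x y}"

lemma touchI: "x \<in> V \<Longrightarrow> y \<in> V \<Longrightarrow> lev x = lev y \<Longrightarrow> z \<in> cell x \<Longrightarrow> z \<in> cell y \<Longrightarrow> (x, y) \<in> touch"
  unfolding touch_def by auto

lemma touch_refl: "x \<in> V \<Longrightarrow> (x, x) \<in> touch"
  unfolding touch_def using cell_ne by auto

lemma sym_touch: "sym touch"
  unfolding touch_def sym_def by auto

lemma anc: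
  assumes "(x, y) \<in> Vt\<^sup>*" "y \<in> V"
  shows "x \<in> V" "lev x \<le> lev y" "cell y \<subseteq> cell x"
  using assms by (induction rule: converse_rtrancl_induct) (auto dest: Vt)

lemma ex_anc:
  assumes "y \<in> V" "l \<le> lev y"
  obtains x where "(x, y) \<in> Vt\<^sup>*" "lev x = l" "x \<in> V"
proof -
  have "\<exists>x. (x, y) \<in> Vt\<^sup>* \<and> lev x = l" using assms
  proof (induction "lev y" arbitrary: y)
    case 0 then show ?case by auto
  next
    case (Suc n)
    show ?case
    proof (cases "l = Suc n")
      case True with Suc show ?thesis by (intro exI[of _ y]) auto
    next
      case False
      obtain w where w: "(w, y) \<in> Vt" using parent Suc by metis
      then have "w \<in> V" "n = lev w" "l \<le> lev w" using Suc Vt False by fastforce+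
      then obtain x where "(x, w) \<in> Vt\<^sup>*" "lev x = l" using Suc.hyps(1) by metis
      then show ?thesis using w by (metis rtrancl.rtrancl_into_rtrancl)
    qed
  qed
  then show ?thesis using that anc(1) assms by blast
qed

lemma anc_relpow:
  assumes "(x, y) \<in> Vt\<^sup>*" "y \<in> V"
  shows "(x, y) \<in> Vt ^^ (lev y - lev x)"
proof -
  have "lev y = lev x + n" if "(x, y) \<in> Vt ^^ n" for n y
    using that by (induction n arbitrary: y) (auto dest: Vt)
  then show ?thesis using rtrancl_imp_relpow[OF assms(1)] by force
qed

text \<open>Both cells contain the nonempty cell of x. This replaces the uniqueness of
  ancestors.\<close>

lemma anc_touch:
  assumes "x \<in> V" "(x', x) \<in> Vt\<^sup>*" "(x'', x) \<in> Vt\<^sup>*" "lev x' = lev x''"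
  shows "(x', x'') \<in> touch"
  using cell_ne[of x] anc[of x' x] anc[of x'' x] assms touchI by blast

lemma touch_up:
  assumes "(x, y) \<in> touch" "(x', x) \<in> Vt\<^sup>*" "(y', y) \<in> Vt\<^sup>*" "lev x' = lev y'"
  shows "(x', y') \<in> touch"
  using anc[of x' x] anc[of y' y] assms touchI unfolding touch_def by blast

lemma touch_chain:
  assumes "(x, y) \<in> touch ^^ k" "x \<in> V" "z \<in> cell x"
  shows "y \<in> V" "lev y = lev x" "q \<in> cell y \<Longrightarrow> norm (q - z) \<le> real (Suc k) * (B * r ^ lev x)"
proof -
  have "y \<in> V \<and> lev y = lev x \<and> (\<forall>q\<in>cell y. norm (q - z) \<le> real (Suc k) * (B * r ^ lev x))"
    using assms(1)
  proof (induction k arbitrary: y)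
    case 0 then show ?case using assms cell_diam by auto
  next
    case (Suc k)
    then obtain w where w: "(x, w) \<in> touch ^^ k" "(w, y) \<in> touch" by auto
    then obtain c where c: "c \<in> cell w" "c \<in> cell y" "y \<in> V" "lev y = lev w"
      unfolding touch_def by auto
    have IH: "lev w = lev x" "norm (c - z) \<le> real (Suc k) * (B * r ^ lev x)"
      using Suc.IH[OF w(1)] c by auto
    have "norm (q - z) \<le> real (Suc (Suc k)) * (B * r ^ lev x)" if "q \<in> cell y" for q
    proof -
      have "norm (q - z) \<le> norm (q - c) + norm (c - z)"
        using norm_triangle_ineq[of "q - c" "c - z"] by simp
      also have "\<dots> \<le> B * r ^ lev x + real (Suc k) * (B * r ^ lev x)"
        using cell_diam[OF c(3) that c(2)] c(4) IH by simp
      finally show ?thesis by (simp add: algebra_simps)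
    qed
    then show ?case using c IH by simp
  qed
  then show "y \<in> V" "lev y = lev x" "q \<in> cell y \<Longrightarrow> norm (q - z) \<le> real (Suc k) * (B * r ^ lev x)"
    by auto
qed

lemma touch_pow_in: "(x, y) \<in> touch ^^ k \<Longrightarrow> x \<in> V \<Longrightarrow> y \<in> V \<and> lev y = lev x"
  using touch_chain(1,2)[of x y k] cell_ne[of x] by auto

lemma touch_pow_mono:
  assumes "(x, y) \<in> touch ^^ k" "x \<in> V" "k \<le> m"
  shows "(x, y) \<in> touch ^^ m"
proof -
  have "(x, x) \<in> touch ^^ n" for n
    by (induction n) (use assms(2) touch_refl in auto)
  then have "(x, y) \<in> touch ^^ ((m - k) + k)"
    unfolding relpow_add using assms(1) by blast
  then show ?thesis using assms(3) by simp
qed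

text \<open>Going up does not lengthen a chain. The exponent is a successor because a chain of
  length 0 can lift to two different ancestors of the same vertex, which takes one step.\<close>

lemma touch_pow_up:
  assumes "(x, y) \<in> touch ^^ Suc k" "(x', x) \<in> Vt\<^sup>*" "(y', y) \<in> Vt\<^sup>*" "lev x' = lev y'"
  shows "(x', y') \<in> touch ^^ Suc k"
  using assms
proof (induction k arbitrary: y y')
  case 0 then show ?case using touch_up by auto
next
  case (Suc k)
  obtain w where w: "(x, w) \<in> touch ^^ Suc k" "(w, y) \<in> touch" using Suc.prems(1) by auto
  then have "y \<in> V" "w \<in> V" "lev w = lev y" unfolding touch_def by auto
  then obtain w' where w': "(w', w) \<in> Vt\<^sup>*" "lev w' = lev y'"
    using ex_anc[of w "lev y'"] anc[OF Suc.prems(3)] by metis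
  then have "(x', w') \<in> touch ^^ Suc k" "(w', y') \<in> touch"
    using Suc.IH w Suc.prems touch_up by auto
  then show ?case by auto
qed

text \<open>Along a shortest chain every second cell is disjoint from the others, so that the packing
  bound limits the length of the chain.\<close>

lemma bounded_chain:
  assumes W: "W \<subseteq> {x \<in> V. lev x = n}" "\<And>x. x \<in> W \<Longrightarrow> cell x \<subseteq> cball z (2 * B * r ^ n)"
    and xy: "(x, y) \<in> (touch \<inter> W \<times> W)\<^sup>*" and x: "x \<in> W"
  shows "(x, y) \<in> touch ^^ M"
proof -
  obtain f m where f: "f 0 = x" "f m = y" "\<And>i. i < m \<Longrightarrow> (f i, f (Suc i)) \<in> touch \<inter> W \<times> W"
    "\<And>i j. Suc i < j \<Longrightarrow> j \<le> m \<Longrightarrow> (f i, f j) \<notin> touch \<inter> W \<times> W"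
    using shortest_path[OF xy] by metis
  have fW: "f i \<in> W" if "i \<le> m" for i
    using f(1) x f(3)[of "i - 1"] that by (cases i) auto
  have far: "cell (f i) \<inter> cell (f j) = {}" if "Suc i < j" "j \<le> m" for i j
    using f(4)[OF that] fW[of i] fW[of j] that W(1) unfolding touch_def by auto
  define F where "F = (\<lambda>i. f (2 * i)) ` {..m div 2}"
  have disj: "cell (f (2 * i)) \<inter> cell (f (2 * j)) = {}" if "i \<noteq> j" "i \<le> m div 2" "j \<le> m div 2" for i j
  proof (cases "i < j")
    case True
    then show ?thesis using that by (intro far) auto
  next
    case False
    then have "cell (f (2 * j)) \<inter> cell (f (2 * i)) = {}" using that by (intro far) auto
    then show ?thesis by blast
  qed
  have fW2: "f (2 * i) \<in> W" if "i \<le> m div 2" for i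
    by (rule fW) (use that in linarith)
  then have inV: "f (2 * i) \<in> V" if "i \<le> m div 2" for i
    using that W(1) by blast
  have "inj_on (\<lambda>i. f (2 * i)) {..m div 2}"
  proof (rule inj_onI)
    fix i j assume ij: "i \<in> {..m div 2}" "j \<in> {..m div 2}" "f (2 * i) = f (2 * j)"
    show "i = j"
    proof (rule ccontr)
      assume "i \<noteq> j"
      then have "cell (f (2 * i)) = {}" using disj[of i j] ij by simp
      then show False using cell_ne inV[of i] ij by simp
    qed
  qed
  then have "card F = Suc (m div 2)" unfolding F_def by (simp add: card_image)
  moreover have "card F \<le> M0"
  proof (rule packing[where n = n and z = z])
    show "F \<subseteq> {x \<in> V. lev x = n}" unfolding F_def using fW2 W(1) by blast
    show "cell u \<subseteq> cball z (2 * B * r ^ n)" if "u \<in> F" for u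
      using that fW2 W(2) unfolding F_def by blast
    show "cell u \<inter> cell v = {}" if uv: "u \<in> F" "v \<in> F" "u \<noteq> v" for u v
    proof -
      obtain i j where "u = f (2 * i)" "v = f (2 * j)" "i \<le> m div 2" "j \<le> m div 2"
        using uv(1,2) unfolding F_def by auto
      then show ?thesis using uv(3) disj[of i j] by (cases "i = j") simp_all
    qed
  qed
  \<comment> \<open>The indices 0, 2, 4, ... up to m give \<open>Suc (m div 2)\<close> disjoint
    cells, so m < 2 * M0; shorter chains are padded by reflexivity.\<close>
  ultimately have "m \<le> M" unfolding M_def by simp
  moreover have "(x, y) \<in> touch ^^ m"
    unfolding relpow_fun_conv using f by auto
  ultimately show ?thesis using touch_pow_mono x W(1) by blast
qed

text \<open>The union of k + 1 cells on a level j steps further down is small compared with a cell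
  of the upper level n. All ancestors on level n then lie in one ball of radius comparable to
  \<open>r ^ n\<close>, and \<open>bounded_chain\<close> applies to them. The number j depends on k
  only.\<close>

lemma chain_contracts:
  "\<exists>j. \<forall>x y x' y'. (x, y) \<in> touch ^^ k \<longrightarrow> x \<in> V \<longrightarrow> (x', x) \<in> Vt\<^sup>* \<longrightarrow> (y', y) \<in> Vt\<^sup>* \<longrightarrow>
     lev x' = lev y' \<longrightarrow> lev x' + j \<le> lev x \<longrightarrow> (x', y') \<in> touch ^^ M"
proof -
  \<comment> \<open>Chosen so that k + 1 cells, j levels down, have total diameter at most that
    allowed for one cell.\<close>
  obtain j where "r ^ j < 1 / real (Suc k)"
    using real_arch_pow_inv[of "1 / real (Suc k)" r] r(2) by (metis of_nat_0_less_iff zero_less_Suc zero_less_divide_1_iff)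
  then have "r ^ j * real (Suc k) < 1" by (simp only: pos_less_divide_eq of_nat_0_less_iff zero_less_Suc)
  then have j: "real (Suc k) * r ^ j \<le> 1" by (simp only: mult.commute less_imp_le)
  have "(x', y') \<in> touch ^^ M"
    if xy: "(x, y) \<in> touch ^^ k" "x \<in> V" "(x', x) \<in> Vt\<^sup>*" "(y', y) \<in> Vt\<^sup>*"
      and l: "lev x' = lev y'" "lev x' + j \<le> lev x" for x y x' y'
  proof -
    define n where "n = lev x'"
    obtain z where z: "z \<in> cell x" using cell_ne[OF xy(2)] by auto
    \<comment> \<open>The radius is twice \<open>B * r ^ n\<close>: once for the distance from z to
      a point of the chain, once for the diameter of the ancestor that contains this point.\<close>
    define W where "W = {u \<in> V. lev u = n \<and> cell u \<subseteq> cball z (2 * B * r ^ n)}"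
    have inW: "w' \<in> W" if w: "(x, w) \<in> touch ^^ i" "i \<le> k" "(w', w) \<in> Vt\<^sup>*" "lev w' = n" for w w' i
    proof -
      note tc = touch_chain[OF w(1) xy(2) z]
      obtain c where c: "c \<in> cell w" using cell_ne tc(1) by blast
      have w': "w' \<in> V" "c \<in> cell w'" using anc[OF w(3) tc(1)] c by auto
      have "real (Suc i) * (B * r ^ lev x) \<le> B * r ^ n"
      proof -
        have "real (Suc i) * r ^ lev x \<le> real (Suc k) * (r ^ j * r ^ n)"
        proof (rule mult_mono)
          have "r ^ lev x \<le> r ^ (j + n)" using l(2) r unfolding n_def by (intro power_decreasing) auto
          then show "r ^ lev x \<le> r ^ j * r ^ n" by (simp only: power_add)
        qed (use w(2) r in auto)
        also have "\<dots> = (real (Suc k) * r ^ j) * r ^ n" by (simp only: mult.assoc)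
        also have "\<dots> \<le> 1 * r ^ n" using j r by (intro mult_right_mono) auto
        also have "1 * r ^ n = r ^ n" by simp
        finally have "B * (real (Suc i) * r ^ lev x) \<le> B * r ^ n" using B by (intro mult_left_mono) auto
        then show ?thesis by (simp only: mult.left_commute)
      qed
      then have cz: "norm (c - z) \<le> B * r ^ n" using tc(3)[OF c] by linarith
      have "norm (q - z) \<le> 2 * B * r ^ n" if "q \<in> cell w'" for q
      proof -
        have "norm (q - c) \<le> B * r ^ n" using cell_diam[OF w'(1) that w'(2)] w(4) by simp
        moreover have "norm (q - z) \<le> norm (q - c) + norm (c - z)"
          using norm_triangle_ineq[of "q - c" "c - z"] by simp
        ultimately show ?thesis using cz by linarith
      qed
      then show ?thesis unfolding W_def using w' w(4) by (auto simp: dist_norm norm_minus_commute)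
    qed
    have x'W: "x' \<in> W" using inW[of x 0 x'] xy(3) n_def by simp
    \<comment> \<open>Consecutive members of the lower chain have touching ancestors, so the
      ancestors form a chain inside W. It may be long; only its existence matters to
      \<open>bounded_chain\<close>.\<close>
    have "(x', w') \<in> (touch \<inter> W \<times> W)\<^sup>*"
      if "(x, w) \<in> touch ^^ i" "i \<le> k" "(w', w) \<in> Vt\<^sup>*" "lev w' = n" for w w' i
      using that
    proof (induction i arbitrary: w w')
      case 0
      then have "w = x" by simp
      then have "(x', w') \<in> touch" using anc_touch[OF xy(2,3)] 0(3,4) n_def by simp
      moreover have "w' \<in> W" using inW[OF 0] .
      ultimately show ?case using x'W by (intro r_into_rtrancl) simp
    next
      case (Suc i)
      obtain v where v: "(x, v) \<in> touch ^^ i" "(v, w) \<in> touch" using Suc.prems by auto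
      have "v \<in> V" "lev v = lev x" using touch_pow_in[OF v(1) xy(2)] by auto
      moreover have "n \<le> lev x" using l(2) unfolding n_def by simp
      ultimately obtain v' where v': "(v', v) \<in> Vt\<^sup>*" "lev v' = n"
        using ex_anc[of v n] by auto
      have "(x', v') \<in> (touch \<inter> W \<times> W)\<^sup>*"
        using Suc.IH[OF v(1) _ v'] Suc.prems(2) by simp
      moreover have "(v', w') \<in> touch"
        using touch_up[OF v(2) v'(1) Suc.prems(3)] v'(2) Suc.prems(4) by simp
      moreover have "v' \<in> W" using inW[OF v(1) _ v'] Suc.prems(2) by simp
      moreover have "w' \<in> W" by (rule inW[OF Suc.prems])
      ultimately show ?case by (simp add: rtrancl.rtrancl_into_rtrancl)
    qed
    from this[OF xy(1) order_refl xy(4)] have "(x', y') \<in> (touch \<inter> W \<times> W)\<^sup>*" using l n_def by simp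
    then show ?thesis by (rule bounded_chain[of W n z, rotated 2]) (use x'W in \<open>auto simp: W_def\<close>)
  qed
  then show ?thesis by blast
qed

section \<open>The depth function \<open>p\<close> and its ultrametric inequality\<close>

lemma near_le: "near l x y \<Longrightarrow> x \<in> V \<Longrightarrow> y \<in> V \<Longrightarrow> l \<le> lev x \<and> l \<le> lev y"
  unfolding near_def by (auto dest: anc(2))

lemma root_anc:
  assumes "x \<in> V"
  shows "(rt, x) \<in> Vt\<^sup>*"
proof -
  obtain x' where "(x', x) \<in> Vt\<^sup>*" "lev x' = 0" "x' \<in> V" using ex_anc[OF assms, of 0] by auto
  then show ?thesis using lev_0 by simp
qed

lemma lev_rt [simp]: "lev rt = 0"
  using lev_0 rt by simp

lemma near_0: "x \<in> V \<Longrightarrow> y \<in> V \<Longrightarrow> near 0 x y"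
proof -
  assume "x \<in> V" "y \<in> V"
  moreover have "(rt, rt) \<in> touch ^^ M"
    using touch_pow_mono[of rt rt 0 M] rt by simp
  ultimately show ?thesis unfolding near_def using root_anc by (intro exI[of _ rt]) simp
qed

lemma near_touchI:
  assumes "x \<in> V" "y \<in> V" "(x', x) \<in> Vt\<^sup>*" "(y', y) \<in> Vt\<^sup>*" "lev x' = l" "lev y' = l"
    "z \<in> cell x'" "z \<in> cell y'"
  shows "near l x y"
proof -
  have V: "x' \<in> V" "y' \<in> V" using anc(1)[OF assms(3,1)] anc(1)[OF assms(4,2)] by auto
  then have "(x', y') \<in> touch" using assms(5-8) by (intro touchI[of x' y' z]) auto
  then have "(x', y') \<in> touch ^^ M"
    using touch_pow_mono[of x' y' 1 M] V unfolding M_def by simp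
  then show ?thesis unfolding near_def using assms(3-6) by blast
qed

lemma near_mono:
  assumes "near l x y" "x \<in> V" "y \<in> V" "m \<le> l"
  shows "near m x y"
proof -
  obtain x' y' where xy: "(x', x) \<in> Vt\<^sup>*" "(y', y) \<in> Vt\<^sup>*" "lev x' = l" "lev y' = l"
    "(x', y') \<in> touch ^^ M"
    using assms(1) unfolding near_def by auto
  have V: "x' \<in> V" "y' \<in> V" using anc(1)[OF xy(1) assms(2)] anc(1)[OF xy(2) assms(3)] by auto
  obtain x'' where x'': "(x'', x') \<in> Vt\<^sup>*" "lev x'' = m" using ex_anc[OF V(1), of m] xy(3) assms(4) by auto
  obtain y'' where y'': "(y'', y') \<in> Vt\<^sup>*" "lev y'' = m" using ex_anc[OF V(2), of m] xy(4) assms(4) by auto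
  have "(x'', y'') \<in> touch ^^ M"
    using touch_pow_up[of x' y' "2 * M0" x'' y''] xy x'' y'' unfolding M_def by simp
  then show ?thesis unfolding near_def
    using rtrancl_trans[OF x''(1) xy(1)] rtrancl_trans[OF y''(1) xy(2)] x''(2) y''(2) by blast
qed

lemma near_iff_le_p:
  assumes "x \<in> V" "y \<in> V"
  shows "near l x y \<longleftrightarrow> l \<le> p x y"
proof -
  have fin: "finite {l. near l x y}"
    by (rule finite_subset[of _ "{..lev x}"]) (use near_le assms in auto)
  have "near (p x y) x y" unfolding p_def using Max_in[OF fin] near_0[OF assms] by auto
  then show ?thesis using near_mono[OF _ assms] Max_ge[OF fin] unfolding p_def by blast
qed

lemma p_le: "x \<in> V \<Longrightarrow> y \<in> V \<Longrightarrow> p x y \<le> lev x \<and> p x y \<le> lev y"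
  using near_iff_le_p near_le by blast

lemma p_self: "x \<in> V \<Longrightarrow> p x x = lev x"
  using near_touchI[of x x x x "lev x"] cell_ne[of x] p_le[of x x] near_iff_le_p[of x x "lev x"]
  by (force intro: le_antisym)

text \<open>The chains for (x, z) and for (z, y) end in possibly different ancestors of z, which
  touch. Joined by this contact they form a chain of length 2 * M + 1, which contracts to length M
  after j levels, where j is the same for all vertices.\<close>

lemma p_quasi:
  "\<exists>j. \<forall>x\<in>V. \<forall>y\<in>V. \<forall>z\<in>V. min (p x z) (p z y) \<le> p x y + j"
proof -
  obtain j where j: "\<And>x y x' y'. (x, y) \<in> touch ^^ (M + Suc M) \<Longrightarrow> x \<in> V \<Longrightarrow> (x', x) \<in> Vt\<^sup>* \<Longrightarrow>
    (y', y) \<in> Vt\<^sup>* \<Longrightarrow> lev x' = lev y' \<Longrightarrow> lev x' + j \<le> lev x \<Longrightarrow> (x', y') \<in> touch ^^ M"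
    using chain_contracts by metis
  have "min (p x z) (p z y) \<le> p x y + j" if V: "x \<in> V" "y \<in> V" "z \<in> V" for x y z
  proof -
    define l where "l = min (p x z) (p z y)"
    have "near l x z" "near l z y" using near_iff_le_p V unfolding l_def by auto
    then obtain x' z' z'' y' where n: "(x', x) \<in> Vt\<^sup>*" "(z', z) \<in> Vt\<^sup>*" "(z'', z) \<in> Vt\<^sup>*" "(y', y) \<in> Vt\<^sup>*"
      "lev x' = l" "lev z' = l" "lev z'' = l" "lev y' = l" "(x', z') \<in> touch ^^ M" "(z'', y') \<in> touch ^^ M"
      unfolding near_def by blast
    have V': "x' \<in> V" "y' \<in> V" using anc(1)[OF n(1) V(1)] anc(1)[OF n(4) V(2)] by auto
    have "(z', z'') \<in> touch" using anc_touch[OF V(3) n(2,3)] n(6,7) by simp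
    then have "(z', y') \<in> touch ^^ Suc M" using n(10) by (metis relpow_Suc_I2)
    then have xy: "(x', y') \<in> touch ^^ (M + Suc M)" using n(9) unfolding relpow_add by blast
    obtain x'' where x'': "(x'', x') \<in> Vt\<^sup>*" "lev x'' = l - j" using ex_anc[OF V'(1), of "l - j"] n(5) by auto
    obtain y'' where y'': "(y'', y') \<in> Vt\<^sup>*" "lev y'' = l - j" using ex_anc[OF V'(2), of "l - j"] n(8) by auto
    \<comment> \<open>The subtraction is truncated: for l at most j the level is 0, where any two
      vertices are near.\<close>
    have "near (l - j) x y"
    proof (cases "l \<le> j")
      case True
      then show ?thesis using near_0 V by simp
    next
      case False
      then have "(x'', y'') \<in> touch ^^ M"
        using x''(2) y''(2) n(5) by (intro j[OF xy V'(1) x''(1) y''(1)]) auto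
      then show ?thesis unfolding near_def
        using rtrancl_trans[OF x''(1) n(1)] rtrancl_trans[OF y''(1) n(4)] x''(2) y''(2) by blast
    qed
    then have "l - j \<le> p x y" using near_iff_le_p V by blast
    then show ?thesis unfolding l_def[symmetric] by simp
  qed
  then show ?thesis by blast
qed

lemma cell_dist_le:
  assumes V: "x \<in> V" "y \<in> V" and u: "u \<in> cell x" and v: "v \<in> cell y"
  shows "norm (u - v) \<le> real (Suc M) * (B * r ^ p x y)"
proof -
  have "near (p x y) x y" using near_iff_le_p V by simp
  then obtain x' y' where n: "(x', x) \<in> Vt\<^sup>*" "(y', y) \<in> Vt\<^sup>*" "lev x' = p x y" "(x', y') \<in> touch ^^ M"
    unfolding near_def by auto
  have "x' \<in> V" "u \<in> cell x'" "v \<in> cell y'"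
    using anc(1,3)[OF n(1) V(1)] anc(3)[OF n(2) V(2)] u v by auto
  then show ?thesis using touch_chain(3)[OF n(4), of u v] n(3) by (simp add: norm_minus_commute)
qed

section \<open>Descending rays through the points of K\<close>

definition is_ray where
  "is_ray z f \<longleftrightarrow> f 0 = rt \<and> (\<forall>n. (f n, f (Suc n)) \<in> Vt \<and> z \<in> cell (f n))"

definition ray where "ray z = (SOME f. is_ray z f)"

lemma is_ray_ray:
  assumes "z \<in> K"
  shows "is_ray z (ray z)"
proof -
  have "\<exists>f. \<forall>n. (f n \<in> V \<and> z \<in> cell (f n) \<and> (n = 0 \<longrightarrow> f n = rt)) \<and> (f n, f (Suc n)) \<in> Vt"
  proof (rule dependent_nat_choice)
    show "\<exists>x. x \<in> V \<and> z \<in> cell x \<and> (0 = (0::nat) \<longrightarrow> x = rt)"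
      using assms rt cell_rt by blast
    fix x n assume "x \<in> V \<and> z \<in> cell x \<and> (n = (0::nat) \<longrightarrow> x = rt)"
    then obtain y where "(x, y) \<in> Vt" "z \<in> cell y" using child by blast
    then show "\<exists>y. (y \<in> V \<and> z \<in> cell y \<and> (Suc n = 0 \<longrightarrow> y = rt)) \<and> (x, y) \<in> Vt"
      using Vt[of x y] by blast
  qed
  then have "\<exists>f. is_ray z f" unfolding is_ray_def by blast
  then show ?thesis unfolding ray_def by (rule someI_ex)
qed

lemma ray:
  assumes "z \<in> K"
  shows "ray z 0 = rt" "(ray z n, ray z (Suc n)) \<in> Vt" "z \<in> cell (ray z n)" "ray z n \<in> V"
  using is_ray_ray[OF assms] Vt unfolding is_ray_def by blast+

lemma lev_ray: "z \<in> K \<Longrightarrow> lev (ray z n) = n"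
  by (induction n) (use ray(1) lev_0 rt Vt[OF ray(2)] in auto)

lemma ray_relpow: "z \<in> K \<Longrightarrow> m \<le> n \<Longrightarrow> (ray z m, ray z n) \<in> Vt ^^ (n - m)"
  using path_segment[of n "ray z" Vt m n] ray(2) by simp

lemma ray_anc: "z \<in> K \<Longrightarrow> m \<le> n \<Longrightarrow> (ray z m, ray z n) \<in> Vt\<^sup>*"
  using ray_relpow relpow_imp_rtrancl by metis

lemma cells_locally:
  assumes "z \<in> K"
  obtains e where "e > 0"
    "\<And>x z'. x \<in> V \<Longrightarrow> lev x = l \<Longrightarrow> z' \<in> cell x \<Longrightarrow> dist z z' < e \<Longrightarrow> z \<in> cell x"
proof -
  define U where "U = (\<Union>x\<in>{x \<in> V. lev x = l \<and> z \<notin> cell x}. cell x)"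
  have "finite {x \<in> V. lev x = l \<and> z \<notin> cell x}"
    by (rule finite_subset[OF _ finite_level[of l]]) auto
  then have "closed U" unfolding U_def using compact_cell compact_imp_closed by (intro closed_UN) auto
  moreover have "z \<in> - U" unfolding U_def by auto
  ultimately obtain e where e: "e > 0" "ball z e \<subseteq> - U"
    using open_contains_ball[of "- U"] by (auto simp: open_Compl)
  show ?thesis
  proof (rule that[OF e(1)])
    fix x z' assume x: "x \<in> V" "lev x = l" "z' \<in> cell x" "dist z z' < e"
    then have "z' \<notin> U" using e(2) by auto
    then show "z \<in> cell x" using x unfolding U_def by blast
  qed
qed

lemma cell_subset: "x \<in> V \<Longrightarrow> cell x \<subseteq> K"
proof -
  assume x: "x \<in> V"
  show ?thesis using anc(3)[OF root_anc[OF x] x] cell_rt by simp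
qed

lemma compact_K: "compact K"
  using compact_cell[OF rt] cell_rt by simp

end

section \<open>Graphs on a system of cells\<close>

text \<open>What the two graphs have in common. \<open>touch_G\<close> replaces a contact by at most
  \<open>kt\<close> edges and gives the upper bound for distances; \<open>G_near\<close> says that
  the ends of an edge are near as seen from the upper of their levels, and with \<open>G_lev\<close>
  gives the lower bound.\<close>

locale cell_graph = cell_system V rt lev Vt cell r B K M0
  for V :: "'v set" and rt :: 'v and lev :: "'v \<Rightarrow> nat" and Vt :: "'v rel"
    and cell :: "'v \<Rightarrow> 'a::euclidean_space set" and r B :: real and K :: "'a set" and M0 :: nat +
  fixes G :: "'v rel" and kt :: nat
  assumes G_sub: "G \<subseteq> V \<times> V" and sym_G: "sym G" and Vt_sub: "Vt \<subseteq> G"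
    and G_lev: "\<And>x y. (x, y) \<in> G \<Longrightarrow> lev y \<le> Suc (lev x)"
    and G_near: "\<And>x y. (x, y) \<in> G \<Longrightarrow> near (min (lev x) (lev y)) x y"
    and touch_G: "\<And>x y. (x, y) \<in> touch \<Longrightarrow> \<exists>k\<le>kt. (x, y) \<in> G ^^ k"
begin

lemma Vt_pow_sub: "Vt ^^ n \<subseteq> G ^^ n"
  by (induction n) (use Vt_sub in \<open>auto intro!: relcomp_mono\<close>)

lemma G_pow_lev: "(x, y) \<in> G ^^ n \<Longrightarrow> lev y \<le> lev x + n"
proof (induction n arbitrary: y)
  case (Suc n)
  then obtain w where "(x, w) \<in> G ^^ n" "(w, y) \<in> G" by auto
  then show ?case using Suc.IH[of w] G_lev[of w y] by simp
qed auto

lemma anc_G_pow: "(x, y) \<in> Vt\<^sup>* \<Longrightarrow> y \<in> V \<Longrightarrow> (x, y) \<in> G ^^ (lev y - lev x)"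
  using anc_relpow[of x y] Vt_pow_sub by auto

lemma G_rtrancl: "x \<in> V \<Longrightarrow> y \<in> V \<Longrightarrow> (x, y) \<in> G\<^sup>*"
proof -
  assume "x \<in> V" "y \<in> V"
  then have "(rt, x) \<in> G\<^sup>*" "(rt, y) \<in> G\<^sup>*"
    using root_anc rtrancl_mono[OF Vt_sub] by auto
  then show ?thesis
    using sym_G by (meson rtrancl_trans sym_rtrancl symD)
qed

lemma connected_G: "connected_graph V G"
  unfolding connected_graph_def using G_sub sym_G G_rtrancl by blast

lemma dist_rt:
  assumes "x \<in> V"
  shows "graph_dist G rt x = lev x"
proof (rule antisym)
  show "graph_dist G rt x \<le> lev x"
    using anc_G_pow[OF root_anc[OF assms] assms] by (intro graph_dist_le) simp
  show "lev x \<le> graph_dist G rt x"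
    using G_pow_lev[OF graph_dist_relpow[OF G_rtrancl[OF rt assms]]] by simp
qed

lemma gromov_eq:
  "x \<in> V \<Longrightarrow> y \<in> V \<Longrightarrow>
    gromov_product G rt x y = (real (lev x) + real (lev y) - real (graph_dist G x y)) / 2"
  unfolding gromov_product_def by (simp add: dist_rt)

lemma touch_pow_G: "(x, y) \<in> touch ^^ m \<Longrightarrow> \<exists>k\<le>kt * m. (x, y) \<in> G ^^ k"
proof (induction m arbitrary: y)
  case (Suc m)
  then obtain w where w: "(x, w) \<in> touch ^^ m" "(w, y) \<in> touch" by auto
  obtain k where k: "k \<le> kt * m" "(x, w) \<in> G ^^ k" using Suc.IH[OF w(1)] by auto
  obtain l where l: "l \<le> kt" "(w, y) \<in> G ^^ l" using touch_G[OF w(2)] by auto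
  have "(x, y) \<in> G ^^ (k + l)" unfolding relpow_add using k l by auto
  then show ?case using k(1) l(1) by (intro exI[of _ "k + l"]) simp
qed auto

lemma p_le_gromov:
  assumes V: "x \<in> V" "y \<in> V"
  shows "real (p x y) \<le> gromov_product G rt x y + real (kt * M) / 2"
proof -
  have "near (p x y) x y" using near_iff_le_p V by simp
  then obtain x' y' where n: "(x', x) \<in> Vt\<^sup>*" "(y', y) \<in> Vt\<^sup>*" "lev x' = p x y" "lev y' = p x y"
    "(x', y') \<in> touch ^^ M"
    unfolding near_def by auto
  obtain k where k: "k \<le> kt * M" "(x', y') \<in> G ^^ k" using touch_pow_G[OF n(5)] by auto
  have "(x, x') \<in> G ^^ (lev x - p x y)" using relpow_sym[OF sym_G anc_G_pow[OF n(1) V(1)]] n(3) by simp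
  moreover have "(y', y) \<in> G ^^ (lev y - p x y)" using anc_G_pow[OF n(2) V(2)] n(4) by simp
  ultimately have "(x, y) \<in> G ^^ (lev x - p x y + (k + (lev y - p x y)))"
    unfolding relpow_add using k(2) by auto
  then have "graph_dist G x y \<le> lev x - p x y + (k + (lev y - p x y))" by (rule graph_dist_le)
  moreover have "p x y \<le> lev x" "p x y \<le> lev y" using p_le V by auto
  ultimately have "real (graph_dist G x y) \<le> real (lev x) + real (lev y) - 2 * real (p x y) + real (kt * M)"
    using k(1) by linarith
  then show ?thesis unfolding gromov_eq[OF V] by (simp add: field_simps)
qed

text \<open>The exponents are distinct, so the sum is part of a geometric series.\<close>

lemma sum_power_inj_le:
  fixes s :: real
  assumes s: "0 < s" "s < 1" and f: "finite A" "inj_on f A"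
  shows "(\<Sum>i\<in>A. s ^ f i) \<le> 1 / (1 - s)"
proof -
  have "(\<Sum>i\<in>A. s ^ f i) = (\<Sum>k\<in>f ` A. s ^ k)"
    using f(2) by (simp add: sum.reindex)
  also have "\<dots> \<le> (\<Sum>k. s ^ k)"
    using s f by (intro sum_le_suminf) auto
  also have "\<dots> = 1 / (1 - s)" using s by (intro suminf_geometric) auto
  finally show ?thesis .
qed

text \<open>The chain bound for the quasi-metric \<open>s ^ (2 * p x y)\<close>, applied to a geodesic: as levels change
  by at most one along edges, the sum over a path of length n is dominated by two geometric series
  meeting at the place where the two bounds for the levels agree.\<close>

lemma gromov_le_p:
  "\<exists>C. \<forall>x\<in>V. \<forall>y\<in>V. gromov_product G rt x y \<le> real (p x y) + C"
proof -
  obtain j where j: "\<And>x y z. x \<in> V \<Longrightarrow> y \<in> V \<Longrightarrow> z \<in> V \<Longrightarrow> min (p x z) (p z y) \<le> p x y + j"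
    using p_quasi by blast
  \<comment> \<open>This makes the square of the constant \<open>1 / s ^ (2 * j)\<close> at most 2.
    \<open>Suc j\<close> instead of j keeps s below 1 when j = 0.\<close>
  define s where "s = root (4 * Suc j) (1 / 2)"
  have s: "0 < s" "s < 1" "s ^ (4 * Suc j) = 1 / 2"
    unfolding s_def by simp_all
  have s4: "1 / 2 \<le> s ^ (4 * j)"
    unfolding s(3)[symmetric] using s by (intro power_decreasing) auto
  define q where "q x y = s ^ (2 * p x y)" for x y
  have qb: "q x y \<le> (1 / s ^ (2 * j)) * max (q x z) (q z y)" if "x \<in> V" "y \<in> V" "z \<in> V" for x y z
  proof -
    have "s ^ (2 * j) * q x y = s ^ (2 * (p x y + j))"
      unfolding q_def by (simp add: power_add)
    also have "\<dots> \<le> s ^ (2 * min (p x z) (p z y))"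
      using j[OF that] s by (intro power_decreasing) auto
    also have "\<dots> \<le> max (q x z) (q z y)" unfolding q_def by (simp add: min_def)
    finally show ?thesis using s by (simp add: field_simps)
  qed
  have b2: "(1 / s ^ (2 * j))\<^sup>2 \<le> 2"
  proof -
    have "(s ^ (2 * j))\<^sup>2 = s ^ (4 * j)" by (simp add: power_mult[symmetric])
    then show ?thesis using s4 s(1) by (simp add: power_divide field_simps)
  qed
  \<comment> \<open>A factor 2 from the chain lemma, two geometric series of sum
    \<open>1 / (1 - s)\<close>, and \<open>s ^ 2\<close> for the level lost in \<open>lo\<close>. N
    turns this factor into an additive constant.\<close>
  define A where "A = 4 / (1 - s) / s ^ 2"
  have A: "A > 0" unfolding A_def using s by simp
  obtain N where N: "s ^ N < 1 / A" using real_arch_pow_inv[OF _ s(2), of "1 / A"] A by auto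
  have "gromov_product G rt x y \<le> real (p x y) + real N" if V: "x \<in> V" "y \<in> V" for x y
  proof (cases "x = y")
    case True
    then show ?thesis using V gromov_eq[OF V] p_self by simp
  next
    case False
    define n where "n = graph_dist G x y"
    have path: "(x, y) \<in> G ^^ n" unfolding n_def by (rule graph_dist_relpow[OF G_rtrancl[OF V]])
    then obtain f where f: "f 0 = x" "f n = y" "\<And>i. i < n \<Longrightarrow> (f i, f (Suc i)) \<in> G"
      unfolding relpow_fun_conv by auto
    have n1: "n \<ge> 1" using False f(1,2) by (cases n) auto
    have fV: "f i \<in> V" if "i \<le> n" for i
      using f(3)[of "i - 1"] G_sub f(1) V that by (cases i) auto
    have nl: "n \<le> lev x + lev y"
    proof -
      have "graph_dist G x y \<le> graph_dist G x rt + graph_dist G rt y"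
        by (rule graph_dist_triangle[OF G_rtrancl[OF V(1) rt] G_rtrancl[OF rt V(2)]])
      then show ?thesis unfolding n_def using dist_rt V graph_dist_commute[OF sym_G, of x rt] by simp
    qed
    have ln: "lev y \<le> lev x + n" using G_pow_lev[OF path] .
    \<comment> \<open>h is twice the Gromov product. The level of \<open>f i\<close> is at least lev
      x - i and at least lev y - (n - i); twice the larger of these bounds is h + |2 * i - c|. By
      \<open>nl\<close> and \<open>ln\<close> the natural subtractions are exact.\<close>
    define h c where "h = lev x + lev y - n" and "c = lev x + n - lev y"
    \<comment> \<open>The summand 2 accounts for the upper end of the edge, whose level can be one
      less than that of the end to which the bound applies.\<close>
    have lo: "h + (if 2 * i \<ge> c then 2 * i - c else c - 2 * i) \<le> 2 * p (f i) (f (Suc i)) + 2" if i: "i < n" for i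
    proof -
      have "near (min (lev (f i)) (lev (f (Suc i)))) (f i) (f (Suc i))" using G_near f(3) i by simp
      then have m: "min (lev (f i)) (lev (f (Suc i))) \<le> p (f i) (f (Suc i))"
        using near_iff_le_p[of "f i" "f (Suc i)"] fV i by simp
      have a: "(f 0, f i) \<in> G ^^ (i - 0)" by (rule path_segment[of n]) (use f(3) i in auto)
      have b: "(f (Suc i), f n) \<in> G ^^ (n - Suc i)" by (rule path_segment[of n]) (use f(3) i in auto)
      have "lev x \<le> lev (f i) + i" using G_pow_lev[OF relpow_sym[OF sym_G a]] f(1) by simp
      moreover have "lev y \<le> lev (f (Suc i)) + (n - Suc i)" using G_pow_lev[OF b] f(2) by simp
      moreover have "lev (f (Suc i)) \<le> Suc (lev (f i))" "lev (f i) \<le> Suc (lev (f (Suc i)))"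
        using G_lev f(3)[OF i] symD[OF sym_G f(3)[OF i]] by auto
      ultimately show ?thesis using m nl ln i unfolding h_def c_def by (auto simp: min_def split: if_splits)
    qed
    have "s ^ 2 * (\<Sum>i<n. q (f i) (f (Suc i))) = (\<Sum>i<n. s ^ (2 * p (f i) (f (Suc i)) + 2))"
      unfolding q_def sum_distrib_left
      by (intro sum.cong refl) (simp only: power_add mult.commute)
    also have "\<dots> \<le> (\<Sum>i<n. s ^ (h + (if 2 * i \<ge> c then 2 * i - c else c - 2 * i)))"
      using lo s by (intro sum_mono power_decreasing) auto
    also have "\<dots> = s ^ h * (\<Sum>i<n. s ^ (if 2 * i \<ge> c then 2 * i - c else c - 2 * i))"
      by (simp add: sum_distrib_left power_add)
    also have "(\<Sum>i<n. s ^ (if 2 * i \<ge> c then 2 * i - c else c - 2 * i))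
        = (\<Sum>i\<in>{i. i < n \<and> 2 * i \<ge> c}. s ^ (2 * i - c)) + (\<Sum>i\<in>{i. i < n \<and> \<not> 2 * i \<ge> c}. s ^ (c - 2 * i))"
    proof -
      have "{..<n} = {i. i < n \<and> 2 * i \<ge> c} \<union> {i. i < n \<and> \<not> 2 * i \<ge> c}" by auto
      then have "(\<Sum>i<n. s ^ (if 2 * i \<ge> c then 2 * i - c else c - 2 * i)) =
          (\<Sum>i\<in>{i. i < n \<and> 2 * i \<ge> c}. s ^ (if 2 * i \<ge> c then 2 * i - c else c - 2 * i)) +
          (\<Sum>i\<in>{i. i < n \<and> \<not> 2 * i \<ge> c}. s ^ (if 2 * i \<ge> c then 2 * i - c else c - 2 * i))"
        by (simp only:, intro sum.union_disjoint) auto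
      then show ?thesis by simp
    qed
    also have "\<dots> \<le> 1 / (1 - s) + 1 / (1 - s)"
    proof (rule add_mono)
      show "(\<Sum>i\<in>{i. i < n \<and> 2 * i \<ge> c}. s ^ (2 * i - c)) \<le> 1 / (1 - s)"
        by (rule sum_power_inj_le[OF s(1,2)]) (auto simp: inj_on_def)
      show "(\<Sum>i\<in>{i. i < n \<and> \<not> 2 * i \<ge> c}. s ^ (c - 2 * i)) \<le> 1 / (1 - s)"
        by (rule sum_power_inj_le[OF s(1,2)]) (auto simp: inj_on_def)
    qed
    finally have sum: "s ^ 2 * (\<Sum>i<n. q (f i) (f (Suc i))) \<le> s ^ h * (2 / (1 - s))"
      using s(1) by simp
    have "q (f 0) (f n) \<le> 2 * (\<Sum>i<n. q (f i) (f (Suc i)))"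
      by (rule quasimetric_chain_bound[where V = V and b = "1 / s ^ (2 * j)"])
        (use qb b2 s fV n1 in \<open>auto simp: q_def\<close>)
    then have "s ^ 2 * q x y \<le> s ^ 2 * (2 * (\<Sum>i<n. q (f i) (f (Suc i))))"
      unfolding f(1,2) by (rule mult_left_mono) simp
    also have "\<dots> = 2 * (s ^ 2 * (\<Sum>i<n. q (f i) (f (Suc i))))" by simp
    also have "\<dots> \<le> 2 * (s ^ h * (2 / (1 - s)))" using sum by (rule mult_left_mono) simp
    finally have "s ^ 2 * q x y \<le> 2 * (s ^ h * (2 / (1 - s)))" .
    then have "q x y \<le> s ^ h * A" unfolding A_def using s by (simp add: field_simps)
    then have "s ^ N * q x y \<le> s ^ N * (s ^ h * A)" using s by (intro mult_left_mono) auto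
    also have "\<dots> = (s ^ N * A) * s ^ h" by simp
    also have "\<dots> < 1 * s ^ h" using N A s by (intro mult_strict_right_mono) (auto simp: field_simps)
    finally have "s ^ (N + 2 * p x y) < s ^ h" unfolding q_def by (simp add: power_add)
    then have "h < N + 2 * p x y"
      using power_decreasing[of "N + 2 * p x y" h s] s by force
    then show ?thesis using nl unfolding gromov_eq[OF V] n_def[symmetric] h_def by simp
  qed
  then show ?thesis by blast
qed

text \<open>A fixed choice of the constant, so that the constants of the boundary estimates can be
  defined from it.\<close>

definition Cg where
  "Cg = (SOME C. C \<ge> 0 \<and> (\<forall>x\<in>V. \<forall>y\<in>V. \<bar>gromov_product G rt x y - real (p x y)\<bar> \<le> C))"

lemma Cg: "Cg \<ge> 0" "x \<in> V \<Longrightarrow> y \<in> V \<Longrightarrow> \<bar>gromov_product G rt x y - real (p x y)\<bar> \<le> Cg"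
proof -
  obtain C where C: "\<And>x y. x \<in> V \<Longrightarrow> y \<in> V \<Longrightarrow> gromov_product G rt x y \<le> real (p x y) + C"
    using gromov_le_p by blast
  have "\<exists>C. C \<ge> 0 \<and> (\<forall>x\<in>V. \<forall>y\<in>V. \<bar>gromov_product G rt x y - real (p x y)\<bar> \<le> C)"
  proof (intro exI[of _ "max C (real (kt * M) / 2)"] conjI ballI)
    fix x y assume "x \<in> V" "y \<in> V"
    then show "\<bar>gromov_product G rt x y - real (p x y)\<bar> \<le> max C (real (kt * M) / 2)"
      using C[of x y] p_le_gromov[of x y] by linarith
  qed (simp add: max.coboundedI2)
  from someI_ex[OF this] show "Cg \<ge> 0"
    "x \<in> V \<Longrightarrow> y \<in> V \<Longrightarrow> \<bar>gromov_product G rt x y - real (p x y)\<bar> \<le> Cg"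
    unfolding Cg_def by blast+
qed

text \<open>Stated for all large \<delta>, so that a common value for the two graphs can be
  taken.\<close>

lemma hyperbolic_G: "\<exists>\<delta>0. \<forall>\<delta>\<ge>\<delta>0. hyperbolic_graph V G rt \<delta>"
proof -
  obtain j where j: "\<And>x y z. x \<in> V \<Longrightarrow> y \<in> V \<Longrightarrow> z \<in> V \<Longrightarrow> min (p x z) (p z y) \<le> p x y + j"
    using p_quasi by blast
  have "hyperbolic_graph V G rt \<delta>" if \<delta>: "\<delta> \<ge> real j + 2 * Cg" for \<delta>
    unfolding hyperbolic_graph_def
  proof (intro conjI ballI rt connected_G)
    fix x y z assume V: "x \<in> V" "y \<in> V" "z \<in> V"
    have "min (real (p x z)) (real (p z y)) \<le> real (p x y) + real j"
      using j[OF V] by linarith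
    then show "min (gromov_product G rt x z) (gromov_product G rt z y) - \<delta> \<le> gromov_product G rt x y"
      using Cg(2)[OF V(1,2)] Cg(2)[OF V(1,3)] Cg(2)[OF V(3,2)] \<delta> by linarith
  qed
  then show ?thesis by blast
qed

end

section \<open>The boundary of a cell graph\<close>

text \<open>Here \<delta> and a are those of the theorem, unrelated to the threshold found in
  \<open>hyperbolic_G\<close>.\<close>

locale cell_boundary =
  cell_graph V rt lev Vt cell r B K M0 G kt + visual_graph V G rt \<delta> a
  for V :: "'v set" and rt :: 'v and lev :: "'v \<Rightarrow> nat" and Vt :: "'v rel"
    and cell :: "'v \<Rightarrow> 'a::euclidean_space set" and r B :: real and K :: "'a set" and M0 :: nat
    and G :: "'v rel" and kt :: nat and \<delta> a :: real
begin

section \<open>Comparison of the visual metric with powers of \<open>lam\<close>\<close>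

definition lam where "lam = exp (- a)"
text \<open>The exponent with \<open>lam powr alpha = r\<close>: it carries the scale
  \<open>lam ^ p\<close> of the boundary to the scale \<open>r ^ p\<close> of distances in
  K.\<close>

definition alpha where "alpha = - ln r / a"
text \<open>The factor 2 is the one between \<open>vis_rho\<close> and \<open>vis_theta\<close>; the
  exponential absorbs the difference between Gromov product and p.\<close>

definition c2 where "c2 = 2 * exp (a * Cg)"
definition A1 where "A1 = real (Suc M) * B * c2 powr alpha"

lemma lam: "0 < lam" "lam < 1"
  unfolding lam_def using a by auto

lemma alpha: "0 < alpha"
  unfolding alpha_def using r a by (simp add: divide_neg_pos)

lemma c2: "0 < c2" and A1: "0 < A1"
  unfolding A1_def c2_def using B by auto

lemma r_pow_eq: "r ^ n = (lam ^ n) powr alpha"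
proof -
  have "lam ^ n = exp (real n * - a)" unfolding lam_def by (simp add: exp_of_nat_mult[symmetric])
  then have "(lam ^ n) powr alpha = exp (real n * ln r)"
    unfolding alpha_def using a by (simp add: exp_powr_real)
  then show ?thesis using r by (simp add: exp_of_nat_mult)
qed

lemma lam_pow_eq: "exp (- a * real n) = lam ^ n"
  unfolding lam_def by (simp add: exp_of_nat_mult[symmetric] mult.commute)

lemma th_le_p:
  assumes V: "x \<in> V" "y \<in> V"
  shows "th x y \<le> c2 * lam ^ p x y"
proof -
  have "a * (real (p x y) - Cg) \<le> a * g x y"
    using Cg(2)[OF V] a by (intro mult_left_mono) auto
  then have "- a * g x y \<le> a * Cg + - a * real (p x y)" by (simp add: algebra_simps)
  then have "exp (- a * g x y) \<le> exp (a * Cg) * lam ^ p x y"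
    by (simp only: exp_le_cancel_iff exp_add[symmetric] lam_pow_eq[symmetric])
  moreover have "0 \<le> exp (a * Cg) * lam ^ p x y" using lam by simp
  ultimately show ?thesis using th_le_exp[OF V] unfolding c2_def by linarith
qed

lemma p_le_th:
  assumes V: "x \<in> V" "y \<in> V" "x \<noteq> y"
  shows "lam ^ p x y \<le> c2 * th x y"
proof -
  have "a * g x y \<le> a * (real (p x y) + Cg)"
    using Cg(2)[OF V(1,2)] a by (intro mult_left_mono) auto
  then have "- a * real (p x y) \<le> a * Cg + - a * g x y" by (simp add: algebra_simps)
  then have "lam ^ p x y \<le> exp (a * Cg) * exp (- a * g x y)"
    by (simp only: exp_le_cancel_iff exp_add[symmetric] lam_pow_eq[symmetric])
  also have "\<dots> \<le> exp (a * Cg) * (2 * th x y)"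
    using exp_le_th[OF V] by (intro mult_left_mono) auto
  finally show ?thesis unfolding c2_def by simp
qed

lemma cell_dist_le_th:
  assumes V: "x \<in> V" "y \<in> V" "x \<noteq> y" and u: "u \<in> cell x" and v: "v \<in> cell y"
  shows "norm (u - v) \<le> A1 * th x y powr alpha"
proof -
  have "r ^ p x y \<le> (c2 * th x y) powr alpha"
    unfolding r_pow_eq using p_le_th[OF V] alpha lam by (intro powr_mono2) auto
  also have "\<dots> = c2 powr alpha * th x y powr alpha"
    using c2 by (simp add: powr_mult)
  finally have "real (Suc M) * (B * r ^ p x y) \<le> real (Suc M) * (B * (c2 powr alpha * th x y powr alpha))"
    using B by (intro mult_left_mono) auto
  also have "\<dots> = A1 * th x y powr alpha" unfolding A1_def by (simp only: mult.assoc)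
  finally show ?thesis using cell_dist_le[OF V(1,2) u v] by linarith
qed

section \<open>The bijection between K and the boundary\<close>

definition pt where "pt x = (SOME z. z \<in> cell x)"

lemma pt: "x \<in> V \<Longrightarrow> pt x \<in> cell x"
  unfolding pt_def using cell_ne[of x] by (auto intro: someI_ex)

definition Psi where "Psi z = cls (ray z)"

lemma small_lam_pow:
  assumes "e > 0"
  obtains l where "c2 * lam ^ l < e"
proof -
  obtain l where "lam ^ l < e / c2" using real_arch_pow_inv[OF _ lam(2), of "e / c2"] assms c2 by auto
  then show ?thesis using that c2 by (simp add: field_simps)
qed

lemma th_le_near:
  assumes "x \<in> V" "y \<in> V" "near l x y"
  shows "th x y \<le> c2 * lam ^ l"
proof -
  have "l \<le> p x y" using near_iff_le_p assms by blast
  then have "c2 * lam ^ p x y \<le> c2 * lam ^ l"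
    using lam c2 by (intro mult_left_mono power_decreasing) auto
  then show ?thesis using th_le_p[OF assms(1,2)] by linarith
qed

lemma near_rays:
  assumes "z \<in> K" "z' \<in> K" "l \<le> m" "l \<le> n" "cell (ray z l) \<inter> cell (ray z' l) \<noteq> {}"
  shows "near l (ray z m) (ray z' n)"
proof -
  obtain w where "w \<in> cell (ray z l)" "w \<in> cell (ray z' l)" using assms(5) by blast
  then show ?thesis
    using near_touchI[OF ray(4)[OF assms(1)] ray(4)[OF assms(2)] ray_anc[OF assms(1,3)] ray_anc[OF assms(2,4)]]
      lev_ray assms(1,2) by blast
qed

lemma MCauchy_ray:
  assumes "z \<in> K"
  shows "MCauchy (ray z)"
  unfolding MCauchy_def
proof (intro conjI allI impI)
  show "range (ray z) \<subseteq> V" using ray(4)[OF assms] by auto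
  fix e :: real assume "e > 0"
  then obtain l where l: "c2 * lam ^ l < e" by (rule small_lam_pow)
  have "th (ray z m) (ray z n) < e" if "l \<le> m" "l \<le> n" for m n
  proof -
    have "near l (ray z m) (ray z n)" using near_rays[OF assms assms that] ray(3)[OF assms, of l] by blast
    then show ?thesis using th_le_near[OF ray(4)[OF assms] ray(4)[OF assms]] l by fastforce
  qed
  then show "\<exists>N. \<forall>n n'. N \<le> n \<longrightarrow> N \<le> n' \<longrightarrow> th (ray z n) (ray z n') < e" by blast
qed

lemma D_Psi_le:
  assumes z: "z \<in> K" "z' \<in> K" and "cell (ray z l) \<inter> cell (ray z' l) \<noteq> {}"
  shows "D (Psi z) (Psi z') \<le> c2 * lam ^ l"
proof (rule LIMSEQ_le_const2)
  show "(\<lambda>n. th (ray z n) (ray z' n)) \<longlonglongrightarrow> D (Psi z) (Psi z')"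
    unfolding Psi_def using cdist_cls MCauchy_ray z by blast
  have "th (ray z n) (ray z' n) \<le> c2 * lam ^ l" if "n \<ge> l" for n
    by (rule th_le_near[OF ray(4)[OF z(1)] ray(4)[OF z(2)] near_rays[OF z that that assms(3)]])
  then show "\<exists>N. \<forall>n\<ge>N. th (ray z n) (ray z' n) \<le> c2 * lam ^ l" by blast
qed

lemma norm_le_D_Psi:
  assumes z: "z \<in> K" "z' \<in> K"
  shows "norm (z - z') \<le> A1 * D (Psi z) (Psi z') powr alpha"
proof -
  have lim: "(\<lambda>n. th (ray z n) (ray z' n)) \<longlonglongrightarrow> D (Psi z) (Psi z')"
    unfolding Psi_def using cdist_cls MCauchy_ray z by blast
  have "(\<lambda>n. th (ray z n) (ray z' n) powr alpha) \<longlonglongrightarrow> D (Psi z) (Psi z') powr alpha"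
    using alpha by (intro tendsto_powr2[OF lim tendsto_const]) auto
  moreover have "(\<lambda>n. r ^ n) \<longlonglongrightarrow> 0" using r by (intro LIMSEQ_power_zero) simp
  ultimately have lim2: "(\<lambda>n. A1 * th (ray z n) (ray z' n) powr alpha + B * r ^ n)
      \<longlonglongrightarrow> A1 * D (Psi z) (Psi z') powr alpha + B * 0"
    by (intro tendsto_add tendsto_mult_left)
  \<comment> \<open>The rays can share a vertex, at which \<open>th\<close> vanishes; the diameter
    of the common cell then bounds the distance. The extra term tends to 0.\<close>
  have "norm (z - z') \<le> A1 * th (ray z n) (ray z' n) powr alpha + B * r ^ n" for n
  proof (cases "ray z n = ray z' n")
    case True
    have "norm (z - z') \<le> B * r ^ n"
      using cell_diam[OF ray(4)[OF z(1)] ray(3)[OF z(1)], of z' n] ray(3)[OF z(2), of n] True lev_ray[OF z(2), of n]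
      by simp
    moreover have "0 \<le> A1 * th (ray z n) (ray z' n) powr alpha" using A1 by simp
    ultimately show ?thesis by linarith
  next
    case False
    have "norm (z - z') \<le> A1 * th (ray z n) (ray z' n) powr alpha"
      by (rule cell_dist_le_th[OF ray(4)[OF z(1)] ray(4)[OF z(2)] False ray(3)[OF z(1)] ray(3)[OF z(2)]])
    moreover have "0 \<le> B * r ^ n" using B r by simp
    ultimately show ?thesis by linarith
  qed
  then show ?thesis using LIMSEQ_le_const[OF lim2, of "norm (z - z')"] by auto
qed

abbreviation bd where "bd \<equiv> hyp_boundary V G rt a"

text \<open>A vertex has distance at least \<open>lam ^ l / c2\<close> from all others if its level
  is below l. A Cauchy sequence that keeps returning below level l is thus eventually constant and
  represents a vertex, not a boundary point.\<close>

lemma boundary_levels: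
  assumes s: "MCauchy s" and bd: "cls s \<in> bd"
  shows "\<exists>N. \<forall>n\<ge>N. l \<le> lev (s n)"
proof (rule ccontr)
  assume no: "\<not> ?thesis"
  have e: "lam ^ l / c2 > 0" using lam c2 by simp
  obtain N where N: "\<And>n n'. N \<le> n \<Longrightarrow> N \<le> n' \<Longrightarrow> th (s n) (s n') < lam ^ l / c2"
    using s e unfolding MCauchy_def by meson
  obtain n where n: "n \<ge> N" "lev (s n) < l" using no by (auto simp: not_le)
  have V: "s m \<in> V" for m using MCauchy_in[OF s] .
  have eq: "s m = s n" if "m \<ge> N" for m
  proof (rule ccontr)
    assume "s m \<noteq> s n"
    then have "lam ^ p (s m) (s n) \<le> c2 * th (s m) (s n)" by (rule p_le_th[OF V V])
    also have "\<dots> < lam ^ l" using N[OF that n(1)] c2 by (simp add: field_simps)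
    finally have "\<not> p (s m) (s n) \<le> l" using power_decreasing[of "p (s m) (s n)" l lam] lam by auto
    then show False using p_le[OF V V, of m n] n(2) by simp
  qed
  have "(\<lambda>m. th (s m) (s n)) \<longlonglongrightarrow> 0"
    by (rule tendsto_eventually) (use eq V in \<open>auto simp: eventually_sequentially\<close>)
  then have "cls s = completion_point V th (s n)"
    unfolding completion_point_eq using cls_eq_iff[OF s MCauchy_const[OF V]] by simp
  then show False using bd V unfolding hyp_boundary_def by blast
qed

text \<open>A vertex x keeps the distance \<open>lam ^ lev x / c2\<close> from all vertices of the
  ray below its level, so the ray cannot converge to x.\<close>

lemma Psi_boundary:
  assumes z: "z \<in> K"
  shows "Psi z \<in> bd"
proof -
  have "cls (ray z) \<noteq> cls (\<lambda>_. x)" if x: "x \<in> V" for x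
  proof
    assume "cls (ray z) = cls (\<lambda>_. x)"
    then have lim: "(\<lambda>n. th (ray z n) x) \<longlonglongrightarrow> 0"
      using cls_eq_iff[OF MCauchy_ray[OF z] MCauchy_const[OF x]] by simp
    have "lam ^ lev x / c2 \<le> th (ray z n) x" if "n > lev x" for n
    proof -
      have "ray z n \<noteq> x" using that lev_ray[OF z, of n] by auto
      then have "lam ^ p (ray z n) x \<le> c2 * th (ray z n) x" by (rule p_le_th[OF ray(4)[OF z] x])
      moreover have "lam ^ lev x \<le> lam ^ p (ray z n) x"
        using p_le[OF ray(4)[OF z] x] lam by (intro power_decreasing) auto
      ultimately show ?thesis using c2 by (simp add: field_simps)
    qed
    then have "lam ^ lev x / c2 \<le> 0"
      by (intro LIMSEQ_le_const[OF lim]) (auto intro!: exI[of _ "Suc (lev x)"])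
    moreover have "lam ^ lev x / c2 > 0" using lam c2 by simp
    ultimately show False by simp
  qed
  then show ?thesis
    unfolding hyp_boundary_def Psi_def completion_point_eq[abs_def] using cls_in[OF MCauchy_ray[OF z]] by auto
qed

text \<open>Points chosen in the cells of a Cauchy sequence form a Cauchy sequence in K, by the
  Hoelder bound for cells. With z its limit, the sequence turns out to be equivalent to the ray of
  z.\<close>

lemma Psi_surj:
  assumes "\<xi> \<in> bd"
  obtains z where "z \<in> K" "\<xi> = Psi z"
proof -
  have "\<xi> \<in> cpl" using assms boundary_subset by blast
  then obtain s where s: "MCauchy s" "\<xi> = cls s" by (rule cls_cases)
  have V: "s n \<in> V" for n using MCauchy_in[OF s(1)] .
  have "Cauchy (\<lambda>n. pt (s n))"
  proof (rule metric_CauchyI)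
    fix e :: real assume e: "e > 0"
    \<comment> \<open>The inverse of the Hoelder modulus \<open>A1 * t powr alpha\<close> at
      e.\<close>
    define e' where "e' = (e / A1) powr (1 / alpha)"
    have e': "e' > 0" "e' powr alpha = e / A1"
      unfolding e'_def using e A1 alpha by (auto simp: powr_powr)
    obtain N where N: "\<And>n n'. N \<le> n \<Longrightarrow> N \<le> n' \<Longrightarrow> th (s n) (s n') < e'"
      using s(1) e'(1) unfolding MCauchy_def by meson
    have "dist (pt (s m)) (pt (s n)) < e" if mn: "N \<le> m" "N \<le> n" for m n
    proof (cases "s m = s n")
      case False
      have "norm (pt (s m) - pt (s n)) \<le> A1 * th (s m) (s n) powr alpha"
        by (rule cell_dist_le_th[OF V V False pt[OF V] pt[OF V]])
      also have "\<dots> < A1 * e' powr alpha"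
        using N[OF mn] A1 alpha by (intro mult_strict_left_mono powr_less_mono2) auto
      also have "\<dots> = e" using e'(2) A1 by simp
      finally show ?thesis by (simp add: dist_norm)
    qed (use e in simp)
    then show "\<exists>N. \<forall>m\<ge>N. \<forall>n\<ge>N. dist (pt (s m)) (pt (s n)) < e" by blast
  qed
  then obtain z where z: "(\<lambda>n. pt (s n)) \<longlonglongrightarrow> z"
    using Cauchy_convergent convergent_def by blast
  have ptK: "pt (s n) \<in> K" for n using pt[OF V] cell_subset[OF V] by blast
  have zK: "z \<in> K"
    by (rule closed_sequentially[OF compact_imp_closed[OF compact_K] ptK z])
  have "(\<lambda>n. th (s n) (ray z n)) \<longlonglongrightarrow> 0"
  proof (rule metric_LIMSEQ_I)
    fix e :: real assume "e > 0"
    then obtain l where l: "c2 * lam ^ l < e" by (rule small_lam_pow)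
    obtain e' where e': "e' > 0"
      "\<And>x z'. x \<in> V \<Longrightarrow> lev x = l \<Longrightarrow> z' \<in> cell x \<Longrightarrow> dist z z' < e' \<Longrightarrow> z \<in> cell x"
      using cells_locally[OF zK, of l] by blast
    obtain N1 where N1: "\<And>n. n \<ge> N1 \<Longrightarrow> l \<le> lev (s n)"
      using boundary_levels[OF s(1)] assms s(2) by blast
    obtain N2 where N2: "\<And>n. n \<ge> N2 \<Longrightarrow> dist (pt (s n)) z < e'"
      using metric_LIMSEQ_D[OF z e'(1)] by blast
    have "dist (th (s n) (ray z n)) 0 < e" if n: "n \<ge> max (max N1 N2) l" for n
    proof -
      have nn: "n \<ge> N1" "n \<ge> N2" "n \<ge> l" using n by auto
      obtain x where x: "(x, s n) \<in> Vt\<^sup>*" "lev x = l" "x \<in> V"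
        using ex_anc[OF V N1[OF nn(1)]] by blast
      have "pt (s n) \<in> cell x" using anc(3)[OF x(1) V] pt[OF V] by blast
      \<comment> \<open>Closeness becomes membership: the ancestor x of \<open>s n\<close> on level
        l has a point close to z, so it contains z and touches the ray of z on level l.\<close>
      then have "z \<in> cell x" using e'(2)[OF x(3,2)] N2[OF nn(2)] by (simp add: dist_commute)
      then have "near l (s n) (ray z n)"
        by (rule near_touchI[OF V ray(4)[OF zK] x(1) ray_anc[OF zK nn(3)] x(2) lev_ray[OF zK] _ ray(3)[OF zK]])
      then have "th (s n) (ray z n) \<le> c2 * lam ^ l" by (rule th_le_near[OF V ray(4)[OF zK]])
      then show ?thesis using l by (simp add: dist_real_def)
    qed
    then show "\<exists>N. \<forall>n\<ge>N. dist (th (s n) (ray z n)) 0 < e" by blast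
  qed
  then have "\<xi> = Psi z"
    unfolding s(2) Psi_def using cls_eq_iff[OF s(1) MCauchy_ray[OF zK]] by simp
  with zK show ?thesis by (rule that)
qed

lemma D_metric: "Metric_space cpl D"
  by (rule Metric_space_completion)

lemma Psi_inj:
  assumes "z \<in> K" "z' \<in> K" "Psi z = Psi z'"
  shows "z = z'"
proof -
  interpret C: Metric_space cpl D by (rule D_metric)
  have "Psi z' \<in> cpl" using Psi_boundary[OF assms(2)] boundary_subset by blast
  then show ?thesis using norm_le_D_Psi[OF assms(1,2)] assms(3) by simp
qed

text \<open>Provides a geodesic ray for every boundary point, so that the infimum in
  \<open>boundary_product\<close> is over a nonempty set. Descending paths are geodesic because an
  edge raises the level by at most 1.\<close>

lemma ray_to_Psi:
  assumes z: "z \<in> K"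
  shows "ray_to V G rt a (ray z) (Psi z)"
  unfolding ray_to_def
proof
  show "limitin (completion_topology V th) (\<lambda>n. completion_point V th (ray z n)) (Psi z) sequentially"
    unfolding Psi_def by (rule limitin_completion_point_cls[OF MCauchy_ray[OF z]])
  show "geodesic_ray V G rt (ray z)"
    unfolding geodesic_ray_def
  proof (intro conjI allI impI)
    show "ray z 0 = rt" "ray z n \<in> V" for n using ray[OF z] by auto
    show "(ray z n, ray z (Suc n)) \<in> G" for n using ray(2)[OF z] Vt_sub by blast
    fix m n :: nat assume mn: "m \<le> n"
    have "(ray z m, ray z n) \<in> G ^^ (n - m)" using ray_relpow[OF z mn] Vt_pow_sub by blast
    then have "graph_dist G (ray z m) (ray z n) \<le> n - m" by (rule graph_dist_le)
    moreover have "n \<le> m + graph_dist G (ray z m) (ray z n)"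
      using G_pow_lev[OF graph_dist_relpow[OF G_rtrancl[OF ray(4)[OF z, of m] ray(4)[OF z, of n]]]]
      by (simp add: lev_ray[OF z])
    ultimately show "graph_dist G (ray z m) (ray z n) = n - m" by simp
  qed
qed

definition Phi where "Phi = inv_into K Psi"

lemma bij_Psi: "bij_betw Psi K bd"
  unfolding bij_betw_def
  using Psi_boundary Psi_inj by (auto simp: inj_on_def elim: Psi_surj)

lemma Phi_Psi: "z \<in> K \<Longrightarrow> Phi (Psi z) = z"
  unfolding Phi_def using bij_Psi by (simp add: bij_betw_def inv_into_f_f)

lemma Psi_Phi: "\<xi> \<in> bd \<Longrightarrow> Psi (Phi \<xi>) = \<xi>"
  and Phi_K: "\<xi> \<in> bd \<Longrightarrow> Phi \<xi> \<in> K"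
  unfolding Phi_def using bij_Psi by (auto simp: bij_betw_def f_inv_into_f inv_into_into)

lemma norm_Phi_le:
  assumes "\<xi> \<in> bd" "\<eta> \<in> bd"
  shows "norm (Phi \<xi> - Phi \<eta>) \<le> A1 * D \<xi> \<eta> powr alpha"
  using norm_le_D_Psi[OF Phi_K[OF assms(1)] Phi_K[OF assms(2)]] Psi_Phi assms by simp

lemma homeomorphic_map_Phi:
  "homeomorphic_map (hyp_boundary_topology V G rt a) (top_of_set K) Phi"
proof -
  interpret C: Metric_space cpl D by (rule D_metric)
  let ?T = "subtopology C.mtopology bd"
  have T: "hyp_boundary_topology V G rt a = ?T"
    unfolding hyp_boundary_topology_def completion_topology_def ..
  have sp: "topspace ?T = bd" using boundary_subset by auto
  have "continuous_map ?T Met_TC.mtopology Phi"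
    unfolding Met_TC.continuous_map_to_metric sp
  proof (intro ballI allI impI)
    fix \<xi> and e :: real assume \<xi>: "\<xi> \<in> bd" and e: "e > 0"
    define e' where "e' = (e / A1) powr (1 / alpha)"
    have e': "e' > 0" "e' powr alpha = e / A1"
      unfolding e'_def using e A1 alpha by (auto simp: powr_powr)
    have "Phi \<eta> \<in> ball (Phi \<xi>) e" if "\<eta> \<in> bd" "D \<xi> \<eta> < e'" for \<eta>
    proof -
      have "norm (Phi \<xi> - Phi \<eta>) \<le> A1 * D \<xi> \<eta> powr alpha" by (rule norm_Phi_le[OF \<xi> that(1)])
      also have "\<dots> < A1 * e' powr alpha"
        using that(2) A1 alpha by (intro mult_strict_left_mono powr_less_mono2) auto
      also have "\<dots> = e" using e'(2) A1 by simp
      finally show ?thesis by (simp add: dist_norm)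
    qed
    then show "\<exists>U. openin ?T U \<and> \<xi> \<in> U \<and> (\<forall>\<eta>\<in>U. Phi \<eta> \<in> Met_TC.mball (Phi \<xi>) e)"
      using \<xi> e'(1) boundary_subset
      by (intro exI[of _ "C.mball \<xi> e' \<inter> bd"]) (auto simp: openin_subtopology_Int)
  qed
  then have c1: "continuous_map ?T (top_of_set K) Phi"
    using Phi_K sp by (auto simp: continuous_map_in_subtopology)
  have "continuous_map (top_of_set K) C.mtopology Psi"
    unfolding C.continuous_map_to_metric topspace_euclidean_subtopology
  proof (intro ballI allI impI)
    fix z and e :: real assume z: "z \<in> K" and "e > 0"
    then obtain l where l: "c2 * lam ^ l < e" using small_lam_pow by blast
    obtain e' where e': "e' > 0"
      "\<And>x z'. x \<in> V \<Longrightarrow> lev x = l \<Longrightarrow> z' \<in> cell x \<Longrightarrow> dist z z' < e' \<Longrightarrow> z \<in> cell x"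
      using cells_locally[OF z, of l] by blast
    have "Psi z' \<in> C.mball (Psi z) e" if z': "z' \<in> K" "dist z z' < e'" for z'
    proof -
      have "z \<in> cell (ray z' l)"
        by (rule e'(2)[OF ray(4)[OF z'(1)] lev_ray[OF z'(1)] ray(3)[OF z'(1)] z'(2)])
      then have "cell (ray z l) \<inter> cell (ray z' l) \<noteq> {}" using ray(3)[OF z, of l] by blast
      then have "D (Psi z) (Psi z') \<le> c2 * lam ^ l" by (rule D_Psi_le[OF z z'(1)])
      then show ?thesis using l Psi_boundary[OF z] Psi_boundary[OF z'(1)] boundary_subset by auto
    qed
    then show "\<exists>U. openin (top_of_set K) U \<and> z \<in> U \<and> (\<forall>y\<in>U. Psi y \<in> C.mball (Psi z) e)"
      using z e'(1) by (intro exI[of _ "K \<inter> ball z e'"]) (auto simp: openin_open_Int)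
  qed
  then have c2: "continuous_map (top_of_set K) ?T Psi"
    using Psi_boundary by (auto simp: continuous_map_in_subtopology)
  have "homeomorphic_maps ?T (top_of_set K) Phi Psi"
    unfolding homeomorphic_maps_def sp using c1 c2 Phi_Psi Psi_Phi by simp
  then show ?thesis unfolding T homeomorphic_map_maps by blast
qed

lemma boundary_rho_D:
  assumes "\<xi> \<in> bd" "\<eta> \<in> bd"
  shows "D \<xi> \<eta> \<le> boundary_rho V G rt a \<xi> \<eta>" "boundary_rho V G rt a \<xi> \<eta> \<le> 2 * D \<xi> \<eta>"
proof -
  have "ray_to V G rt a (ray (Phi \<xi>)) \<xi>" "ray_to V G rt a (ray (Phi \<eta>)) \<eta>" "\<xi> \<in> cpl"
    using ray_to_Psi[OF Phi_K] Psi_Phi assms boundary_subset by force+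
  then show "D \<xi> \<eta> \<le> boundary_rho V G rt a \<xi> \<eta>" "boundary_rho V G rt a \<xi> \<eta> \<le> 2 * D \<xi> \<eta>"
    by (rule boundary_rho_bounds)+
qed

section \<open>The reverse estimate under condition (H)\<close>

lemma scale_between:
  assumes "0 < c" "0 < d"
  shows "\<exists>k. c * r ^ Suc k \<le> d \<and> (k = 0 \<or> d < c * r ^ k)"
proof -
  obtain n where "r ^ n < d / c" using real_arch_pow_inv[OF _ r(2), of "d / c"] assms by auto
  then have n: "c * r ^ n \<le> d" using assms by (simp add: field_simps)
  define m where "m = (LEAST m. c * r ^ m \<le> d)"
  have m: "c * r ^ m \<le> d" unfolding m_def using n by (rule LeastI)
  have least: "d < c * r ^ k" if "k < m" for k
    using not_less_Least[of k "\<lambda>m. c * r ^ m \<le> d"] that unfolding m_def by simp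
  show ?thesis
  proof (cases m)
    case 0
    have "c * r ^ Suc 0 \<le> c * r ^ 0" using assms r by (intro mult_left_mono power_decreasing) auto
    then show ?thesis using m 0 by (intro exI[of _ 0]) simp
  next
    case (Suc k)
    then show ?thesis using m least by (intro exI[of _ k]) simp
  qed
qed

text \<open>At the scale k with \<open>norm (z - z') < c * r ^ k\<close> the points are too close
  for disjoint cells, so their cells of level k meet. For k = 0 this bound can fail, but both cells
  are then K. The lower bound on the norm at scale k + 1 turns \<open>r ^ k\<close> back into the
  norm.\<close>

lemma D_Psi_le_norm:
  assumes c: "0 < c" and z: "z \<in> K" "z' \<in> K" "z \<noteq> z'"
    and H: "\<And>n x y u v. 0 < n \<Longrightarrow> x \<in> V \<Longrightarrow> y \<in> V \<Longrightarrow> lev x = n \<Longrightarrow> lev y = n \<Longrightarrow>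
      cell x \<inter> cell y = {} \<Longrightarrow> u \<in> cell x \<Longrightarrow> v \<in> cell y \<Longrightarrow> c * r ^ n \<le> norm (u - v)"
  shows "D (Psi z) (Psi z') powr alpha \<le> c2 powr alpha / (c * r) * norm (z - z')"
proof -
  interpret C: Metric_space cpl D by (rule D_metric)
  obtain k where k: "c * r ^ Suc k \<le> norm (z - z')" "k = 0 \<or> norm (z - z') < c * r ^ k"
    using scale_between[OF c, of "norm (z - z')"] z(3) by auto
  have "cell (ray z k) \<inter> cell (ray z' k) \<noteq> {}"
  proof (cases "k = 0")
    case True
    then show ?thesis using ray(1)[OF z(1)] ray(1)[OF z(2)] cell_ne[OF rt] by simp
  next
    case False
    show ?thesis
    proof
      assume "cell (ray z k) \<inter> cell (ray z' k) = {}"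
      then have "c * r ^ k \<le> norm (z - z')"
        using False by (intro H[OF _ ray(4)[OF z(1)] ray(4)[OF z(2)] lev_ray[OF z(1)] lev_ray[OF z(2)] _ ray(3)[OF z(1)] ray(3)[OF z(2)]]) auto
      then show False using k(2) False by simp
    qed
  qed
  then have "D (Psi z) (Psi z') \<le> c2 * lam ^ k" by (rule D_Psi_le[OF z(1,2)])
  then have "D (Psi z) (Psi z') powr alpha \<le> (c2 * lam ^ k) powr alpha"
    using alpha by (intro powr_mono2) auto
  also have "\<dots> = c2 powr alpha * r ^ k" unfolding r_pow_eq using c2 lam by (simp add: powr_mult)
  also have "\<dots> = c2 powr alpha / (c * r) * (c * r ^ Suc k)" using c r by (simp add: field_simps)
  also have "\<dots> \<le> c2 powr alpha / (c * r) * norm (z - z')"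
    using k(1) c r by (intro mult_left_mono) auto
  finally show ?thesis .
qed

lemma Hoelder_equivalence:
  assumes c: "0 < c"
    and H: "\<And>n x y u v. 0 < n \<Longrightarrow> x \<in> V \<Longrightarrow> y \<in> V \<Longrightarrow> lev x = n \<Longrightarrow> lev y = n \<Longrightarrow>
      cell x \<inter> cell y = {} \<Longrightarrow> u \<in> cell x \<Longrightarrow> v \<in> cell y \<Longrightarrow> c * r ^ n \<le> norm (u - v)"
  shows "\<exists>C>0. \<forall>\<xi>\<in>bd. \<forall>\<eta>\<in>bd. norm (Phi \<xi> - Phi \<eta>) \<le> C * boundary_rho V G rt a \<xi> \<eta> powr alpha \<and>
    boundary_rho V G rt a \<xi> \<eta> powr alpha \<le> C * norm (Phi \<xi> - Phi \<eta>)"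
proof -
  interpret C: Metric_space cpl D by (rule D_metric)
  \<comment> \<open>The first factor comes from \<open>boundary_rho\<close> being at most 2 *
    D.\<close>
  define C3 where "C3 = 2 powr alpha * (c2 powr alpha / (c * r))"
  have "norm (Phi \<xi> - Phi \<eta>) \<le> A1 * boundary_rho V G rt a \<xi> \<eta> powr alpha"
    "boundary_rho V G rt a \<xi> \<eta> powr alpha \<le> C3 * norm (Phi \<xi> - Phi \<eta>)"
    if b: "\<xi> \<in> bd" "\<eta> \<in> bd" for \<xi> \<eta>
  proof -
    note rho = boundary_rho_D[OF b]
    have "A1 * D \<xi> \<eta> powr alpha \<le> A1 * boundary_rho V G rt a \<xi> \<eta> powr alpha"
      using rho(1) A1 alpha by (intro mult_left_mono powr_mono2) auto
    then show "norm (Phi \<xi> - Phi \<eta>) \<le> A1 * boundary_rho V G rt a \<xi> \<eta> powr alpha"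
      using norm_Phi_le[OF b] by linarith
    show "boundary_rho V G rt a \<xi> \<eta> powr alpha \<le> C3 * norm (Phi \<xi> - Phi \<eta>)"
    proof (cases "\<xi> = \<eta>")
      case True
      then show ?thesis by (simp add: boundary_rho_def)
    next
      case False
      then have ne: "Phi \<xi> \<noteq> Phi \<eta>" using Psi_Phi b by metis
      have "0 \<le> boundary_rho V G rt a \<xi> \<eta>" using rho(1) C.nonneg order_trans by blast
      then have "boundary_rho V G rt a \<xi> \<eta> powr alpha \<le> (2 * D \<xi> \<eta>) powr alpha"
        using rho(2) alpha by (intro powr_mono2) auto
      also have "\<dots> = 2 powr alpha * D \<xi> \<eta> powr alpha" by (simp add: powr_mult)
      also have "\<dots> \<le> 2 powr alpha * (c2 powr alpha / (c * r) * norm (Phi \<xi> - Phi \<eta>))"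
        using D_Psi_le_norm[OF c Phi_K[OF b(1)] Phi_K[OF b(2)] ne H] Psi_Phi b
        by (intro mult_left_mono) auto
      finally show ?thesis unfolding C3_def by (simp only: mult.assoc)
    qed
  qed
  note * = this
  have "norm (Phi \<xi> - Phi \<eta>) \<le> max A1 C3 * boundary_rho V G rt a \<xi> \<eta> powr alpha \<and>
    boundary_rho V G rt a \<xi> \<eta> powr alpha \<le> max A1 C3 * norm (Phi \<xi> - Phi \<eta>)"
    if b: "\<xi> \<in> bd" "\<eta> \<in> bd" for \<xi> \<eta>
    using *[OF b] mult_right_mono[of A1 "max A1 C3" "boundary_rho V G rt a \<xi> \<eta> powr alpha"]
      mult_right_mono[of C3 "max A1 C3" "norm (Phi \<xi> - Phi \<eta>)"] by fastforce
  then show ?thesis using A1 by (intro exI[of _ "max A1 C3"]) auto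
qed

end

section \<open>Measure of similar copies\<close>

text \<open>Divided by c and translated to fix 0, the map is an isometry, hence orthogonal.\<close>

lemma similarity_surj:
  fixes f :: "'a::euclidean_space \<Rightarrow> 'a"
  assumes c: "0 < c" and f: "\<And>x y. norm (f x - f y) = c * norm (x - y)"
  shows "surj f"
proof -
  define h where "h = (\<lambda>x. (1 / c) *\<^sub>R (f x - f 0))"
  have "dist (h x) (h y) = dist x y" for x y
  proof -
    have "h x - h y = (1 / c) *\<^sub>R (f x - f y)"
      unfolding h_def by (simp add: scaleR_right_diff_distrib)
    then show ?thesis using c f by (simp add: dist_norm)
  qed
  then have "orthogonal_transformation h"
    unfolding orthogonal_transformation_isometry by (simp add: h_def)
  then have h: "surj h" by (rule orthogonal_transformation_surj)
  show ?thesis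
  proof (rule surjI)
    fix y
    have "h (inv h ((1 / c) *\<^sub>R (y - f 0))) = (1 / c) *\<^sub>R (y - f 0)" using h by (rule surj_f_inv_f)
    then show "f (inv h ((1 / c) *\<^sub>R (y - f 0))) = y" unfolding h_def using c by simp
  qed
qed

lemma similarity_image_ball:
  fixes f :: "'a::euclidean_space \<Rightarrow> 'a"
  assumes c: "0 < c" and f: "\<And>x y. norm (f x - f y) = c * norm (x - y)"
  shows "f ` ball x R = ball (f x) (c * R)"
proof
  show "f ` ball x R \<subseteq> ball (f x) (c * R)" using c f by (auto simp: dist_norm)
  show "ball (f x) (c * R) \<subseteq> f ` ball x R"
  proof
    fix y assume y: "y \<in> ball (f x) (c * R)"
    obtain p where p: "y = f p" using similarity_surj[OF c f] by (meson surjD)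
    then show "y \<in> f ` ball x R" using y c f by (auto simp: dist_norm)
  qed
qed

text \<open>The image is determined by its centre and radius, so f can be replaced by the homothety
  T with \<open>T x = f x\<close>, an affine map of known effect on the measure.\<close>

lemma emeasure_similarity_ball:
  fixes f :: "'a::euclidean_space \<Rightarrow> 'a"
  assumes c: "0 < c" and f: "\<And>x y. norm (f x - f y) = c * norm (x - y)"
  shows "emeasure lebesgue (f ` ball x R) = ennreal (c ^ DIM('a)) * emeasure lebesgue (ball x R)"
proof -
  define T where "T = (\<lambda>p. c *\<^sub>R p + (f x - c *\<^sub>R x))"
  have "T ` ball x R = ball (T x) (c * R)"
  proof (rule similarity_image_ball[OF c])
    fix p q
    have "T p - T q = c *\<^sub>R (p - q)" unfolding T_def by (simp add: scaleR_right_diff_distrib)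
    then show "norm (T p - T q) = c * norm (p - q)" using c by simp
  qed
  then have "f ` ball x R = T ` ball x R"
    using similarity_image_ball[OF c f] by (simp add: T_def)
  then show ?thesis unfolding T_def using c by (simp only: emeasure_lebesgue_affine) simp
qed

text \<open>Open sets are exhausted by disjoint balls, whose images are balls; the library's rule for linear
  images needs a well-ordered index type.\<close>

lemma emeasure_similarity_open_le:
  fixes f :: "'a::euclidean_space \<Rightarrow> 'a"
  assumes c: "0 < c" and f: "\<And>x y. norm (f x - f y) = c * norm (x - y)" and U: "open U"
  shows "emeasure lebesgue (f ` U) \<le> ennreal (c ^ DIM('a)) * emeasure lebesgue U"
proof -
  have inj: "f x = f y \<Longrightarrow> x = y" for x y using f[of x y] c by simp
  define I where "I = {i. 0 < snd i \<and> ball (fst i) (snd i) \<subseteq> U}"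
  \<comment> \<open>Balls of I of arbitrarily small radius around each point: the fine cover
    required by the Vitali theorem.\<close>
  have "\<exists>i. i \<in> I \<and> x \<in> ball (fst i) (snd i) \<and> snd i < d" if x: "x \<in> U" and d: "0 < d" for x and d :: real
  proof -
    obtain e where e: "e > 0" "ball x e \<subseteq> U" using U x open_contains_ball by blast
    have "ball x (min e (d / 2)) \<subseteq> U" using e by auto
    then show ?thesis using e d unfolding I_def by (intro exI[of _ "(x, min e (d / 2))"]) auto
  qed
  then obtain C where C: "countable C" "C \<subseteq> I"
    "pairwise (\<lambda>i j. disjnt (ball (fst i) (snd i)) (ball (fst j) (snd j))) C"
    "negligible (U - (\<Union>i\<in>C. ball (fst i) (snd i)))"
    by (rule Vitali_covering_theorem_balls)
  define b where "b i = ball (fst i) (snd i)" for i :: "'a \<times> real"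
  have b: "b i \<in> sets lebesgue" "f ` b i \<in> sets lebesgue" for i
    unfolding b_def similarity_image_ball[OF c f] by simp_all
  have disj: "disjoint_family_on b C" "disjoint_family_on (\<lambda>i. f ` b i) C"
    using C(3) inj unfolding disjoint_family_on_def pairwise_def disjnt_def b_def by blast+
  \<comment> \<open>The part of U that the balls miss is null, and f is Lipschitz, so its image is
    null.\<close>
  have neg: "negligible (f ` (U - (\<Union>i\<in>C. b i)))"
  proof (rule negligible_locally_Lipschitz_image)
    show "negligible (U - (\<Union>i\<in>C. b i))" using C(4) unfolding b_def .
    show "\<exists>T B. open T \<and> x \<in> T \<and> (\<forall>y\<in>(U - (\<Union>i\<in>C. b i)) \<inter> T. norm (f y - f x) \<le> B * norm (y - x))" for x
      using f by (intro exI[of _ UNIV] exI[of _ c]) auto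
  qed simp
  then have neg0: "emeasure lebesgue (f ` (U - (\<Union>i\<in>C. b i))) = 0"
    and negs: "f ` (U - (\<Union>i\<in>C. b i)) \<in> sets lebesgue"
    using negligible_iff_null_sets by auto
  have sub: "(\<Union>i\<in>C. b i) \<subseteq> U" using C(2) unfolding I_def b_def by blast
  then have "f ` U = f ` (U - (\<Union>i\<in>C. b i)) \<union> (\<Union>i\<in>C. f ` b i)" by blast
  then have "emeasure lebesgue (f ` U) \<le> emeasure lebesgue (f ` (U - (\<Union>i\<in>C. b i))) + emeasure lebesgue (\<Union>i\<in>C. f ` b i)"
    using negs b C(1) by (simp only:, intro emeasure_subadditive sets.countable_UN'') auto
  also have "\<dots> = emeasure lebesgue (\<Union>i\<in>C. f ` b i)" using neg0 by simp
  also have "\<dots> = (\<integral>\<^sup>+i. emeasure lebesgue (f ` b i) \<partial>count_space C)"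
    using b C(1) disj(2) by (intro emeasure_UN_countable) auto
  also have "\<dots> = (\<integral>\<^sup>+i. ennreal (c ^ DIM('a)) * emeasure lebesgue (b i) \<partial>count_space C)"
    unfolding b_def emeasure_similarity_ball[OF c f] ..
  also have "\<dots> = ennreal (c ^ DIM('a)) * (\<integral>\<^sup>+i. emeasure lebesgue (b i) \<partial>count_space C)"
    by (rule nn_integral_cmult) simp
  also have "(\<integral>\<^sup>+i. emeasure lebesgue (b i) \<partial>count_space C) = emeasure lebesgue (\<Union>i\<in>C. b i)"
    using b C(1) disj(1) by (intro emeasure_UN_countable[symmetric]) auto
  also have "ennreal (c ^ DIM('a)) * \<dots> \<le> ennreal (c ^ DIM('a)) * emeasure lebesgue U"
    using sub U by (intro mult_left_mono emeasure_mono) auto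
  finally show ?thesis .
qed

text \<open>The lower bound for D comes from the upper bound for the open set U = ball - D: the
  image of the ball has exactly \<open>c ^ DIM('a)\<close> times its measure, and the image of U
  takes up at most the share of U.\<close>

lemma measure_similarity_image_ge:
  fixes f :: "'a::euclidean_space \<Rightarrow> 'a"
  assumes c: "0 < c" and f: "\<And>x y. norm (f x - f y) = c * norm (x - y)" and D: "compact D"
  shows "c ^ DIM('a) * measure lebesgue D \<le> measure lebesgue (f ` D)" "compact (f ` D)"
proof -
  have "continuous_on D f"
    unfolding continuous_on_iff
  proof (intro ballI allI impI)
    fix x and e :: real assume "e > 0"
    then show "\<exists>d>0. \<forall>x'\<in>D. dist x' x < d \<longrightarrow> dist (f x') (f x) < e"
      using c f by (intro exI[of _ "e / c"]) (auto simp: dist_norm field_simps)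
  qed
  then show fD: "compact (f ` D)" using D by (rule compact_continuous_image)
  obtain R where "D \<subseteq> ball 0 R" using compact_imp_bounded[OF D] by (metis bounded_subset_ballD)
  then have DB: "D \<subseteq> ball 0 R" .
  define U where "U = ball 0 R - D"
  have U: "open U" unfolding U_def using D by (intro open_Diff compact_imp_closed) auto
  have lm: "U \<in> lmeasurable" "D \<in> lmeasurable" "f ` D \<in> lmeasurable" "ball (0::'a) R \<in> lmeasurable"
    using D fD unfolding U_def by (auto intro: lmeasurable_compact fmeasurable_Diff)
  have fin: "emeasure lebesgue A = ennreal (measure lebesgue A)" if "A \<in> lmeasurable" for A :: "'a set"
    using that by (simp add: emeasure_eq_measure2)
  have B: "measure lebesgue (ball (0::'a) R) = measure lebesgue U + measure lebesgue D"
    unfolding U_def using lm DB measurable_measure_Diff[of "ball 0 R" lebesgue D] by (simp add: fmeasurableD)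
  have inj: "inj f" using f c by (intro injI) (metis eq_iff_diff_eq_0 mult_eq_0_iff norm_eq_zero less_irrefl)
  have fU: "f ` U = f ` ball 0 R - f ` D" unfolding U_def using inj by (rule image_set_diff)
  have "f ` U \<in> sets lebesgue"
    unfolding fU similarity_image_ball[OF c f] using lm(3) by (intro sets.Diff) (auto simp: fmeasurableD)
  then have "emeasure lebesgue (f ` U \<union> f ` D) \<le> emeasure lebesgue (f ` U) + emeasure lebesgue (f ` D)"
    by (rule emeasure_subadditive) (rule fmeasurableD[OF lm(3)])
  moreover have "f ` U \<union> f ` D = f ` ball 0 R" unfolding U_def using DB by blast
  ultimately have "emeasure lebesgue (f ` ball 0 R) \<le> emeasure lebesgue (f ` U) + emeasure lebesgue (f ` D)"
    by simp
  also have "\<dots> \<le> ennreal (c ^ DIM('a)) * emeasure lebesgue U + emeasure lebesgue (f ` D)"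
    by (intro add_mono emeasure_similarity_open_le[OF c f U]) simp
  finally have le: "ennreal (c ^ DIM('a)) * emeasure lebesgue (ball (0::'a) R)
      \<le> ennreal (c ^ DIM('a)) * emeasure lebesgue U + emeasure lebesgue (f ` D)"
    unfolding emeasure_similarity_ball[OF c f] .
  from le[unfolded fin[OF lm(1)] fin[OF lm(3)] fin[OF lm(4)]]
  have "ennreal (c ^ DIM('a) * measure lebesgue (ball (0::'a) R))
      \<le> ennreal (c ^ DIM('a) * measure lebesgue U + measure lebesgue (f ` D))"
    by (simp only: ennreal_mult ennreal_plus measure_nonneg zero_le_power less_imp_le[OF c]
        mult_nonneg_nonneg)
  then have "c ^ DIM('a) * measure lebesgue (ball (0::'a) R)
      \<le> c ^ DIM('a) * measure lebesgue U + measure lebesgue (f ` D)"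
    by (subst (asm) ennreal_le_iff) (use c in auto)
  then show "c ^ DIM('a) * measure lebesgue D \<le> measure lebesgue (f ` D)"
    unfolding B by (simp add: algebra_simps)
qed

text \<open>The sum is the integral of the number of sets through a point, which is at most \<gamma>
  on Q and 0 outside.\<close>

lemma sum_measure_le_multiplicity:
  fixes A :: "'i \<Rightarrow> 'a::euclidean_space set"
  assumes F: "finite F" and A: "\<And>i. i \<in> F \<Longrightarrow> A i \<in> lmeasurable" "\<And>i. i \<in> F \<Longrightarrow> A i \<subseteq> Q"
    and Q: "Q \<in> lmeasurable" and mult: "\<And>p. real (card {i \<in> F. p \<in> A i}) \<le> \<gamma>"
  shows "(\<Sum>i\<in>F. measure lebesgue (A i)) \<le> \<gamma> * measure lebesgue Q"
proof -
  have int: "integrable lebesgue (indicator B :: 'a \<Rightarrow> real)" if "B \<in> lmeasurable" for B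
    using that by (simp add: lmeasurable_iff_integrable)
  have "(\<Sum>i\<in>F. measure lebesgue (A i)) = (\<Sum>i\<in>F. \<integral>p. indicator (A i) p \<partial>lebesgue)"
    using A by (intro sum.cong) (auto simp: fmeasurableD)
  also have "\<dots> = (\<integral>p. (\<Sum>i\<in>F. indicator (A i) p) \<partial>lebesgue)"
    using int A by (intro Bochner_Integration.integral_sum[symmetric]) auto
  also have "\<dots> \<le> (\<integral>p. \<gamma> * indicator Q p \<partial>lebesgue)"
  proof (rule integral_mono)
    show "integrable lebesgue (\<lambda>p. \<Sum>i\<in>F. indicator (A i) p :: real)"
      using int A by (intro Bochner_Integration.integrable_sum) auto
    show "integrable lebesgue (\<lambda>p. \<gamma> * indicator Q p)"
      using int[OF Q] by (intro integrable_mult_right)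
    fix p
    have eq: "(\<Sum>i\<in>F. indicator (A i) p :: real) = real (card {i \<in> F. p \<in> A i})"
      using F by (simp add: indicator_def sum.If_cases Int_def)
    show "(\<Sum>i\<in>F. indicator (A i) p :: real) \<le> \<gamma> * indicator Q p"
    proof (cases "p \<in> Q")
      case True
      then show ?thesis using eq mult[of p] by simp
    next
      case False
      then have "{i \<in> F. p \<in> A i} = {}" using A(2) by blast
      then show ?thesis using eq False by simp
    qed
  qed
  also have "\<dots> = \<gamma> * measure lebesgue Q" using Q by (simp add: fmeasurableD)
  finally show ?thesis .
qed

lemma measure_cball_scale:
  fixes z :: "'a::euclidean_space"
  assumes "0 < R"
  shows "measure lebesgue (cball z R) = R ^ DIM('a) * unit_ball_vol (DIM('a))"
  using content_cball[of R z] assms by (simp add: mult.commute)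

section \<open>Words\<close>

lemma word_map_Nil [simp]: "word_map S [] = id"
  and word_map_Cons: "word_map S (j # w) = S j \<circ> word_map S w"
  unfolding word_map_def by simp_all

lemma word_map_append: "word_map S (u @ v) = word_map S u \<circ> word_map S v"
  by (induction u) (auto simp: word_map_Cons fun_eq_iff)

lemma word_ratio_Nil [simp]: "word_ratio \<rho> [] = 1"
  and word_ratio_Cons: "word_ratio \<rho> (j # w) = \<rho> j * word_ratio \<rho> w"
  and word_ratio_append: "word_ratio \<rho> (u @ v) = word_ratio \<rho> u * word_ratio \<rho> v"
  unfolding word_ratio_def by simp_all

locale self_similar_ifs =
  fixes N :: nat and S :: "nat \<Rightarrow> real ^ 'd \<Rightarrow> real ^ 'd" and \<rho> :: "nat \<Rightarrow> real"
    and K :: "(real ^ 'd) set"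
  assumes ifs: "similitude_ifs N S \<rho>" and self_similar: "self_similar_set N S K"
begin

abbreviation W where "W \<equiv> lists {1..N}"
abbreviation r0 where "r0 \<equiv> min_ratio N \<rho>"
abbreviation level where "level \<equiv> words_level N \<rho>"
abbreviation X where "X \<equiv> ifs_vertices N S \<rho>"
abbreviation rt where "rt \<equiv> ifs_root N S \<rho>"
abbreviation lev where "lev \<equiv> vertex_level N \<rho>"
abbreviation vm where "vm \<equiv> vertex_map S"
abbreviation cell where "cell x \<equiv> vm x ` K"
abbreviation Vt where "Vt \<equiv> vertical_edges N S \<rho>"
abbreviation cl where "cl w \<equiv> word_equiv N S \<rho> `` {w}"

lemma rho: "j \<in> {1..N} \<Longrightarrow> 0 < \<rho> j" "j \<in> {1..N} \<Longrightarrow> \<rho> j < 1"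
  "j \<in> {1..N} \<Longrightarrow> norm (S j p - S j q) = \<rho> j * norm (p - q)"
  using ifs unfolding similitude_ifs_def by auto

lemma N: "1 \<in> {1..N}"
  using ifs unfolding similitude_ifs_def by auto

lemma r0: "0 < r0" "r0 < 1" and r0_le: "j \<in> {1..N} \<Longrightarrow> r0 \<le> \<rho> j"
proof -
  have "r0 \<in> \<rho> ` {1..N}" unfolding min_ratio_def using N by (intro Min_in) auto
  then show "0 < r0" "r0 < 1" using rho by auto
  show "j \<in> {1..N} \<Longrightarrow> r0 \<le> \<rho> j" unfolding min_ratio_def by simp
qed

lemma ratio_pos: "w \<in> W \<Longrightarrow> 0 < word_ratio \<rho> w"
  by (induction w) (use rho(1) in \<open>auto simp: word_ratio_Cons\<close>)

lemma ratio_le_1: "w \<in> W \<Longrightarrow> word_ratio \<rho> w \<le> 1"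
proof (induction w)
  case (Cons j w)
  then show ?case using rho[of j] ratio_pos[of w] by (auto simp: word_ratio_Cons intro!: mult_le_one)
qed simp

lemma ratio_append_le: "u \<in> W \<Longrightarrow> v \<in> W \<Longrightarrow> word_ratio \<rho> (u @ v) \<le> word_ratio \<rho> u"
  unfolding word_ratio_append using ratio_pos[of u] ratio_le_1[of v] by (simp add: mult_le_cancel_left1)

lemma word_similitude: "w \<in> W \<Longrightarrow> norm (word_map S w p - word_map S w q) = word_ratio \<rho> w * norm (p - q)"
  by (induction w) (use rho(3) in \<open>auto simp: word_map_Cons word_ratio_Cons\<close>)

text \<open>A map determines its ratio, read off at a unit vector. With \<open>level_unique\<close>
  this makes the level of a vertex independent of the word.\<close>

lemma ratio_eqI:
  assumes "u \<in> W" "v \<in> W" "word_map S u = word_map S v"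
  shows "word_ratio \<rho> u = word_ratio \<rho> v"
proof -
  obtain e :: "real ^ 'd" where "norm e = 1" using vector_choose_size[of 1] by auto
  then show ?thesis
    using word_similitude[OF assms(1), of e 0] word_similitude[OF assms(2), of e 0] assms(3) by simp
qed

lemma level_0: "level 0 = {[]}"
  unfolding words_level_def by simp

lemma level_W: "w \<in> level n \<Longrightarrow> w \<in> W"
  unfolding words_level_def by (auto split: if_splits)

text \<open>The last letter has ratio at least \<open>r0\<close>, hence the lower bound. The
  resulting half-open intervals are disjoint for different n.\<close>

lemma level_ratio:
  assumes "w \<in> level n"
  shows "word_ratio \<rho> w \<le> r0 ^ n" "r0 ^ Suc n < word_ratio \<rho> w"
proof -
  have "word_ratio \<rho> w \<le> r0 ^ n \<and> r0 ^ Suc n < word_ratio \<rho> w"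
  proof (cases "n = 0")
    case True
    then show ?thesis using assms level_0 r0 by simp
  next
    case False
    then have w: "w \<in> W" "w \<noteq> []" "word_ratio \<rho> w \<le> r0 ^ n" "r0 ^ n < word_ratio \<rho> (butlast w)"
      using assms unfolding words_level_def by auto
    have l: "last w \<in> {1..N}" using w(1,2) last_in_set by blast
    have "word_ratio \<rho> w = word_ratio \<rho> (butlast w) * \<rho> (last w)"
      using word_ratio_append[of \<rho> "butlast w" "[last w]"] w(2) by (simp add: word_ratio_Cons)
    moreover have "r0 ^ n * r0 < word_ratio \<rho> (butlast w) * \<rho> (last w)"
      using w(4) r0_le[OF l] r0 by (intro mult_less_le_imp_less) auto
    ultimately show ?thesis using w(3) by (simp add: mult.commute)
  qed
  then show "word_ratio \<rho> w \<le> r0 ^ n" "r0 ^ Suc n < word_ratio \<rho> w" by auto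
qed

lemma level_unique:
  assumes "u \<in> level n" "v \<in> level m" "word_ratio \<rho> u = word_ratio \<rho> v"
  shows "n = m"
proof (rule ccontr)
  have *: False if "u \<in> level n" "v \<in> level m" "word_ratio \<rho> u = word_ratio \<rho> v" "n < m" for u v n m
  proof -
    have "r0 ^ m \<le> r0 ^ Suc n" using that(4) r0 by (intro power_decreasing) auto
    then show False using level_ratio(2)[OF that(1)] level_ratio(1)[OF that(2)] that(3) by linarith
  qed
  assume "n \<noteq> m"
  then show False using *[of u n v m] *[of v m u n] assms by (metis nat_neq_iff)
qed

lemma level_crossing:
  assumes w: "w \<in> W" and n: "n \<ge> 1" and le: "word_ratio \<rho> w \<le> r0 ^ n"
  obtains m where "take m w \<in> level n"
proof -
  define m where "m = (LEAST m. word_ratio \<rho> (take m w) \<le> r0 ^ n)"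
  have m: "word_ratio \<rho> (take m w) \<le> r0 ^ n"
    unfolding m_def by (rule LeastI[of _ "length w"]) (use le in simp)
  have least: "r0 ^ n < word_ratio \<rho> (take k w)" if "k < m" for k
    using not_less_Least[of k "\<lambda>m. word_ratio \<rho> (take m w) \<le> r0 ^ n"] that unfolding m_def by simp
  have ml: "m \<le> length w" unfolding m_def by (rule Least_le) (use le in simp)
  have "r0 ^ n < 1" using r0 n by (simp add: power_less_one_iff)
  then have m0: "m \<noteq> 0" using m by (cases m) auto
  have "take m w \<noteq> []"
    using m \<open>r0 ^ n < 1\<close> by (metis linorder_not_le word_ratio_Nil)
  moreover have "take m w \<in> W" using w by (auto dest: in_set_takeD)
  moreover have "butlast (take m w) = take (m - 1) w" using ml by (rule butlast_take)
  ultimately have "take m w \<in> level n"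
    unfolding words_level_def using m least[of "m - 1"] m0 n by auto
  then show ?thesis by (rule that)
qed

lemma long_words_small:
  obtains L where "\<And>w. w \<in> W \<Longrightarrow> L \<le> length w \<Longrightarrow> word_ratio \<rho> w < r0 ^ n"
proof -
  define R where "R = Max (\<rho> ` {1..N})"
  have "R \<in> \<rho> ` {1..N}" unfolding R_def using N by (intro Max_in) auto
  then have R: "0 < R" "R < 1" using rho by auto
  have le: "word_ratio \<rho> w \<le> R ^ length w" if "w \<in> W" for w
    using that
  proof (induction w)
    case (Cons j w)
    then have "\<rho> j \<le> R" unfolding R_def by (intro Max_ge) auto
    then show ?case using Cons rho(1)[of j] ratio_pos[of w] R
      by (auto simp: word_ratio_Cons intro!: mult_mono)
  qed simp
  obtain L where L: "R ^ L < r0 ^ n" using real_arch_pow_inv[of "r0 ^ n" R] R r0 by auto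
  show ?thesis
  proof (rule that)
    fix w assume w: "w \<in> W" "L \<le> length w"
    then have "R ^ length w \<le> R ^ L" using R by (intro power_decreasing) auto
    then show "word_ratio \<rho> w < r0 ^ n" using le[OF w(1)] L by linarith
  qed
qed

lemma finite_words_level: "finite (level n)"
proof -
  obtain L where L: "\<And>w. w \<in> W \<Longrightarrow> L \<le> length w \<Longrightarrow> word_ratio \<rho> w < r0 ^ Suc n"
    using long_words_small by blast
  have "length w \<le> L" if "w \<in> level n" for w
  proof (rule ccontr)
    assume "\<not> length w \<le> L"
    then show False using L[OF level_W[OF that]] level_ratio(2)[OF that] by simp
  qed
  then have "level n \<subseteq> {w. set w \<subseteq> {1..N} \<and> length w \<le> L}" using level_W by auto
  then show ?thesis using finite_lists_length_le[of "{1..N}" L] by (rule finite_subset) simp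
qed

lemma K: "compact K" "K \<noteq> {}" "K = (\<Union>j\<in>{1..N}. S j ` K)"
  using self_similar unfolding self_similar_set_def by auto

lemma word_map_K: "w \<in> W \<Longrightarrow> word_map S w ` K \<subseteq> K"
proof (induction w)
  case (Cons j w)
  then have "S j ` (word_map S w ` K) \<subseteq> S j ` K" "j \<in> {1..N}" by auto
  then show ?case using K(3) by (force simp: word_map_Cons image_comp[symmetric])
qed simp

lemma word_of_length:
  assumes "z \<in> K"
  shows "\<exists>w\<in>W. length w = m \<and> z \<in> word_map S w ` K"
  using assms
proof (induction m arbitrary: z)
  case (Suc m)
  obtain j q where j: "j \<in> {1..N}" "q \<in> K" "z = S j q" using Suc.prems K(3) by blast
  obtain w where w: "w \<in> W" "length w = m" "q \<in> word_map S w ` K" using Suc.IH[OF j(2)] by auto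
  then have "z \<in> word_map S (j # w) ` K" using j by (auto simp: word_map_Cons)
  then show ?case using w j(1) by (intro bexI[of _ "j # w"]) auto
qed auto

text \<open>A long coding word of the preimage of z is appended to u, and the result is cut where
  its ratio first drops to \<open>r0 ^ Suc n\<close>. The cut lies beyond u, whose ratio is still
  larger.\<close>

lemma level_child:
  assumes u: "u \<in> level n" and z: "z \<in> word_map S u ` K"
  obtains k where "k \<in> W" "u @ k \<in> level (Suc n)" "z \<in> word_map S (u @ k) ` K"
proof -
  obtain q where q: "q \<in> K" "z = word_map S u q" using z by auto
  obtain L where L: "\<And>w. w \<in> W \<Longrightarrow> L \<le> length w \<Longrightarrow> word_ratio \<rho> w < r0 ^ Suc n"
    using long_words_small by blast
  obtain w where w: "w \<in> W" "length w = L" "q \<in> word_map S w ` K" using word_of_length[OF q(1)] by blast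
  have uW: "u \<in> W" by (rule level_W[OF u])
  have "word_ratio \<rho> (u @ w) < r0 ^ Suc n" using uW w by (intro L) auto
  then obtain m where m: "take m (u @ w) \<in> level (Suc n)"
    using level_crossing[of "u @ w" "Suc n"] uW w(1) by auto
  have "length u < m"
  proof (rule ccontr)
    assume "\<not> length u < m"
    then have t: "take m (u @ w) = take m u" by simp
    have "word_ratio \<rho> u \<le> word_ratio \<rho> (take m u)"
    proof -
      have "take m u \<in> W" "drop m u \<in> W" using uW by (auto dest: in_set_takeD in_set_dropD)
      then show ?thesis using ratio_append_le[of "take m u" "drop m u"] by simp
    qed
    then show False using level_ratio(1)[OF m, unfolded t] level_ratio(2)[OF u] by linarith
  qed
  then have t: "take m (u @ w) = u @ take (m - length u) w" by simp
  define k where "k = take (m - length u) w"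
  have k: "k \<in> W" "drop (m - length u) w \<in> W" unfolding k_def using w(1) by (auto dest: in_set_takeD in_set_dropD)
  have "word_map S w ` K = word_map S k ` (word_map S (drop (m - length u) w) ` K)"
    unfolding k_def image_comp word_map_append[symmetric] by simp
  then have "q \<in> word_map S k ` K" using w(3) word_map_K[OF k(2)] by blast
  then have "z \<in> word_map S (u @ k) ` K" unfolding q(2) by (auto simp: word_map_append)
  then show ?thesis using that k(1) m t unfolding k_def by simp
qed

section \<open>Vertices as classes of words\<close>

lemma equiv_words: "equiv (words_J N \<rho>) (word_equiv N S \<rho>)"
  by (rule equivI) (auto simp: refl_on_def sym_def trans_def word_equiv_def)

lemma words_J_level:
  assumes "w \<in> words_J N \<rho>"
  obtains n where "w \<in> level n"
  using assms unfolding words_J_def by auto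

lemma level_words_J: "w \<in> level n \<Longrightarrow> w \<in> words_J N \<rho>"
  unfolding words_J_def by auto

lemma vertex_word:
  assumes "x \<in> X"
  obtains w where "w \<in> x"
  using assms in_quotient_imp_non_empty[OF equiv_words] unfolding ifs_vertices_def by blast

lemma vertex_words:
  assumes "x \<in> X" "u \<in> x"
  shows "u \<in> words_J N \<rho>"
  using assms in_quotient_imp_subset[OF equiv_words] unfolding ifs_vertices_def by blast

lemma vertex_word_maps:
  assumes "x \<in> X" "u \<in> x" "v \<in> x"
  shows "word_map S u = word_map S v"
  using in_quotient_imp_in_rel[OF equiv_words, of x u v] assms
  unfolding ifs_vertices_def word_equiv_def by auto

lemma some_in: "x \<in> X \<Longrightarrow> (SOME w. w \<in> x) \<in> x"
  by (meson someI vertex_word)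

lemma vertex_map_eq: "x \<in> X \<Longrightarrow> u \<in> x \<Longrightarrow> vm x = word_map S u"
  unfolding vertex_map_def by (rule vertex_word_maps[OF _ some_in])

lemma vertex_level_eq:
  assumes x: "x \<in> X" "u \<in> x" "u \<in> level n"
  shows "lev x = n"
proof -
  define w where "w = (SOME w. w \<in> x)"
  have w: "w \<in> x" unfolding w_def by (rule some_in[OF x(1)])
  obtain m where m: "w \<in> level m" using words_J_level[OF vertex_words[OF x(1) w]] .
  have eq: "word_ratio \<rho> u = word_ratio \<rho> w"
    by (rule ratio_eqI[OF level_W[OF x(3)] level_W[OF m] vertex_word_maps[OF x(1,2) w]])
  have nm: "n = m" by (rule level_unique[OF x(3) m eq])
  have "(THE n. w \<in> level n) = n"
  proof (rule the_equality)
    show "w \<in> level n" using m nm by simp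
    show "k = n" if "w \<in> level k" for k using level_unique[OF that m refl] nm by simp
  qed
  then show ?thesis unfolding vertex_level_def w_def .
qed

lemma vertex_in_level:
  assumes x: "x \<in> X" and u: "u \<in> x"
  shows "u \<in> level (lev x)"
proof -
  obtain m where "u \<in> level m" using words_J_level[OF vertex_words[OF x u]] .
  then show ?thesis using vertex_level_eq[OF x u] by simp
qed

lemma cl_vertex:
  assumes "w \<in> level n"
  shows "cl w \<in> X" "w \<in> cl w" "lev (cl w) = n" "vm (cl w) = word_map S w"
proof -
  have w: "w \<in> words_J N \<rho>" by (rule level_words_J[OF assms])
  show x: "cl w \<in> X" unfolding ifs_vertices_def by (rule quotientI[OF w])
  show wx: "w \<in> cl w" by (rule equiv_class_self[OF equiv_words w])
  show "lev (cl w) = n" by (rule vertex_level_eq[OF x wx assms])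
  show "vm (cl w) = word_map S w" by (rule vertex_map_eq[OF x wx])
qed

lemma vertex_eqI:
  assumes x: "x \<in> X" and y: "y \<in> X" and "vm x = vm y"
  shows "x = y"
proof -
  obtain u where u: "u \<in> x" using vertex_word[OF x] .
  obtain v where v: "v \<in> y" using vertex_word[OF y] .
  have "(u, v) \<in> word_equiv N S \<rho>"
    using vertex_words[OF x u] vertex_words[OF y v] vertex_map_eq[OF x u] vertex_map_eq[OF y v] assms(3)
    unfolding word_equiv_def by simp
  then show ?thesis
    using quotient_eqI[OF equiv_words _ _ u v] x y unfolding ifs_vertices_def by simp
qed

lemma vertex_similitude:
  assumes x: "x \<in> X"
  shows "\<exists>c. r0 ^ Suc (lev x) < c \<and> c \<le> r0 ^ lev x \<and> (\<forall>p q. norm (vm x p - vm x q) = c * norm (p - q))"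
proof -
  obtain u where u: "u \<in> x" using vertex_word[OF x] .
  note l = vertex_in_level[OF x u]
  show ?thesis
    using level_ratio[OF l] word_similitude[OF level_W[OF l]] vertex_map_eq[OF x u]
    by (intro exI[of _ "word_ratio \<rho> u"]) simp
qed

lemma lev_0_iff:
  assumes x: "x \<in> X"
  shows "lev x = 0 \<longleftrightarrow> x = rt"
proof
  assume l: "lev x = 0"
  obtain u where u: "u \<in> x" using vertex_word[OF x] .
  have "u = []" using vertex_in_level[OF x u] l level_0 by simp
  then have "vm x = vm (cl [])" using vertex_map_eq[OF x u] cl_vertex(4)[of "[]" 0] level_0 by simp
  then show "x = rt" unfolding ifs_root_def using vertex_eqI[OF x] cl_vertex(1)[of "[]" 0] level_0 by simp
next
  assume "x = rt"
  then show "lev x = 0" unfolding ifs_root_def using cl_vertex(3)[of "[]" 0] level_0 by simp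
qed

lemma rt_X: "rt \<in> X" and vm_rt: "vm rt = id"
  unfolding ifs_root_def using cl_vertex(1,4)[of "[]" 0] level_0 by simp_all

lemma Vt_props:
  assumes "(x, y) \<in> Vt"
  shows "x \<in> X \<and> y \<in> X \<and> lev y = Suc (lev x) \<and> cell y \<subseteq> cell x"
proof -
  obtain u k where xy: "x \<in> X" "y \<in> X" "lev y = Suc (lev x)" "u \<in> x" "u @ k \<in> y" "k \<in> W"
    using assms unfolding vertical_edges_def by auto
  have "vm y ` K = vm x ` (word_map S k ` K)"
    using vertex_map_eq[OF xy(2,5)] vertex_map_eq[OF xy(1,4)] by (simp add: word_map_append image_comp)
  then show ?thesis using word_map_K[OF xy(6)] xy(1-3) by auto
qed

lemma Vt_cl:
  assumes u: "u \<in> level n" and k: "k \<in> W" and uk: "u @ k \<in> level (Suc n)"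
  shows "(cl u, cl (u @ k)) \<in> Vt"
  unfolding vertical_edges_def
  using cl_vertex[OF u] cl_vertex[OF uk] k by auto

lemma cl_eq: "x \<in> X \<Longrightarrow> u \<in> x \<Longrightarrow> cl u = x"
  using cl_vertex(1,4)[OF vertex_in_level] vertex_map_eq by (intro vertex_eqI) auto

text \<open>The parent is the class of a prefix of a word of y, cut at the threshold of level n.
  Level 0 is separate, being defined as the empty word and not by a threshold.\<close>

lemma vertex_parent:
  assumes y: "y \<in> X" and n: "lev y = Suc n"
  shows "\<exists>x. (x, y) \<in> Vt"
proof -
  obtain v where v: "v \<in> y" using vertex_word[OF y] .
  have vl: "v \<in> level (Suc n)" using vertex_in_level[OF y v] n by simp
  have vW: "v \<in> W" by (rule level_W[OF vl])
  obtain m where m: "take m v \<in> level n"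
  proof (cases "n = 0")
    case True
    then show ?thesis using that[of 0] level_0 by simp
  next
    case False
    have "word_ratio \<rho> v \<le> r0 ^ Suc n" by (rule level_ratio(1)[OF vl])
    also have "\<dots> \<le> r0 ^ n" using r0 by (intro power_decreasing) auto
    finally show ?thesis using level_crossing[OF vW] False that by (metis One_nat_def Suc_leI not_gr_zero)
  qed
  have "(cl (take m v), cl (take m v @ drop m v)) \<in> Vt"
    using vl vW by (intro Vt_cl[OF m]) (auto dest: in_set_dropD)
  then show ?thesis using cl_eq[OF y v] by auto
qed

lemma vertex_child:
  assumes x: "x \<in> X" and z: "z \<in> cell x"
  shows "\<exists>y. (x, y) \<in> Vt \<and> z \<in> cell y"
proof -
  obtain u where u: "u \<in> x" using vertex_word[OF x] .
  note ul = vertex_in_level[OF x u]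
  have "z \<in> word_map S u ` K" using z vertex_map_eq[OF x u] by simp
  then obtain k where k: "k \<in> W" "u @ k \<in> level (Suc (lev x))" "z \<in> word_map S (u @ k) ` K"
    using level_child[OF ul] by blast
  then show ?thesis using Vt_cl[OF ul k(1,2)] cl_eq[OF x u] cl_vertex(4)[OF k(2)] by auto
qed

lemma finite_vertices_level: "finite {x \<in> X. lev x = n}"
proof (rule finite_subset)
  show "{x \<in> X. lev x = n} \<subseteq> cl ` level n"
  proof
    fix x assume "x \<in> {x \<in> X. lev x = n}"
    then have x: "x \<in> X" "lev x = n" by auto
    obtain u where u: "u \<in> x" using vertex_word[OF x(1)] .
    then have "x = cl u" "u \<in> level n" using cl_eq[OF x(1) u] vertex_in_level[OF x(1) u] x(2) by simp_all
    then show "x \<in> cl ` level n" by (rule image_eqI)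
  qed
qed (use finite_words_level in simp)

lemma cell_compact:
  assumes x: "x \<in> X"
  shows "compact (cell x)"
proof -
  obtain c where c: "r0 ^ Suc (lev x) < c" "c \<le> r0 ^ lev x" "\<And>p q. norm (vm x p - vm x q) = c * norm (p - q)"
    using vertex_similitude[OF x] by auto
  have "0 < r0 ^ Suc (lev x)" using r0 by simp
  then have "0 < c" using c(1) by linarith
  then show ?thesis by (rule measure_similarity_image_ge(2)[OF _ c(3) K(1)])
qed

text \<open>Distinct vertices have distinct maps, so the maps of a family of vertices of level n with
  disjoint cells overlap at most \<open>\<gamma>\<close> times on \<open>D = K\<close> (with \<open>\<gamma> = 1\<close>) or, under the weak
  separation condition, on the set provided by that condition.\<close>

lemma overlap_bound:
  assumes "emeasure lebesgue K > 0 \<or> weak_separation N S \<rho>"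
  shows "\<exists>D \<gamma>. compact D \<and> measure lebesgue D > 0 \<and> (0::real) \<le> \<gamma> \<and>
    (\<forall>F n p. F \<subseteq> {x \<in> X. lev x = n} \<longrightarrow> (\<forall>x\<in>F. \<forall>y\<in>F. x \<noteq> y \<longrightarrow> cell x \<inter> cell y = {}) \<longrightarrow>
      real (card {x \<in> F. p \<in> vm x ` D}) \<le> \<gamma>)"
  using assms
proof
  assume pos: "emeasure lebesgue K > 0"
  show ?thesis
  proof (intro exI[of _ K] exI[of _ 1] conjI allI impI)
    show "compact K" by (rule K(1))
    have "emeasure lebesgue K = ennreal (measure lebesgue K)"
      using lmeasurable_compact[OF K(1)] by (simp add: emeasure_eq_measure2)
    then show "measure lebesgue K > 0" using pos by simp
    show "(0::real) \<le> 1" by simp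
    fix F n and p :: "real ^ 'd"
    assume F: "F \<subseteq> {x \<in> X. lev x = n}" and d: "\<forall>x\<in>F. \<forall>y\<in>F. x \<noteq> y \<longrightarrow> cell x \<inter> cell y = {}"
    have fin: "finite {x \<in> F. p \<in> cell x}"
      by (rule finite_subset[OF _ finite_vertices_level[of n]]) (use F in auto)
    have "x = y" if "x \<in> F" "p \<in> cell x" "y \<in> F" "p \<in> cell y" for x y
    proof (rule ccontr)
      assume "x \<noteq> y"
      then have "cell x \<inter> cell y = {}" using that(1,3) d by simp
      then show False using that(2,4) by blast
    qed
    then have "card {x \<in> F. p \<in> cell x} \<le> Suc 0"
      unfolding card_le_Suc0_iff_eq[OF fin] mem_Collect_eq by (intro ballI) auto
    then show "real (card {x \<in> F. p \<in> cell x}) \<le> 1" by simp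
  qed
next
  assume "weak_separation N S \<rho>"
  then show ?thesis
    unfolding weak_separation_def
  proof (elim exE conjE)
    fix \<gamma> :: real and D :: "(real ^ 'd) set"
    assume D: "\<gamma> > 0" "compact D" "interior D \<noteq> {}"
      and overlap: "\<forall>n\<ge>1. \<forall>p. real (card {f \<in> word_map S ` level n. p \<in> f ` D}) \<le> \<gamma>"
    show ?thesis
    \<comment> \<open>The maximum with 1 covers level 0, about which the weak separation condition
      says nothing; only the root lies there.\<close>
    proof (intro exI[of _ D] exI[of _ "max \<gamma> 1"] conjI allI impI)
      show "compact D" by (rule D(2))
      have "\<not> negligible D"
        using negligible_subset[OF _ interior_subset, of D] open_not_negligible[OF open_interior D(3)] by auto
      then have "measure lebesgue D \<noteq> 0"
        using lmeasurable_compact[OF D(2)] by (simp add: negligible_iff_measure)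
      then show "measure lebesgue D > 0" using measure_nonneg[of lebesgue D] by linarith
      show "0 \<le> max \<gamma> 1" using D(1) by simp
      fix F n and p :: "real ^ 'd"
      assume F: "F \<subseteq> {x \<in> X. lev x = n}"
      have fin: "finite F" by (rule finite_subset[OF F finite_vertices_level])
      show "real (card {x \<in> F. p \<in> vm x ` D}) \<le> max \<gamma> 1"
      proof (cases "n = 0")
        case True
        then have "{x \<in> F. p \<in> vm x ` D} \<subseteq> {rt}" using F lev_0_iff by blast
        then have "card {x \<in> F. p \<in> vm x ` D} \<le> card {rt}" by (intro card_mono) auto
        then show ?thesis by simp
      next
        case False
        have inj: "inj_on vm {x \<in> F. p \<in> vm x ` D}"
        proof (rule inj_onI)
          fix x y assume "x \<in> {x \<in> F. p \<in> vm x ` D}" "y \<in> {x \<in> F. p \<in> vm x ` D}" "vm x = vm y"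
          then show "x = y" using F by (intro vertex_eqI) auto
        qed
        have "vm x \<in> word_map S ` level n" if x: "x \<in> F" for x
        proof -
          have xX: "x \<in> X" "lev x = n" using F x by auto
          obtain u where u: "u \<in> x" using vertex_word[OF xX(1)] .
          show ?thesis using vertex_map_eq[OF xX(1) u] vertex_in_level[OF xX(1) u] xX(2) by auto
        qed
        then have sub: "vm ` {x \<in> F. p \<in> vm x ` D} \<subseteq> {f \<in> word_map S ` level n. p \<in> f ` D}" by auto
        have "card {x \<in> F. p \<in> vm x ` D} = card (vm ` {x \<in> F. p \<in> vm x ` D})"
          using inj by (simp add: card_image)
        also have "\<dots> \<le> card {f \<in> word_map S ` level n. p \<in> f ` D}"
          using sub finite_words_level by (intro card_mono) auto
        finally have "real (card {x \<in> F. p \<in> vm x ` D}) \<le> real (card {f \<in> word_map S ` level n. p \<in> f ` D})"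
          by simp
        also have "\<dots> \<le> \<gamma>" using overlap False by simp
        finally show ?thesis by simp
      qed
    qed
  qed
qed

lemma packing_bound:
  assumes sep: "emeasure lebesgue K > 0 \<or> weak_separation N S \<rho>" and B: "0 < B"
  shows "\<exists>M0. \<forall>F n z. F \<subseteq> {x \<in> X. lev x = n} \<longrightarrow>
      (\<forall>x\<in>F. \<forall>y\<in>F. x \<noteq> y \<longrightarrow> cell x \<inter> cell y = {}) \<longrightarrow>
      (\<forall>x\<in>F. cell x \<subseteq> cball z (2 * B * r0 ^ n)) \<longrightarrow> card F \<le> M0"
proof -
  obtain D \<gamma> where D: "compact D" "measure lebesgue D > 0" "0 \<le> \<gamma>"
    and overlap: "\<forall>F n p. F \<subseteq> {x \<in> X. lev x = n} \<longrightarrow>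
      (\<forall>x\<in>F. \<forall>y\<in>F. x \<noteq> y \<longrightarrow> cell x \<inter> cell y = {}) \<longrightarrow>
      real (card {x \<in> F. p \<in> vm x ` D}) \<le> \<gamma>"
    using overlap_bound[OF sep] by (elim exE conjE) (rule that)
  let ?d = "CARD('d)"
  define om where "om = unit_ball_vol (real ?d)"
  obtain k0 where k0: "k0 \<in> K" using K(2) by blast
  obtain R' where R': "\<And>p. p \<in> D \<Longrightarrow> norm (p - k0) \<le> R'"
    using compact_imp_bounded[OF D(1)] unfolding bounded_any_center[of D k0]
    by (auto simp: dist_norm norm_minus_commute)
  \<comment> \<open>D may lie away from K; R' bounds its distance from a point of K, whose image
    lies in the given ball.\<close>
  define R where "R = 2 * B + \<bar>R'\<bar>"
  have R: "0 < R" unfolding R_def using B by simp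
  define Q where "Q = \<gamma> * (R ^ ?d * om) / (r0 ^ ?d * measure lebesgue D)"
  have "real (card F) \<le> Q"
    if F: "F \<subseteq> {x \<in> X. lev x = n}"
      and d: "\<forall>x\<in>F. \<forall>y\<in>F. x \<noteq> y \<longrightarrow> cell x \<inter> cell y = {}"
      and ball: "\<And>x. x \<in> F \<Longrightarrow> cell x \<subseteq> cball z (2 * B * r0 ^ n)" for F n z
  proof -
    have fin: "finite F" by (rule finite_subset[OF F finite_vertices_level])
    have rn: "0 < r0 ^ n" using r0 by simp
    have x: "vm x ` D \<in> lmeasurable \<and> vm x ` D \<subseteq> cball z (R * r0 ^ n) \<and>
      (r0 ^ Suc n) ^ ?d * measure lebesgue D \<le> measure lebesgue (vm x ` D)" if xF: "x \<in> F" for x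
    proof -
      have xX: "x \<in> X" "lev x = n" using F xF by auto
      obtain c where c: "r0 ^ Suc n < c" "c \<le> r0 ^ n" "\<And>p q. norm (vm x p - vm x q) = c * norm (p - q)"
        using vertex_similitude[OF xX(1)] unfolding xX(2) by auto
      have "0 < r0 ^ Suc n" using r0 by simp
      then have c0: "0 < c" using c(1) by linarith
      note m = measure_similarity_image_ge[OF c0 c(3) D(1)]
      have "(r0 ^ Suc n) ^ ?d * measure lebesgue D \<le> c ^ ?d * measure lebesgue D"
        using c(1) r0 by (intro mult_right_mono power_mono) auto
      then have le: "(r0 ^ Suc n) ^ ?d * measure lebesgue D \<le> measure lebesgue (vm x ` D)"
        using m(1) by simp
      have "vm x p \<in> cball z (R * r0 ^ n)" if p: "p \<in> D" for p
      proof -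
        have "norm (vm x p - vm x k0) = c * norm (p - k0)" by (rule c(3))
        also have "\<dots> \<le> r0 ^ n * \<bar>R'\<bar>" using c(2) R'[OF p] rn by (intro mult_mono) auto
        finally have 1: "dist (vm x k0) (vm x p) \<le> r0 ^ n * \<bar>R'\<bar>" by (simp add: dist_norm norm_minus_commute)
        have "dist z (vm x k0) \<le> 2 * B * r0 ^ n" using ball[OF xF] k0 by auto
        then have "dist z (vm x p) \<le> 2 * B * r0 ^ n + r0 ^ n * \<bar>R'\<bar>"
          using 1 dist_triangle[of z "vm x p" "vm x k0"] by linarith
        then show ?thesis unfolding R_def by (simp add: algebra_simps)
      qed
      then show ?thesis using le lmeasurable_compact[OF m(2)] by blast
    qed
    have "real (card F) * ((r0 ^ Suc n) ^ ?d * measure lebesgue D) \<le> (\<Sum>x\<in>F. measure lebesgue (vm x ` D))"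
      using sum_bounded_below[of F "(r0 ^ Suc n) ^ ?d * measure lebesgue D" "\<lambda>x. measure lebesgue (vm x ` D)"] x
      by simp
    also have "\<dots> \<le> \<gamma> * measure lebesgue (cball z (R * r0 ^ n))"
      using x overlap[rule_format, OF F d[rule_format]] by (intro sum_measure_le_multiplicity fin) auto
    also have "\<dots> = \<gamma> * ((R * r0 ^ n) ^ ?d * om)"
      unfolding om_def using measure_cball_scale[of "R * r0 ^ n" z] R rn by simp
    finally have "real (card F) * (r0 ^ ?d * measure lebesgue D) * (r0 ^ n) ^ ?d \<le> \<gamma> * (R ^ ?d * om) * (r0 ^ n) ^ ?d"
      by (simp add: power_mult_distrib mult_ac)
    then have "real (card F) * (r0 ^ ?d * measure lebesgue D) \<le> \<gamma> * (R ^ ?d * om)"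
      by (rule mult_right_le_imp_le) (use rn in simp)
    then show ?thesis unfolding Q_def using r0 D(2) by (simp add: pos_le_divide_eq)
  qed
  note Q = this
  have "card F \<le> nat \<lceil>Q\<rceil>" if F: "F \<subseteq> {x \<in> X. lev x = n}"
      and d: "\<forall>x\<in>F. \<forall>y\<in>F. x \<noteq> y \<longrightarrow> cell x \<inter> cell y = {}"
      and ball: "\<forall>x\<in>F. cell x \<subseteq> cball z (2 * B * r0 ^ n)" for F n z
  proof -
    have "real (card F) \<le> Q" by (rule Q[OF F d, of z]) (use ball in blast)
    also have "Q \<le> real (nat \<lceil>Q\<rceil>)" by (rule real_nat_ceiling_ge)
    finally show ?thesis by simp
  qed
  then show ?thesis by blast
qed

end

section \<open>The two graphs of an iterated function system\<close>

context cell_system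
begin

definition plus_edges where
  "plus_edges = {(x, y). x \<in> V \<and> y \<in> V \<and> lev y = lev x + 1 \<and> cell x \<inter> cell y \<noteq> {} \<and> (x, y) \<notin> Vt}"

lemma near_sym: "near l x y \<Longrightarrow> near l y x"
proof -
  assume "near l x y"
  then obtain x' y' where n: "(x', x) \<in> Vt\<^sup>*" "(y', y) \<in> Vt\<^sup>*" "lev x' = l" "lev y' = l" "(x', y') \<in> touch ^^ M"
    unfolding near_def by auto
  then show ?thesis unfolding near_def using relpow_sym[OF sym_touch n(5)] by blast
qed

lemma near_touch:
  assumes "(x, y) \<in> touch"
  shows "near (lev x) x y"
proof -
  obtain z where "z \<in> cell x" "z \<in> cell y" "x \<in> V" "y \<in> V" "lev x = lev y"
    using assms unfolding touch_def by auto
  then show ?thesis by (intro near_touchI[of x y x y "lev x" z]) auto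
qed

lemma near_Vt:
  assumes "(x, y) \<in> Vt"
  shows "near (lev x) x y"
proof -
  have V: "x \<in> V" "y \<in> V" using Vt[OF assms] by auto
  obtain z where "z \<in> cell x" using cell_ne[OF V(1)] by auto
  then show ?thesis using V assms by (intro near_touchI[of x y x x "lev x" z]) auto
qed

text \<open>A parent of y has a cell containing that of y, so it meets the cell of x on the level of
  x.\<close>

lemma near_plus:
  assumes "(x, y) \<in> plus_edges"
  shows "near (lev x) x y"
proof -
  obtain z where z: "z \<in> cell x" "z \<in> cell y" "x \<in> V" "y \<in> V" "lev y = Suc (lev x)"
    using assms unfolding plus_edges_def by auto
  obtain w where w: "(w, y) \<in> Vt" using parent[OF z(4,5)] by auto
  show ?thesis
    using Vt[OF w] z w by (intro near_touchI[of x y x w "lev x" z]) auto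
qed

lemma cell_graph_horizontal:
  "cell_graph V rt lev Vt cell r B K M0 (sym_closure (Vt \<union> {(x, y) \<in> touch. x \<noteq> y})) 1"
proof (intro cell_graph.intro cell_system_axioms cell_graph_axioms.intro)
  let ?G = "sym_closure (Vt \<union> {(x, y) \<in> touch. x \<noteq> y})"
  have cases: "(x, y) \<in> Vt \<or> (y, x) \<in> Vt \<or> (x, y) \<in> touch" if "(x, y) \<in> ?G" for x y
    using that symD[OF sym_touch, of y x] unfolding sym_closure_def by auto
  show "?G \<subseteq> V \<times> V" unfolding sym_closure_def touch_def by (auto dest: Vt)
  show "sym ?G" by (rule sym_sym_closure)
  show "Vt \<subseteq> ?G" unfolding sym_closure_def by auto
  fix x y
  show "lev y \<le> Suc (lev x)" if "(x, y) \<in> ?G"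
    using cases[OF that] Vt[of x y] Vt[of y x] by (auto simp: touch_def)
  show "near (min (lev x) (lev y)) x y" if "(x, y) \<in> ?G"
    using cases[OF that]
  proof (elim disjE)
    assume a: "(x, y) \<in> Vt"
    then show ?thesis using near_Vt[OF a] Vt[OF a] by (simp add: min_def)
  next
    assume a: "(y, x) \<in> Vt"
    then show ?thesis using near_sym[OF near_Vt[OF a]] Vt[OF a] by (simp add: min_def)
  next
    assume a: "(x, y) \<in> touch"
    then have "lev x = lev y" unfolding touch_def by simp
    then show ?thesis using near_touch[OF a] by simp
  qed
  show "\<exists>k\<le>1. (x, y) \<in> ?G ^^ k" if "(x, y) \<in> touch"
  proof (cases "x = y")
    case True
    then show ?thesis by (intro exI[of _ 0]) simp
  next
    case False
    then have "(x, y) \<in> ?G" using that unfolding sym_closure_def by simp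
    then show ?thesis by (intro exI[of _ 1]) simp
  qed
qed

text \<open>There are no horizontal edges, but a parent w of x has a cell meeting that of y, so (w,
  y) is an edge of one of the two vertical kinds. A contact thus costs two edges, by way of
  w.\<close>

lemma cell_graph_diamond:
  "cell_graph V rt lev Vt cell r B K M0 (sym_closure (Vt \<union> plus_edges)) 2"
proof (intro cell_graph.intro cell_system_axioms cell_graph_axioms.intro)
  let ?G = "sym_closure (Vt \<union> plus_edges)"
  have cases: "(x, y) \<in> Vt \<or> (y, x) \<in> Vt \<or> (x, y) \<in> plus_edges \<or> (y, x) \<in> plus_edges"
    if "(x, y) \<in> ?G" for x y
    using that unfolding sym_closure_def by auto
  show "?G \<subseteq> V \<times> V" unfolding sym_closure_def plus_edges_def by (auto dest: Vt)
  show "sym ?G" by (rule sym_sym_closure)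
  show "Vt \<subseteq> ?G" unfolding sym_closure_def by auto
  fix x y
  show "lev y \<le> Suc (lev x)" if "(x, y) \<in> ?G"
    using cases[OF that]
  proof (elim disjE)
    assume "(x, y) \<in> Vt"
    from Vt[OF this] show ?thesis by simp
  next
    assume "(y, x) \<in> Vt"
    from Vt[OF this] show ?thesis by simp
  qed (simp_all add: plus_edges_def)
  show "near (min (lev x) (lev y)) x y" if "(x, y) \<in> ?G"
    using cases[OF that]
  proof (elim disjE)
    assume a: "(x, y) \<in> Vt"
    then show ?thesis using near_Vt[OF a] Vt[OF a] by (simp add: min_def)
  next
    assume a: "(y, x) \<in> Vt"
    then show ?thesis using near_sym[OF near_Vt[OF a]] Vt[OF a] by (simp add: min_def)
  next
    assume a: "(x, y) \<in> plus_edges"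
    then have "lev y = lev x + 1" unfolding plus_edges_def by simp
    then show ?thesis using near_plus[OF a] by (simp add: min_def)
  next
    assume a: "(y, x) \<in> plus_edges"
    then have "lev x = lev y + 1" unfolding plus_edges_def by simp
    then show ?thesis using near_sym[OF near_plus[OF a]] by (simp add: min_def)
  qed
  show "\<exists>k\<le>2. (x, y) \<in> ?G ^^ k" if t: "(x, y) \<in> touch"
  proof (cases "x = y")
    case True
    then show ?thesis by (intro exI[of _ 0]) simp
  next
    case False
    have xy: "x \<in> V" "y \<in> V" "lev x = lev y" "cell x \<inter> cell y \<noteq> {}" using t unfolding touch_def by auto
    \<comment> \<open>The root is the only vertex on level 0, so x and y have parents.\<close>
    then have "lev x \<noteq> 0" using False lev_0[of x] lev_0[of y] by auto
    then obtain n where n: "lev x = Suc n" by (cases "lev x") auto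
    obtain w where w: "(w, x) \<in> Vt" using parent[OF xy(1) n] by auto
    have "w \<in> V" "lev y = lev w + 1" "cell w \<inter> cell y \<noteq> {}"
      using Vt[OF w] xy(3,4) n by auto
    then have "(w, y) \<in> Vt \<union> plus_edges" using xy(2) unfolding plus_edges_def by simp
    then have "(x, w) \<in> ?G" "(w, y) \<in> ?G" using w unfolding sym_closure_def by simp_all
    then have "(x, y) \<in> ?G O ?G" by (rule relcompI)
    then have "(x, y) \<in> ?G ^^ 2" by (simp add: numeral_2_eq_2)
    then show ?thesis by (intro exI[of _ 2]) simp
  qed
qed

end

context self_similar_ifs
begin

lemma condition_H_cells:
  assumes "condition_H N S \<rho> K"
  shows "\<exists>c>0. \<forall>n x y u v. 0 < n \<longrightarrow> x \<in> X \<longrightarrow> y \<in> X \<longrightarrow> lev x = n \<longrightarrow> lev y = n \<longrightarrow>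
    cell x \<inter> cell y = {} \<longrightarrow> u \<in> cell x \<longrightarrow> v \<in> cell y \<longrightarrow> c * r0 ^ n \<le> norm (u - v)"
proof -
  from assms[unfolded condition_H_def] obtain c where c: "c > 0" and H: "\<forall>n>0. \<forall>u\<in>level n. \<forall>v\<in>level n.
      word_map S u ` K \<inter> word_map S v ` K \<noteq> {} \<or>
      (\<forall>p\<in>K. \<forall>q\<in>K. c * r0 ^ n \<le> norm (word_map S u p - word_map S v q))"
    by (elim exE conjE) (rule that)
  have "c * r0 ^ n \<le> norm (u - v)"
    if n: "0 < n" and x: "x \<in> X" "lev x = n" and y: "y \<in> X" "lev y = n"
      and disj: "cell x \<inter> cell y = {}" and uv: "u \<in> cell x" "v \<in> cell y" for n x y u v
  proof -
    obtain w where w: "w \<in> x" using vertex_word[OF x(1)] .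
    obtain w' where w': "w' \<in> y" using vertex_word[OF y(1)] .
    have l: "w \<in> level n" "w' \<in> level n"
      using vertex_in_level[OF x(1) w] vertex_in_level[OF y(1) w'] x(2) y(2) by auto
    note m = vertex_map_eq[OF x(1) w] vertex_map_eq[OF y(1) w']
    obtain p q where pq: "p \<in> K" "u = word_map S w p" "q \<in> K" "v = word_map S w' q"
      using uv unfolding m by auto
    show ?thesis
      unfolding pq(2,4) using H[rule_format, OF n l] disj[unfolded m] pq(1,3) by simp
  qed
  note bound = this
  show ?thesis by (intro exI[of _ c] conjI allI impI c) (rule bound)
qed

lemma boundary_homeomorphism:
  assumes G: "cell_graph X rt lev Vt cell r0 B K M0 G kt"
    and hyp: "hyperbolic_graph X G rt \<delta>" "\<delta> > 0" "a > 0" "exp (\<delta> * a) < sqrt 2"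
  shows "\<exists>\<Phi>. homeomorphic_map (hyp_boundary_topology X G rt a) (top_of_set K) \<Phi> \<and>
    (condition_H N S \<rho> K \<longrightarrow>
      (\<exists>C>0. \<forall>\<xi>\<in>hyp_boundary X G rt a. \<forall>\<eta>\<in>hyp_boundary X G rt a.
        norm (\<Phi> \<xi> - \<Phi> \<eta>) \<le> C * boundary_rho X G rt a \<xi> \<eta> powr (- ln r0 / a) \<and>
        boundary_rho X G rt a \<xi> \<eta> powr (- ln r0 / a) \<le> C * norm (\<Phi> \<xi> - \<Phi> \<eta>)))"
proof -
  interpret c: cell_boundary X rt lev Vt cell r0 B K M0 G kt \<delta> a
    by (intro cell_boundary.intro visual_graph.intro G hyp)
  show ?thesis
  proof (intro exI[of _ c.Phi] conjI impI)
    show "homeomorphic_map (hyp_boundary_topology X G rt a) (top_of_set K) c.Phi"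
      by (rule c.homeomorphic_map_Phi)
    assume "condition_H N S \<rho> K"
    from condition_H_cells[OF this] obtain k where k: "k > 0"
      and H: "\<forall>n x y u v. 0 < n \<longrightarrow> x \<in> X \<longrightarrow> y \<in> X \<longrightarrow> lev x = n \<longrightarrow> lev y = n \<longrightarrow>
        cell x \<inter> cell y = {} \<longrightarrow> u \<in> cell x \<longrightarrow> v \<in> cell y \<longrightarrow> k * r0 ^ n \<le> norm (u - v)"
      by (elim exE conjE) (rule that)
    show "\<exists>C>0. \<forall>\<xi>\<in>hyp_boundary X G rt a. \<forall>\<eta>\<in>hyp_boundary X G rt a.
        norm (c.Phi \<xi> - c.Phi \<eta>) \<le> C * boundary_rho X G rt a \<xi> \<eta> powr (- ln r0 / a) \<and>
        boundary_rho X G rt a \<xi> \<eta> powr (- ln r0 / a) \<le> C * norm (c.Phi \<xi> - c.Phi \<eta>)"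
      by (rule c.Hoelder_equivalence[unfolded c.alpha_def, OF k H[rule_format]])
  qed
qed

lemma cell_system_ifs:
  assumes sep: "emeasure lebesgue K > 0 \<or> weak_separation N S \<rho>"
  obtains B M0 where "cell_system X rt lev Vt cell r0 B K M0"
proof -
  \<comment> \<open>The diameter of K plus 1, because B must be positive even if K is a single
    point.\<close>
  obtain B where B: "B > 0" "\<And>p q. p \<in> K \<Longrightarrow> q \<in> K \<Longrightarrow> norm (p - q) \<le> B"
  proof
    fix p q assume "p \<in> K" "q \<in> K"
    then show "norm (p - q) \<le> diameter K + 1"
      using diameter_bounded_bound[OF compact_imp_bounded[OF K(1)], of p q] by (simp add: dist_norm)
  qed (use diameter_ge_0[OF compact_imp_bounded[OF K(1)]] in linarith)
  from packing_bound[OF sep B(1)] obtain M0 where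
    M0: "\<forall>F n z. F \<subseteq> {x \<in> X. lev x = n} \<longrightarrow>
      (\<forall>x\<in>F. \<forall>y\<in>F. x \<noteq> y \<longrightarrow> cell x \<inter> cell y = {}) \<longrightarrow>
      (\<forall>x\<in>F. cell x \<subseteq> cball z (2 * B * r0 ^ n)) \<longrightarrow> card F \<le> M0" ..
  have "cell_system X rt lev Vt cell r0 B K M0"
  proof (rule cell_system.intro)
    show "norm (p - q) \<le> B * r0 ^ lev x" if x: "x \<in> X" and pq: "p \<in> cell x" "q \<in> cell x" for x p q
    proof -
      obtain c where c: "r0 ^ Suc (lev x) < c" "c \<le> r0 ^ lev x" "\<And>p q. norm (vm x p - vm x q) = c * norm (p - q)"
        using vertex_similitude[OF x] by auto
      obtain p' q' where p': "p = vm x p'" "q = vm x q'" "p' \<in> K" "q' \<in> K" using pq by auto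
      have "c * norm (p' - q') \<le> r0 ^ lev x * B"
        using c(2) B(2)[OF p'(3,4)] r0 by (intro mult_mono) auto
      then show ?thesis unfolding p' c(3) by (simp add: mult.commute)
    qed
    show "card F \<le> M0" if "F \<subseteq> {x \<in> X. lev x = n}"
      "\<And>x y. x \<in> F \<Longrightarrow> y \<in> F \<Longrightarrow> x \<noteq> y \<Longrightarrow> cell x \<inter> cell y = {}"
      "\<And>x. x \<in> F \<Longrightarrow> cell x \<subseteq> cball z (2 * B * r0 ^ n)" for F n z
      by (rule M0[rule_format, OF that])
  qed (use r0 B(1) rt_X vm_rt lev_0_iff Vt_props vertex_parent vertex_child finite_vertices_level
      cell_compact K(2) in auto)
  then show ?thesis by (rule that)
qed

end

theorem theorem1p2:
  fixes N :: nat
    and S :: "nat \<Rightarrow> real ^ 'd \<Rightarrow> real ^ 'd"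
    and \<rho> :: "nat \<Rightarrow> real"
    and K :: "(real ^ 'd) set"
  assumes "similitude_ifs N S \<rho>"
    and "self_similar_set N S K"
    and "emeasure lebesgue K > 0 \<or> weak_separation N S \<rho>"
  shows
    "let X = ifs_vertices N S \<rho>; rt = ifs_root N S \<rho>;
         E = ifs_edges N S \<rho> K; E' = ifs_diamond_edges N S \<rho> K
     in (\<exists>\<delta>>0. hyperbolic_graph X E rt \<delta> \<and> hyperbolic_graph X E' rt \<delta>) \<and>
        (\<forall>\<delta> a. \<delta> > 0 \<and> hyperbolic_graph X E rt \<delta> \<and> hyperbolic_graph X E' rt \<delta> \<and>
               a > 0 \<and> exp (\<delta> * a) - 1 < sqrt 2 - 1 \<longrightarrow>
           top_of_set K homeomorphic_space hyp_boundary_topology X E rt a \<and>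
           top_of_set K homeomorphic_space hyp_boundary_topology X E' rt a \<and>
           (condition_H N S \<rho> K \<longrightarrow>
             (\<exists>\<Phi> \<Phi>' C. C > 0 \<and>
               homeomorphic_map (hyp_boundary_topology X E rt a) (top_of_set K) \<Phi> \<and>
               homeomorphic_map (hyp_boundary_topology X E' rt a) (top_of_set K) \<Phi>' \<and>
               (\<forall>\<xi>\<in>hyp_boundary X E rt a. \<forall>\<eta>\<in>hyp_boundary X E rt a.
                  (1 / C) * norm (\<Phi> \<xi> - \<Phi> \<eta>)
                    \<le> boundary_rho X E rt a \<xi> \<eta> powr (- ln (min_ratio N \<rho>) / a) \<and>
                  boundary_rho X E rt a \<xi> \<eta> powr (- ln (min_ratio N \<rho>) / a)
                    \<le> C * norm (\<Phi> \<xi> - \<Phi> \<eta>)) \<and>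
               (\<forall>\<xi>\<in>hyp_boundary X E' rt a. \<forall>\<eta>\<in>hyp_boundary X E' rt a.
                  (1 / C) * norm (\<Phi>' \<xi> - \<Phi>' \<eta>)
                    \<le> boundary_rho X E' rt a \<xi> \<eta> powr (- ln (min_ratio N \<rho>) / a) \<and>
                  boundary_rho X E' rt a \<xi> \<eta> powr (- ln (min_ratio N \<rho>) / a)
                    \<le> C * norm (\<Phi>' \<xi> - \<Phi>' \<eta>)))))"
proof -
  interpret self_similar_ifs N S \<rho> K using assms(1,2) by (rule self_similar_ifs.intro)
  obtain B M0 where "cell_system X rt lev Vt cell r0 B K M0"
    using cell_system_ifs[OF assms(3)] .
  then interpret c: cell_system X rt lev Vt cell r0 B K M0 .
  define E E' where "E = ifs_edges N S \<rho> K" and "E' = ifs_diamond_edges N S \<rho> K"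
  have "{(x, y) \<in> c.touch. x \<noteq> y} = horizontal_edges N S \<rho> K"
    unfolding c.touch_def horizontal_edges_def by auto
  then have G: "cell_graph X rt lev Vt cell r0 B K M0 E 1"
    using c.cell_graph_horizontal unfolding E_def ifs_edges_def by simp
  have "c.plus_edges = vertical_plus_edges N S \<rho> K"
    unfolding c.plus_edges_def vertical_plus_edges_def by auto
  then have G': "cell_graph X rt lev Vt cell r0 B K M0 E' 2"
    using c.cell_graph_diamond unfolding E'_def ifs_diamond_edges_def by simp
  obtain \<delta>1 where \<delta>1: "\<And>\<delta>. \<delta>1 \<le> \<delta> \<Longrightarrow> hyperbolic_graph X E rt \<delta>"
    using cell_graph.hyperbolic_G[OF G] by auto
  obtain \<delta>2 where \<delta>2: "\<And>\<delta>. \<delta>2 \<le> \<delta> \<Longrightarrow> hyperbolic_graph X E' rt \<delta>"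
    using cell_graph.hyperbolic_G[OF G'] by auto
  have hyp: "\<exists>\<delta>>0. hyperbolic_graph X E rt \<delta> \<and> hyperbolic_graph X E' rt \<delta>"
    by (intro exI[of _ "max 1 (max \<delta>1 \<delta>2)"] conjI \<delta>1 \<delta>2) auto
  have main: "top_of_set K homeomorphic_space hyp_boundary_topology X E rt a \<and>
      top_of_set K homeomorphic_space hyp_boundary_topology X E' rt a \<and>
      (condition_H N S \<rho> K \<longrightarrow>
        (\<exists>\<Phi> \<Phi>' C. C > 0 \<and>
          homeomorphic_map (hyp_boundary_topology X E rt a) (top_of_set K) \<Phi> \<and>
          homeomorphic_map (hyp_boundary_topology X E' rt a) (top_of_set K) \<Phi>' \<and>
          (\<forall>\<xi>\<in>hyp_boundary X E rt a. \<forall>\<eta>\<in>hyp_boundary X E rt a.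
             (1 / C) * norm (\<Phi> \<xi> - \<Phi> \<eta>) \<le> boundary_rho X E rt a \<xi> \<eta> powr (- ln r0 / a) \<and>
             boundary_rho X E rt a \<xi> \<eta> powr (- ln r0 / a) \<le> C * norm (\<Phi> \<xi> - \<Phi> \<eta>)) \<and>
          (\<forall>\<xi>\<in>hyp_boundary X E' rt a. \<forall>\<eta>\<in>hyp_boundary X E' rt a.
             (1 / C) * norm (\<Phi>' \<xi> - \<Phi>' \<eta>) \<le> boundary_rho X E' rt a \<xi> \<eta> powr (- ln r0 / a) \<and>
             boundary_rho X E' rt a \<xi> \<eta> powr (- ln r0 / a) \<le> C * norm (\<Phi>' \<xi> - \<Phi>' \<eta>))))"
    if \<delta>: "\<delta> > 0" "hyperbolic_graph X E rt \<delta>" "hyperbolic_graph X E' rt \<delta>"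
      and a: "a > 0" "exp (\<delta> * a) - 1 < sqrt 2 - 1" for \<delta> a
  proof -
    have small: "exp (\<delta> * a) < sqrt 2" using a(2) by simp
    obtain \<Phi> where \<Phi>: "homeomorphic_map (hyp_boundary_topology X E rt a) (top_of_set K) \<Phi>"
      "condition_H N S \<rho> K \<longrightarrow>
        (\<exists>C>0. \<forall>\<xi>\<in>hyp_boundary X E rt a. \<forall>\<eta>\<in>hyp_boundary X E rt a.
          norm (\<Phi> \<xi> - \<Phi> \<eta>) \<le> C * boundary_rho X E rt a \<xi> \<eta> powr (- ln r0 / a) \<and>
          boundary_rho X E rt a \<xi> \<eta> powr (- ln r0 / a) \<le> C * norm (\<Phi> \<xi> - \<Phi> \<eta>))"
      using boundary_homeomorphism[OF G \<delta>(2,1) a(1) small] by (elim exE conjE) (rule that)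
    obtain \<Phi>' where \<Phi>': "homeomorphic_map (hyp_boundary_topology X E' rt a) (top_of_set K) \<Phi>'"
      "condition_H N S \<rho> K \<longrightarrow>
        (\<exists>C>0. \<forall>\<xi>\<in>hyp_boundary X E' rt a. \<forall>\<eta>\<in>hyp_boundary X E' rt a.
          norm (\<Phi>' \<xi> - \<Phi>' \<eta>) \<le> C * boundary_rho X E' rt a \<xi> \<eta> powr (- ln r0 / a) \<and>
          boundary_rho X E' rt a \<xi> \<eta> powr (- ln r0 / a) \<le> C * norm (\<Phi>' \<xi> - \<Phi>' \<eta>))"
      using boundary_homeomorphism[OF G' \<delta>(3,1) a(1) small] by (elim exE conjE) (rule that)
    have both: "\<exists>\<Phi> \<Phi>' C. C > 0 \<and>
          homeomorphic_map (hyp_boundary_topology X E rt a) (top_of_set K) \<Phi> \<and>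
          homeomorphic_map (hyp_boundary_topology X E' rt a) (top_of_set K) \<Phi>' \<and>
          (\<forall>\<xi>\<in>hyp_boundary X E rt a. \<forall>\<eta>\<in>hyp_boundary X E rt a.
             (1 / C) * norm (\<Phi> \<xi> - \<Phi> \<eta>) \<le> boundary_rho X E rt a \<xi> \<eta> powr (- ln r0 / a) \<and>
             boundary_rho X E rt a \<xi> \<eta> powr (- ln r0 / a) \<le> C * norm (\<Phi> \<xi> - \<Phi> \<eta>)) \<and>
          (\<forall>\<xi>\<in>hyp_boundary X E' rt a. \<forall>\<eta>\<in>hyp_boundary X E' rt a.
             (1 / C) * norm (\<Phi>' \<xi> - \<Phi>' \<eta>) \<le> boundary_rho X E' rt a \<xi> \<eta> powr (- ln r0 / a) \<and>
             boundary_rho X E' rt a \<xi> \<eta> powr (- ln r0 / a) \<le> C * norm (\<Phi>' \<xi> - \<Phi>' \<eta>))"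
      if H: "condition_H N S \<rho> K"
    proof -
      from \<Phi>(2)[THEN mp, OF H] obtain C1 where C1: "C1 > 0" "\<forall>\<xi>\<in>hyp_boundary X E rt a. \<forall>\<eta>\<in>hyp_boundary X E rt a.
          norm (\<Phi> \<xi> - \<Phi> \<eta>) \<le> C1 * boundary_rho X E rt a \<xi> \<eta> powr (- ln r0 / a) \<and>
          boundary_rho X E rt a \<xi> \<eta> powr (- ln r0 / a) \<le> C1 * norm (\<Phi> \<xi> - \<Phi> \<eta>)" by auto
      from \<Phi>'(2)[THEN mp, OF H] obtain C2 where C2: "C2 > 0" "\<forall>\<xi>\<in>hyp_boundary X E' rt a. \<forall>\<eta>\<in>hyp_boundary X E' rt a.
          norm (\<Phi>' \<xi> - \<Phi>' \<eta>) \<le> C2 * boundary_rho X E' rt a \<xi> \<eta> powr (- ln r0 / a) \<and>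
          boundary_rho X E' rt a \<xi> \<eta> powr (- ln r0 / a) \<le> C2 * norm (\<Phi>' \<xi> - \<Phi>' \<eta>)" by auto
      \<comment> \<open>The theorem asks for one constant that serves both graphs.\<close>
      define C where "C = max C1 C2"
      have C: "C > 0" "C1 \<le> C" "C2 \<le> C" unfolding C_def using C1(1) by auto
      have *: "(1 / C) * s \<le> t \<and> t \<le> C * s" if "c \<le> C" "s \<le> c * t \<and> t \<le> c * s" "0 \<le> s" "0 \<le> t" for c s t :: real
      proof -
        have "s \<le> C * t" "t \<le> C * s"
          using that mult_right_mono[of c C t] mult_right_mono[of c C s] by linarith+
        then show ?thesis using C(1) by (simp add: pos_divide_le_eq mult.commute)
      qed
      have b1: "\<forall>\<xi>\<in>hyp_boundary X E rt a. \<forall>\<eta>\<in>hyp_boundary X E rt a.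
         (1 / C) * norm (\<Phi> \<xi> - \<Phi> \<eta>) \<le> boundary_rho X E rt a \<xi> \<eta> powr (- ln r0 / a) \<and>
         boundary_rho X E rt a \<xi> \<eta> powr (- ln r0 / a) \<le> C * norm (\<Phi> \<xi> - \<Phi> \<eta>)"
      proof (rule ballI, rule ballI)
        fix \<xi> \<eta> assume b: "\<xi> \<in> hyp_boundary X E rt a" "\<eta> \<in> hyp_boundary X E rt a"
        show "(1 / C) * norm (\<Phi> \<xi> - \<Phi> \<eta>) \<le> boundary_rho X E rt a \<xi> \<eta> powr (- ln r0 / a) \<and>
           boundary_rho X E rt a \<xi> \<eta> powr (- ln r0 / a) \<le> C * norm (\<Phi> \<xi> - \<Phi> \<eta>)"
          by (rule *[OF C(2) bspec[OF bspec[OF C1(2) b(1)] b(2)] norm_ge_zero powr_ge_zero])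
      qed
      have b2: "\<forall>\<xi>\<in>hyp_boundary X E' rt a. \<forall>\<eta>\<in>hyp_boundary X E' rt a.
         (1 / C) * norm (\<Phi>' \<xi> - \<Phi>' \<eta>) \<le> boundary_rho X E' rt a \<xi> \<eta> powr (- ln r0 / a) \<and>
         boundary_rho X E' rt a \<xi> \<eta> powr (- ln r0 / a) \<le> C * norm (\<Phi>' \<xi> - \<Phi>' \<eta>)"
      proof (rule ballI, rule ballI)
        fix \<xi> \<eta> assume b: "\<xi> \<in> hyp_boundary X E' rt a" "\<eta> \<in> hyp_boundary X E' rt a"
        show "(1 / C) * norm (\<Phi>' \<xi> - \<Phi>' \<eta>) \<le> boundary_rho X E' rt a \<xi> \<eta> powr (- ln r0 / a) \<and>
           boundary_rho X E' rt a \<xi> \<eta> powr (- ln r0 / a) \<le> C * norm (\<Phi>' \<xi> - \<Phi>' \<eta>)"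
          by (rule *[OF C(3) bspec[OF bspec[OF C2(2) b(1)] b(2)] norm_ge_zero powr_ge_zero])
      qed
      show ?thesis
        using C(1) \<Phi>(1) \<Phi>'(1) b1 b2 by (intro exI[of _ \<Phi>] exI[of _ \<Phi>'] exI[of _ C] conjI)
    qed
    have "top_of_set K homeomorphic_space hyp_boundary_topology X E rt a"
      "top_of_set K homeomorphic_space hyp_boundary_topology X E' rt a"
      using homeomorphic_map_imp_homeomorphic_space[OF \<Phi>(1)] homeomorphic_map_imp_homeomorphic_space[OF \<Phi>'(1)]
        homeomorphic_space_sym by auto
    then show ?thesis by (intro conjI impI both)
  qed
  show ?thesis
    unfolding Let_def E_def[symmetric] E'_def[symmetric]
  proof (rule conjI[OF hyp], intro allI impI, elim conjE)
  qed (rule main)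
qed

end
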